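(* For every $\beta\in(0,\alpha)$, $t>0$ and $x\in\mathbb{R}^d$, $$\int_{\mathbb{R}^d}\tilde p(t,x,y)|y|^\beta\,dy=|x|^\beta+(\kappa_\delta-\kappa_\beta)\int_0^t\int_{\mathbb{R}^d}\tilde p(s,x,y)|y|^{\beta-\alpha}\,dy\,ds.$$ In particular, $\int_{\mathbb{R}^d}\tilde p(t,x,y)|y|^\delta\,dy=|x|^\delta$ for all $t>0$, $x\in\mathbb{R}^d$.
   Context: Let $d\ge1$ be an integer, $\alpha\in(0,d\wedge2)$, $\delta\in(0,\alpha)$. Let $p(t,x,y)=p(t,x-y)$ be the heat kernel of $\Delta^{\alpha/2}=-(-\Delta)^{\alpha/2}$ on $\mathbb{R}^d$, i.e. the transition density of the rotationally symmetric $\alpha$-stable process $(X_t)$ (with $\int e^{i\xi\cdot z}p(t,z)dz=e^{-t|\xi|^\alpha}$). For $\beta\in(0,\alpha)$, $\kappa_\beta=\frac{2^\alpha\Gamma(\frac{\alpha-\beta}{2})\Gamma(\frac{d+\beta}{2})}{\Gamma(\frac{-\beta}{2})\Gamma(\frac{d+\beta-\alpha}{2})}$ with $\Gamma(-\beta/2)=\int_0^\infty r^{-1-\beta/2}(e^{-r}-1)dr$. Let $q(x)=\kappa_\delta|x|^{-\alpha}$. $\tilde p(t,x,y)$ is the symmetric kernel (satisfying Chapman–Kolmogorov) of the Feynman–Kac semigroup $\tilde P_tf(x)=\mathbb{E}^x[f(X_t)e^{\int_0^tq(X_s)ds}]$ for $x,y\ne0$, with $\tilde p(t,x,y)=0$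 if $x=0$ or $y=0$; it is the heat kernel of $\Delta^{\alpha/2}+q$. *)

theory Defs
  imports "HOL-Analysis.Analysis" "HOL-Probability.Probability"
begin

text \<open>Heat kernel p(t,z) of the fractional Laplacian on the Euclidean space 'a,
  given by Fourier inversion of exp(-t |xi|^alpha).\<close>
definition stable_kernel :: "real \<Rightarrow> real \<Rightarrow> 'a::euclidean_space \<Rightarrow> real" where
  "stable_kernel \<alpha> t z =
     (1 / (2 * pi) ^ DIM('a)) * (LINT \<xi>|lborel. exp (- t * norm \<xi> powr \<alpha>) * cos (\<xi> \<bullet> z))"

definition Gamma_neg_half :: "real \<Rightarrow> real" where
  "Gamma_neg_half \<beta> = (LINT r:{0<..}|lborel. r powr (-1 - \<beta>/2) * (exp (- r) - 1))"

definition kappa :: "nat \<Rightarrow> real \<Rightarrow> real \<Rightarrow> real" where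
  "kappa d \<alpha> \<beta> =
     2 powr \<alpha> * Gamma ((\<alpha> - \<beta>) / 2) * Gamma ((real d + \<beta>) / 2)
     / (Gamma_neg_half \<beta> * Gamma ((real d + \<beta> - \<alpha>) / 2))"

definition hardy_pot :: "real \<Rightarrow> real \<Rightarrow> 'a::euclidean_space \<Rightarrow> real" where
  "hardy_pot \<alpha> \<delta> x = kappa DIM('a) \<alpha> \<delta> / norm x powr \<alpha>"

definition stable_process ::
  "real \<Rightarrow> 'b measure \<Rightarrow> (real \<Rightarrow> 'b \<Rightarrow> 'a::euclidean_space) \<Rightarrow> 'a \<Rightarrow> bool" where
  "stable_process \<alpha> M X x \<longleftrightarrow>
     prob_space M \<and>
     (\<lambda>(s, \<omega>). X s \<omega>) \<in> borel_measurable (lborel \<Otimes>\<^sub>M M) \<and>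
     (AE \<omega> in M. X 0 \<omega> = x) \<and>
     (\<forall>s t. 0 \<le> s \<and> s < t \<longrightarrow>
        distributed M lborel (\<lambda>\<omega>. X t \<omega> - X s \<omega>) (\<lambda>z. ennreal (stable_kernel \<alpha> (t - s) z))) \<and>
     (\<forall>ts :: real list. sorted_wrt (<) ts \<and> ts \<noteq> [] \<and> hd ts \<ge> 0 \<longrightarrow>
        prob_space.indep_vars M (\<lambda>_. borel) (\<lambda>i \<omega>. X (ts ! Suc i) \<omega> - X (ts ! i) \<omega>)
          {..<length ts - 1})"

text \<open>Feynman-Kac weight exp(int_0^t q(X_s) ds); since q <= 0 here, a non-integrable
  integrand means the integral is -oo and the weight is 0.\<close>
definition fk_weight :: "('a \<Rightarrow> real) \<Rightarrow> (real \<Rightarrow> 'b \<Rightarrow> 'a) \<Rightarrow> real \<Rightarrow> 'b \<Rightarrow> real" where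
  "fk_weight q X t \<omega> =
     (if set_integrable lborel {0..t} (\<lambda>s. q (X s \<omega>))
      then exp (LINT s:{0..t}|lborel. q (X s \<omega>)) else 0)"

definition is_fk_kernel ::
  "real \<Rightarrow> real \<Rightarrow> (real \<Rightarrow> 'a::euclidean_space \<Rightarrow> 'a \<Rightarrow> real) \<Rightarrow> 'b itself \<Rightarrow> bool" where
  "is_fk_kernel \<alpha> \<delta> pt _ \<longleftrightarrow>
     (\<forall>t>0. \<forall>x y. pt t x y \<ge> 0) \<and>
     (\<forall>t>0. \<forall>x. pt t x \<in> borel_measurable borel) \<and>
     (\<forall>t>0. \<forall>x y. pt t x y = pt t y x) \<and>
     (\<forall>t>0. \<forall>y. pt t 0 y = 0 \<and> pt t y 0 = 0) \<and>
     (\<forall>s>0. \<forall>t>0. \<forall>x y. ennreal (pt (s + t) x y) =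
        (\<integral>\<^sup>+ z. ennreal (pt s x z * pt t z y) \<partial>lborel)) \<and>
     (\<forall>x. x \<noteq> 0 \<longrightarrow> (\<exists>(M :: 'b measure) X. stable_process \<alpha> M X x \<and>
        (\<forall>t>0. \<forall>f :: 'a \<Rightarrow> ennreal. f \<in> borel_measurable borel \<longrightarrow>
           (\<integral>\<^sup>+ y. f y * ennreal (pt t x y) \<partial>lborel) =
           (\<integral>\<^sup>+ \<omega>. f (X t \<omega>) * ennreal (fk_weight (hardy_pot \<alpha> \<delta>) X t \<omega>) \<partial>M))))"

end

theory Submission
  imports Defs
begin

text \<open>
  Let \<open>P\<^sub>t\<close> be the semigroup of the stable process and \<open>q = \<kappa>\<^sub>\<delta> |y|\<^bsup>-\<alpha>\<^esup> < 0\<close>.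

  Without potential, \<open>P\<^sub>t |.|\<^sup>\<beta> x = |x|\<^sup>\<beta> - \<kappa>\<^sub>\<beta> \<integral>\<^sub>0\<^sup>t P\<^sub>s |.|\<^bsup>\<beta>-\<alpha>\<^esup> x ds\<close>: both \<open>|y|\<^sup>\<beta>\<close> and \<open>|y|\<^bsup>\<beta>-\<alpha>\<^esup>\<close> are
  mixtures of Gaussians \<open>exp (- u |y|\<^sup>2)\<close>, on which \<open>P\<^sub>t\<close> acts explicitly on the Fourier side, and after
  integrating over \<open>u\<close> both \<open>P\<^sub>t |.|\<^sup>\<beta> x - |x|\<^sup>\<beta>\<close> and the time integral are multiples of
  \<open>\<integral> cos (\<xi> \<bullet> x) (1 - exp (- t |\<xi>|\<^sup>\<alpha>)) |\<xi>|\<^bsup>-d-\<beta>\<^esup> d\<xi>\<close>; the ratio of the constants is \<open>-\<kappa>\<^sub>\<beta>\<close>. Letting \<open>\<beta> \<rightarrow> 0\<close>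
  also shows \<open>E \<integral>\<^sub>0\<^sup>t |X\<^sub>s|\<^bsup>-\<alpha>\<^esup> ds < \<infinity>\<close> for a start away from \<open>0\<close>, so the weight
  \<open>A\<^sub>t = exp (\<integral>\<^sub>0\<^sup>t q (X\<^sub>s) ds)\<close> is almost surely positive.

  With potential, \<open>1 - A\<^sub>t = \<integral>\<^sub>0\<^sup>t |q (X\<^sub>s)| A\<^sub>s ds\<close> and the Markov property give Duhamel's formula
  \<open>E [f (X\<^sub>t) (1 - A\<^sub>t)] = \<integral>\<^sub>0\<^sup>t E [A\<^sub>s |q (X\<^sub>s)| P\<^bsub>t-s\<^esub> f (X\<^sub>s)] ds\<close>.  For \<open>f = |.|\<^sup>\<beta>\<close> insert the formula without potential for
  \<open>P\<^bsub>t-s\<^esub> f\<close> and apply Duhamel's formula backwards to \<open>|.|\<^bsup>\<beta>-\<alpha>\<^esup>\<close>.  All terms are nonnegative and finite, so the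
  result can be subtracted from the formula for \<open>E |X\<^sub>t|\<^sup>\<beta>\<close>.
\<close>

section \<open>Integrals over intervals and the half-line\<close>

lemma nn_integral_Icc_cong_Ioo:
  fixes a b :: real
  assumes "\<And>s. a < s \<Longrightarrow> s < b \<Longrightarrow> f s = g s"
  shows "(\<integral>\<^sup>+s\<in>{a..b}. f s \<partial>lborel) = (\<integral>\<^sup>+s\<in>{a..b}. g s \<partial>lborel)"
proof (rule nn_integral_cong_AE)
  have "AE s in lborel. s \<noteq> a" "AE s in lborel. s \<noteq> b" by (rule AE_lborel_singleton)+
  then show "AE s in lborel. f s * indicator {a..b} s = g s * indicator {a..b} s"
    by eventually_elim (auto simp: indicator_def assms)
qed

lemma borel_measurable_nn_integral_Icc:
  fixes a b :: "'w \<Rightarrow> real"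
  assumes [measurable]: "a \<in> borel_measurable N" "b \<in> borel_measurable N"
    "(\<lambda>(w, r). \<phi> w r) \<in> borel_measurable (N \<Otimes>\<^sub>M borel)"
  shows "(\<lambda>w. \<integral>\<^sup>+r\<in>{a w..b w}. \<phi> w r \<partial>lborel) \<in> borel_measurable N"
proof -
  have "(\<lambda>w. \<integral>\<^sup>+r. (if a w \<le> r \<and> r \<le> b w then \<phi> w r else 0) \<partial>lborel) \<in> borel_measurable N"
    by measurable
  also have "(\<lambda>w. \<integral>\<^sup>+r. (if a w \<le> r \<and> r \<le> b w then \<phi> w r else 0) \<partial>lborel) =
      (\<lambda>w. \<integral>\<^sup>+r\<in>{a w..b w}. \<phi> w r \<partial>lborel)"
    by (intro ext nn_integral_cong) (auto simp: indicator_def)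
  finally show ?thesis .
qed

lemma nn_integral_triangle:
  fixes \<phi> :: "real \<Rightarrow> real \<Rightarrow> ennreal"
  assumes [measurable]: "(\<lambda>(s, r). \<phi> s r) \<in> borel_measurable (borel \<Otimes>\<^sub>M borel)"
  shows "(\<integral>\<^sup>+s\<in>{0..t}. (\<integral>\<^sup>+r\<in>{0..t - s}. \<phi> s r \<partial>lborel) \<partial>lborel)
    = (\<integral>\<^sup>+u\<in>{0..t}. (\<integral>\<^sup>+s\<in>{0..u}. \<phi> s (u - s) \<partial>lborel) \<partial>lborel)"
proof -
  define \<psi> where "\<psi> s u = (if 0 \<le> s \<and> s \<le> u \<and> u \<le> t then \<phi> s (u - s) else 0)" for s u
  have [measurable]: "(\<lambda>(s, u). \<psi> s u) \<in> borel_measurable (borel \<Otimes>\<^sub>M borel)"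
    unfolding \<psi>_def by measurable
  have "(\<integral>\<^sup>+s\<in>{0..t}. (\<integral>\<^sup>+r\<in>{0..t - s}. \<phi> s r \<partial>lborel) \<partial>lborel) = (\<integral>\<^sup>+s. \<integral>\<^sup>+u. \<psi> s u \<partial>lborel \<partial>lborel)"
  proof (rule nn_integral_cong)
    fix s
    have "(\<integral>\<^sup>+u. \<psi> s u \<partial>lborel) = (\<integral>\<^sup>+r. \<psi> s (s + 1 * r) \<partial>lborel)"
      by (subst nn_integral_real_affine[where c = 1 and t = s]) auto
    also have "\<dots> = (\<integral>\<^sup>+r. \<phi> s r * indicator {0..t - s} r * indicator {0..t} s \<partial>lborel)"
      by (intro nn_integral_cong) (auto simp: \<psi>_def indicator_def)
    finally show "(\<integral>\<^sup>+r\<in>{0..t - s}. \<phi> s r \<partial>lborel) * indicator {0..t} s = (\<integral>\<^sup>+u. \<psi> s u \<partial>lborel)"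
      by (simp add: nn_integral_multc)
  qed
  also have "\<dots> = (\<integral>\<^sup>+u. \<integral>\<^sup>+s. \<psi> s u \<partial>lborel \<partial>lborel)"
    by (rule lborel_pair.Fubini'[symmetric]) measurable
  also have "\<dots> = (\<integral>\<^sup>+u\<in>{0..t}. (\<integral>\<^sup>+s\<in>{0..u}. \<phi> s (u - s) \<partial>lborel) \<partial>lborel)"
  proof (rule nn_integral_cong)
    fix u
    have "(\<integral>\<^sup>+s. \<psi> s u \<partial>lborel) = (\<integral>\<^sup>+s. \<phi> s (u - s) * indicator {0..u} s * indicator {0..t} u \<partial>lborel)"
      by (intro nn_integral_cong) (auto simp: \<psi>_def indicator_def)
    then show "(\<integral>\<^sup>+s. \<psi> s u \<partial>lborel) = (\<integral>\<^sup>+s\<in>{0..u}. \<phi> s (u - s) \<partial>lborel) * indicator {0..t} u"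
      by (simp add: nn_integral_multc)
  qed
  finally show ?thesis .
qed

lemma nn_integral_exp_Icc:
  fixes c t :: real
  assumes "c > 0" "t \<ge> 0"
  shows "(\<integral>\<^sup>+s\<in>{0..t}. ennreal (exp (- s * c)) \<partial>lborel) = ennreal ((1 - exp (- t * c)) / c)"
proof -
  have "(\<integral>\<^sup>+s\<in>{0..t}. ennreal (exp (- s * c)) \<partial>lborel) = ennreal (- exp (- t * c) / c - (- exp (- 0 * c) / c))"
    using assms by (intro nn_integral_FTC_Icc) (auto intro!: derivative_eq_intros)
  then show ?thesis by (simp add: diff_divide_distrib)
qed

lemma nn_integral_powr_Ici:
  fixes e a :: real
  assumes "e < -1" "a > 0"
  shows "(\<integral>\<^sup>+r\<in>{a..}. ennreal (r powr e) \<partial>lborel) = ennreal (- (a powr (e + 1)) / (e + 1))"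
  using nn_integral_has_integral_lebesgue[OF _ has_integral_powr_to_inf[OF assms]]
  by (simp add: nn_integral_set_ennreal mult.commute)

lemma nn_integral_powr_Icc_0:
  fixes e c :: real
  assumes "e > -1" "c \<ge> 0"
  shows "(\<integral>\<^sup>+r\<in>{0..c}. ennreal (r powr e) \<partial>lborel) = ennreal (c powr (e + 1) / (e + 1))"
  using nn_integral_has_integral_lebesgue[OF _ has_integral_powr_from_0[OF assms]]
  by (simp add: nn_integral_set_ennreal mult.commute)

lemma nn_integral_powr_min_finite:
  fixes p q C :: real
  assumes "p < -1" "-1 < p + q" "0 \<le> C"
  shows "(\<integral>\<^sup>+r\<in>{0<..}. ennreal (r powr p * min 1 (C * r powr q)) \<partial>lborel) < \<infinity>"
proof -
  have "(\<integral>\<^sup>+r\<in>{0<..}. ennreal (r powr p * min 1 (C * r powr q)) \<partial>lborel) \<le>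
      (\<integral>\<^sup>+r. ennreal C * (ennreal (r powr (p + q)) * indicator {0..1} r) +
        ennreal (r powr p) * indicator {1..} r \<partial>lborel)"
  proof (rule nn_integral_mono)
    fix r :: real
    have "r powr p * min 1 (C * r powr q) \<le> r powr p * 1"
      by (intro mult_left_mono) auto
    moreover have "r powr p * min 1 (C * r powr q) \<le> r powr p * (C * r powr q)"
      by (intro mult_left_mono) auto
    ultimately show "ennreal (r powr p * min 1 (C * r powr q)) * indicator {0<..} r \<le>
        ennreal C * (ennreal (r powr (p + q)) * indicator {0..1} r) + ennreal (r powr p) * indicator {1..} r"
      using \<open>0 \<le> C\<close>
      by (cases "r \<le> 1") (auto simp: indicator_def powr_add mult_ac
          simp flip: ennreal_mult intro!: add_increasing2 ennreal_leI)
  qed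
  also have "\<dots> < \<infinity>"
    using assms nn_integral_powr_Icc_0[of "p + q" 1] nn_integral_powr_Ici[of p 1]
    by (simp add: nn_integral_add nn_integral_cmult ennreal_mult_less_top)
  finally show ?thesis .
qed

lemma nn_integral_powr_scale:
  fixes h :: "real \<Rightarrow> ennreal"
  assumes [measurable]: "h \<in> borel_measurable borel" and "c > 0"
  shows "(\<integral>\<^sup>+r\<in>{0<..}. ennreal (r powr p) * h (c * r) \<partial>lborel)
    = ennreal (c powr (- p - 1)) * (\<integral>\<^sup>+r\<in>{0<..}. ennreal (r powr p) * h r \<partial>lborel)"
proof -
  define g where "g r = ennreal (r powr p) * h r * indicator {0<..} r" for r
  have [measurable]: "g \<in> borel_measurable borel" unfolding g_def by measurable
  have "ennreal (r powr p) * h (c * r) * indicator {0<..} r = ennreal (c powr (- p)) * g (c * r)" for r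
  proof (cases "r > 0")
    case True
    then have "r powr p = c powr (- p) * (c * r) powr p"
      using \<open>c > 0\<close> by (simp add: powr_mult powr_minus)
    then show ?thesis using True \<open>c > 0\<close> by (simp add: g_def ennreal_mult mult.assoc)
  qed (use \<open>c > 0\<close> in \<open>simp add: g_def zero_less_mult_iff\<close>)
  then have "(\<integral>\<^sup>+r\<in>{0<..}. ennreal (r powr p) * h (c * r) \<partial>lborel) =
      ennreal (c powr (- p)) * (\<integral>\<^sup>+r. g (c * r) \<partial>lborel)"
    by (simp add: nn_integral_cmult)
  also have "\<dots> = ennreal (c powr (- p - 1)) * (ennreal c * (\<integral>\<^sup>+r. g (0 + c * r) \<partial>lborel))"
    using \<open>c > 0\<close> by (simp add: mult.assoc[symmetric] powr_diff flip: ennreal_mult)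
  also have "ennreal c * (\<integral>\<^sup>+r. g (0 + c * r) \<partial>lborel) = (\<integral>\<^sup>+r. g r \<partial>lborel)"
    using \<open>c > 0\<close> by (subst nn_integral_real_affine[where f = g and c = c and t = 0]) auto
  finally show ?thesis by (simp add: g_def)
qed

lemma nn_integral_Gamma:
  fixes x c :: real
  assumes "x > 0" "c > 0"
  shows "(\<integral>\<^sup>+r\<in>{0<..}. ennreal (r powr (x - 1)) * ennreal (exp (- c * r)) \<partial>lborel) = ennreal (Gamma x * c powr (- x))"
proof -
  have "(\<integral>\<^sup>+r. ennreal (indicator {0..} r * (r powr (x - 1) / exp r)) \<partial>lborel) = ennreal (Gamma x)"
    by (rule nn_integral_has_integral_lebesgue[OF _ Gamma_integral_real[OF assms(1)]]) auto
  also have "(\<integral>\<^sup>+r. ennreal (indicator {0..} r * (r powr (x - 1) / exp r)) \<partial>lborel) =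
      (\<integral>\<^sup>+r\<in>{0<..}. ennreal (r powr (x - 1)) * ennreal (exp (- r)) \<partial>lborel)"
    by (intro nn_integral_cong) (auto simp: indicator_def exp_minus divide_inverse simp flip: ennreal_mult)
  finally show ?thesis
    using nn_integral_powr_scale[of "\<lambda>r. ennreal (exp (- r))" c "x - 1"] assms
    by (simp add: Gamma_real_nonneg mult.commute flip: ennreal_mult)
qed

lemma has_integral_inverse_substitution:
  fixes f :: "real \<Rightarrow> real"
  assumes nonneg: "\<And>r. 0 \<le> f r" and f: "(f has_integral I) {0<..}"
  shows "((\<lambda>r. f (1 / r) / r\<^sup>2) has_integral I) {0<..}"
proof -
  have image: "(\<lambda>r::real. 1 / r) ` {0<..} = {0<..}"
    by (auto simp: image_iff intro!: bexI[of _ "1 / _"])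
  have "f absolutely_integrable_on (\<lambda>r. 1 / r) ` {0<..} \<and> integral ((\<lambda>r. 1 / r) ` {0<..}) f = I"
    unfolding image using f nonneg
    by (auto intro!: nonnegative_absolutely_integrable_1 simp: has_integral_iff)
  also have "?this \<longleftrightarrow> (\<lambda>r. \<bar>- 1 / r\<^sup>2\<bar> * f (1 / r)) absolutely_integrable_on {0<..} \<and>
      integral {0<..} (\<lambda>r. \<bar>- 1 / r\<^sup>2\<bar> * f (1 / r)) = I"
    by (rule has_absolute_integral_change_of_variables_1'[symmetric])
      (auto intro!: derivative_eq_intros inj_onI simp: power2_eq_square field_simps)
  finally show ?thesis
    by (auto simp: has_integral_iff set_lebesgue_integral_eq_integral(1))
qed

lemma nn_integral_inverse_Gamma:
  fixes x c :: real
  assumes "x > 0" "c > 0"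
  shows "(\<integral>\<^sup>+r\<in>{0<..}. ennreal (r powr (- x - 1)) * ennreal (exp (- c / r)) \<partial>lborel) =
    ennreal (Gamma x * c powr (- x))"
proof -
  define f :: "real \<Rightarrow> real" where "f r = r powr (x - 1) * exp (- r)" for r
  have "(\<integral>\<^sup>+r. ennreal (indicator {0<..} r * f r) \<partial>lborel) =
      (\<integral>\<^sup>+r\<in>{0<..}. ennreal (r powr (x - 1)) * ennreal (exp (- 1 * r)) \<partial>lborel)"
    by (intro nn_integral_cong) (auto simp: indicator_def f_def ennreal_mult)
  also have "\<dots> = ennreal (Gamma x)"
    using nn_integral_Gamma[of x 1] assms(1) by simp
  finally have "((\<lambda>r. indicator {0<..} r * f r) has_integral Gamma x) UNIV"
    using assms(1) by (intro nn_integral_has_integral) (auto simp: f_def Gamma_real_nonneg)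
  then have "(f has_integral Gamma x) {0<..}"
    by (simp add: indicator_times_eq_if has_integral_restrict_UNIV flip: greaterThan_iff)
  then have "((\<lambda>r. f (1 / r) / r\<^sup>2) has_integral Gamma x) {0<..}"
    by (intro has_integral_inverse_substitution) (auto simp: f_def[abs_def])
  then have "(\<integral>\<^sup>+r. ennreal (indicator {0<..} r * (f (1 / r) / r\<^sup>2)) \<partial>lborel) = ennreal (Gamma x)"
    by (intro nn_integral_has_integral_lebesgue) (auto simp: f_def)
  also have "(\<integral>\<^sup>+r. ennreal (indicator {0<..} r * (f (1 / r) / r\<^sup>2)) \<partial>lborel) =
      (\<integral>\<^sup>+r\<in>{0<..}. ennreal (r powr (- x - 1)) * ennreal (exp (- 1 / r)) \<partial>lborel)"
  proof (rule nn_integral_cong)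
    fix r :: real
    have "f (1 / r) / r\<^sup>2 = r powr (- x - 1) * exp (- 1 / r)" if "r > 0"
      using that by (simp add: f_def powr_divide powr_diff powr_minus power2_eq_square field_simps)
    then show "ennreal (indicator {0<..} r * (f (1 / r) / r\<^sup>2)) =
        ennreal (r powr (- x - 1)) * ennreal (exp (- 1 / r)) * indicator {0<..} r"
      by (auto simp: indicator_def simp flip: ennreal_mult)
  qed
  finally show ?thesis
    using nn_integral_powr_scale[of "\<lambda>r. ennreal (exp (- 1 / r))" "1 / c" "- x - 1"] assms
    by (simp add: Gamma_real_nonneg powr_divide powr_minus_divide mult.commute flip: ennreal_mult)
qed

lemma nn_integral_compensated_Gamma:
  fixes b :: real
  assumes "0 < b" "b < 1"
  shows "(\<integral>\<^sup>+r\<in>{0<..}. ennreal (r powr (- b - 1)) * ennreal (1 - exp (- r)) \<partial>lborel) = ennreal (Gamma (1 - b) / b)"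
proof -
  define \<phi> where "\<phi> r s = (if 0 < s \<and> s \<le> r then ennreal (r powr (- b - 1)) *
      ennreal (exp (- s)) else 0)" for r s :: real
  have [measurable]: "(\<lambda>(r, s). \<phi> r s) \<in> borel_measurable (borel \<Otimes>\<^sub>M borel)"
    unfolding \<phi>_def by measurable
  have "(\<integral>\<^sup>+r\<in>{0<..}. ennreal (r powr (- b - 1)) * ennreal (1 - exp (- r)) \<partial>lborel) =
      (\<integral>\<^sup>+r. \<integral>\<^sup>+s. \<phi> r s \<partial>lborel \<partial>lborel)"
  proof (rule nn_integral_cong)
    fix r :: real
    have \<phi>_nonpos: "\<phi> r = (\<lambda>s. 0)" if "\<not> 0 < r"
      using that by (auto simp: \<phi>_def fun_eq_iff)
    have "(\<integral>\<^sup>+s. \<phi> r s \<partial>lborel) = (\<integral>\<^sup>+s\<in>{0..r}. \<phi> r s \<partial>lborel)"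
      by (intro nn_integral_cong) (auto simp: \<phi>_def indicator_def)
    also have "\<dots> = (\<integral>\<^sup>+s\<in>{0..r}. ennreal (r powr (- b - 1)) * ennreal (exp (- s * 1)) \<partial>lborel)"
      by (rule nn_integral_Icc_cong_Ioo) (simp add: \<phi>_def)
    also have "\<dots> = ennreal (r powr (- b - 1)) * (\<integral>\<^sup>+s\<in>{0..r}. ennreal (exp (- s * 1)) \<partial>lborel)"
      by (simp add: mult.assoc nn_integral_cmult)
    finally show "ennreal (r powr (- b - 1)) * ennreal (1 - exp (- r)) * indicator {0<..} r = (\<integral>\<^sup>+s. \<phi> r s \<partial>lborel)"
      using nn_integral_exp_Icc[of 1 r] \<phi>_nonpos by (cases "r > 0") auto
  qed
  also have "\<dots> = (\<integral>\<^sup>+s. \<integral>\<^sup>+r. \<phi> r s \<partial>lborel \<partial>lborel)"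
    by (rule lborel_pair.Fubini'[symmetric]) measurable
  also have "\<dots> = (\<integral>\<^sup>+s\<in>{0<..}. ennreal (1 / b) * (ennreal (s powr ((1 - b) - 1)) * ennreal (exp (- 1 * s))) \<partial>lborel)"
  proof (rule nn_integral_cong)
    fix s :: real
    have "(\<integral>\<^sup>+r. \<phi> r s \<partial>lborel) = (\<integral>\<^sup>+r\<in>{s..}. ennreal (r powr (- b - 1)) *
        ennreal (exp (- s)) * indicator {0<..} s \<partial>lborel)"
      by (intro nn_integral_cong) (auto simp: \<phi>_def indicator_def)
    also have "\<dots> = (\<integral>\<^sup>+r\<in>{s..}. ennreal (r powr (- b - 1)) \<partial>lborel) * (ennreal (exp (- s)) * indicator {0<..} s)"
      by (subst nn_integral_multc[symmetric]) (auto simp: mult_ac)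
    finally show "(\<integral>\<^sup>+r. \<phi> r s \<partial>lborel) =
        ennreal (1 / b) * (ennreal (s powr ((1 - b) - 1)) * ennreal (exp (- 1 * s))) * indicator {0<..} s"
      using nn_integral_powr_Ici[of "- b - 1" s] assms
      by (cases "s > 0") (auto simp: mult_ac simp flip: ennreal_mult)
  qed
  also have "\<dots> = ennreal (1 / b) * ennreal (Gamma (1 - b))"
    using nn_integral_Gamma[of "1 - b" 1] assms by (simp add: mult.assoc nn_integral_cmult)
  finally show ?thesis using assms by (simp add: Gamma_real_nonneg flip: ennreal_mult)
qed

lemma Gamma_neg_half_eq:
  assumes "0 < \<beta>" "\<beta> < 2"
  shows "Gamma_neg_half \<beta> = - (2 / \<beta>) * Gamma (1 - \<beta> / 2)"
proof -
  have exponent: "- 1 - \<beta> / 2 = - \<beta> / 2 - 1" by simp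
  have "Gamma_neg_half \<beta> = - (LINT r|lborel. indicator {0<..} r * (r powr (- \<beta> / 2 - 1) * (1 - exp (- r))))"
    unfolding Gamma_neg_half_def set_lebesgue_integral_def exponent
    by (subst integral_minus[symmetric], rule Bochner_Integration.integral_cong)
      (auto simp: algebra_simps indicator_def)
  also have "(LINT r|lborel. indicator {0<..} r * (r powr (- \<beta> / 2 - 1) * (1 - exp (- r)))) =
      enn2real (\<integral>\<^sup>+r\<in>{0<..}. ennreal (r powr (- \<beta> / 2 - 1)) * ennreal (1 - exp (- r)) \<partial>lborel)"
    by (subst integral_eq_nn_integral)
      (auto simp: indicator_def intro!: arg_cong[where f = enn2real] nn_integral_cong simp flip: ennreal_mult)
  also have "\<dots> = Gamma (1 - \<beta> / 2) / (\<beta> / 2)"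
    using nn_integral_compensated_Gamma[of "\<beta> / 2"] assms by (simp add: Gamma_real_nonneg)
  finally show ?thesis by simp
qed

lemma Gamma_neg_half_neg: "0 < \<beta> \<Longrightarrow> \<beta> < 2 \<Longrightarrow> Gamma_neg_half \<beta> < 0"
  by (simp add: Gamma_neg_half_eq Gamma_real_pos)

lemma nn_integral_compensated_Gamma_scaled:
  assumes "0 < \<beta>" "\<beta> < 2" "c \<ge> 0"
  shows "(\<integral>\<^sup>+r\<in>{0<..}. ennreal (r powr (- \<beta> / 2 - 1)) * ennreal (1 - exp (- r * c\<^sup>2)) \<partial>lborel) =
    ennreal (- Gamma_neg_half \<beta> * c powr \<beta>)"
proof (cases "c = 0")
  case False
  then have "c > 0" using assms by simp
  then have "(c\<^sup>2) powr (- (- \<beta> / 2 - 1) - 1) = c powr \<beta>"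
    by (simp add: powr_numeral[symmetric] powr_powr del: powr_numeral)
  then show ?thesis
    using nn_integral_powr_scale[of "\<lambda>r. ennreal (1 - exp (- r))" "c\<^sup>2" "- \<beta> / 2 - 1"] \<open>c > 0\<close> assms
      nn_integral_compensated_Gamma[of "\<beta> / 2"]
    by (simp add: Gamma_neg_half_eq mult_ac Gamma_real_nonneg flip: ennreal_mult)
qed simp

section \<open>The Gaussian heat kernel\<close>

lemma powr_le_exp:
  fixes c y :: real
  assumes "c > 0" "y \<ge> 0"
  shows "y powr c \<le> c powr c * exp y"
proof -
  have "y / c \<le> exp (y / c)"
    using exp_ge_add_one_self[of "y / c"] by linarith
  then have "(y / c) powr c \<le> exp (y / c) powr c"
    using assms by (intro powr_mono2) auto
  then show ?thesis
    using assms by (simp add: powr_divide exp_powr_real field_simps)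
qed

lemma power2_norm_eq_sum_Basis: "(norm z)\<^sup>2 = (\<Sum>b\<in>Basis. (z \<bullet> b)\<^sup>2)"
  for z :: "'a::euclidean_space"
  by (subst power2_norm_eq_inner, subst euclidean_inner) (simp add: power2_eq_square)

lemma borel_measurable_cis [measurable]: "cis \<in> borel_measurable borel"
  by (intro borel_measurable_continuous_onI continuous_intros)

lemma
  fixes f :: "'a::euclidean_space \<Rightarrow> real \<Rightarrow> 'b::{real_normed_field,banach,second_countable_topology}"
  assumes int: "\<And>b. b \<in> Basis \<Longrightarrow> integrable lborel (f b)"
  shows integral_lborel_prod: "(LINT z|lborel. (\<Prod>b\<in>Basis. f b (z \<bullet> b))) = (\<Prod>b\<in>Basis. LINT s|lborel. f b s)"
    and integrable_lborel_prod: "integrable lborel (\<lambda>z::'a. \<Prod>b\<in>Basis. f b (z \<bullet> b))"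
proof -
  interpret product_sigma_finite "\<lambda>b::'a. lborel :: real measure"
    by standard
  have [measurable]: "b \<in> Basis \<Longrightarrow> f b \<in> borel_measurable borel" for b
    using borel_measurable_integrable[OF int[of b]] by simp
  have meas: "(\<lambda>z::'a. \<Prod>b\<in>Basis. f b (z \<bullet> b)) \<in> borel_measurable borel"
    by measurable
  have coords: "(\<Prod>b\<in>Basis. f b ((\<Sum>b\<in>Basis. g b *\<^sub>R b) \<bullet> b)) = (\<Prod>b\<in>Basis. f b (g b))" for g
    by (intro prod.cong) auto
  show "(LINT z|lborel. (\<Prod>b\<in>Basis. f b (z \<bullet> b))) = (\<Prod>b\<in>Basis. LINT s|lborel. f b s)"
    using meas product_integral_prod[OF finite_Basis int]
    by (subst lborel_eq, subst integral_distr) (simp_all add: coords)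
  show "integrable lborel (\<lambda>z::'a. \<Prod>b\<in>Basis. f b (z \<bullet> b))"
    using meas product_integrable_prod[OF finite_Basis int]
    by (subst lborel_eq, subst integrable_distr_eq) (simp_all add: coords)
qed

lemma
  fixes \<sigma> t :: real
  assumes "\<sigma> > 0"
  shows normal_density_cis_integrable: "integrable lborel (\<lambda>s. complex_of_real (normal_density 0 \<sigma> s) * cis (s * t))"
    and normal_density_cis_integral: "(LINT s|lborel. complex_of_real (normal_density 0 \<sigma> s) * cis (s * t))
      = complex_of_real (exp (- (\<sigma> * t)\<^sup>2 / 2))"
proof -
  let ?f = "\<lambda>s. complex_of_real (normal_density 0 \<sigma> s) * cis (s * t)"
  show "integrable lborel ?f"
    by (rule Bochner_Integration.integrable_bound[OF integrable_normal_density[OF assms]]) (auto simp: norm_mult)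
  have "(LINT s|lborel. ?f s) = \<bar>\<sigma>\<bar> *\<^sub>R (LINT s|lborel. ?f (0 + \<sigma> * s))"
    using assms by (intro lborel_integral_real_affine) simp
  also have "\<dots> = (LINT s|lborel. std_normal_density s *\<^sub>R iexp (\<sigma> * t * s))"
    using assms
    by (subst integral_scaleR_right[symmetric])
      (auto simp: normal_density_def scaleR_conv_of_real cis_conv_exp power_mult_distrib real_sqrt_mult mult_ac
        intro!: Bochner_Integration.integral_cong)
  also have "\<dots> = char std_normal_distribution (\<sigma> * t)"
    unfolding char_def by (subst integral_density) auto
  finally show "(LINT s|lborel. ?f s) = complex_of_real (exp (- (\<sigma> * t)\<^sup>2 / 2))"
    by (simp add: char_std_normal_distribution)
qed

definition heat_kernel :: "real \<Rightarrow> 'a::euclidean_space \<Rightarrow> real" where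
  "heat_kernel u \<xi> = (4 * pi * u) powr (- (real DIM('a) / 2)) * exp (- (norm \<xi>)\<^sup>2 / (4 * u))"

lemma heat_kernel_nonneg [simp]: "0 \<le> heat_kernel u \<xi>"
  by (simp add: heat_kernel_def)

lemma borel_measurable_heat_kernel [measurable]:
  assumes [measurable]: "f \<in> borel_measurable M" "g \<in> borel_measurable M"
  shows "(\<lambda>w. heat_kernel (f w) (g w :: 'a::euclidean_space)) \<in> borel_measurable M"
  unfolding heat_kernel_def by measurable

lemma heat_kernel_eq_prod:
  fixes \<xi> :: "'a::euclidean_space"
  assumes "u > 0"
  shows "heat_kernel u \<xi> = (\<Prod>b\<in>Basis. normal_density 0 (sqrt (2 * u)) (\<xi> \<bullet> b))"
proof -
  have "(4 * pi * u) powr (- (real DIM('a) / 2)) = (1 / sqrt (4 * pi * u)) ^ DIM('a)"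
    using assms by (simp add: powr_half_sqrt[symmetric] powr_realpow[symmetric] powr_powr
        powr_minus_divide powr_divide)
  moreover have "exp (- (norm \<xi>)\<^sup>2 / (4 * u)) = (\<Prod>b\<in>Basis. exp (- (\<xi> \<bullet> b)\<^sup>2 / (4 * u)))"
    by (simp add: power2_norm_eq_sum_Basis sum_divide_distrib exp_sum[symmetric] sum_negf)
  ultimately show ?thesis
    using assms by (simp add: heat_kernel_def normal_density_def prod_dividef power_divide mult_ac)
qed

lemma
  fixes x :: "'a::euclidean_space"
  assumes "u > 0"
  shows heat_kernel_cis_integrable: "integrable lborel (\<lambda>\<xi>. complex_of_real (heat_kernel u \<xi>) * cis (\<xi> \<bullet> x))"
    and heat_kernel_cis_integral: "(LINT \<xi>|lborel. complex_of_real (heat_kernel u \<xi>) * cis (\<xi> \<bullet> x))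
      = complex_of_real (exp (- u * (norm x)\<^sup>2))"
proof -
  define f where "f b s = complex_of_real (normal_density 0 (sqrt (2 * u)) s) * cis (s * (x \<bullet> b))" for b s
  have cis_prod: "cis (\<xi> \<bullet> x) = (\<Prod>b\<in>Basis. cis ((\<xi> \<bullet> b) * (x \<bullet> b)))" for \<xi> :: 'a
    by (subst euclidean_inner) (simp add: cis_conv_exp sum_distrib_left exp_sum[symmetric])
  have prod: "complex_of_real (heat_kernel u \<xi>) * cis (\<xi> \<bullet> x) = (\<Prod>b\<in>Basis. f b (\<xi> \<bullet> b))" for \<xi>
    using assms by (simp add: heat_kernel_eq_prod cis_prod f_def prod.distrib)
  have int: "integrable lborel (f b)" for b
    using assms unfolding f_def by (intro normal_density_cis_integrable) simp
  show "integrable lborel (\<lambda>\<xi>. complex_of_real (heat_kernel u \<xi>) * cis (\<xi> \<bullet> x))"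
    unfolding prod by (rule integrable_lborel_prod[OF int])
  have "(LINT \<xi>|lborel. complex_of_real (heat_kernel u \<xi>) * cis (\<xi> \<bullet> x)) = (\<Prod>b\<in>Basis. LINT s|lborel. f b s)"
    unfolding prod by (rule integral_lborel_prod[OF int])
  also have "\<dots> = (\<Prod>b\<in>Basis. complex_of_real (exp (- u * (x \<bullet> b)\<^sup>2)))"
    using assms by (simp add: f_def normal_density_cis_integral power_mult_distrib)
  also have "\<dots> = complex_of_real (exp (- u * (norm x)\<^sup>2))"
    by (simp add: power2_norm_eq_sum_Basis sum_distrib_left flip: of_real_prod exp_sum sum_negf)
  finally show "(LINT \<xi>|lborel. complex_of_real (heat_kernel u \<xi>) * cis (\<xi> \<bullet> x))
      = complex_of_real (exp (- u * (norm x)\<^sup>2))" .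
qed

lemma heat_kernel_cos_integral:
  fixes x :: "'a::euclidean_space"
  assumes "u > 0"
  shows "(LINT \<xi>|lborel. cos (\<xi> \<bullet> x) * heat_kernel u \<xi>) = exp (- u * (norm x)\<^sup>2)"
  using integral_Re[OF heat_kernel_cis_integrable[OF assms, of x]] heat_kernel_cis_integral[OF assms, of x]
  by (simp add: mult.commute)

lemma heat_kernel_sin_integral:
  fixes x :: "'a::euclidean_space"
  assumes "u > 0"
  shows "(LINT \<xi>|lborel. sin (\<xi> \<bullet> x) * heat_kernel u \<xi>) = 0"
  using integral_Im[OF heat_kernel_cis_integrable[OF assms, of x]] heat_kernel_cis_integral[OF assms, of x]
  by (simp add: mult.commute)

lemma heat_kernel_integrable:
  assumes "u > 0"
  shows "integrable lborel (heat_kernel u :: 'a::euclidean_space \<Rightarrow> real)"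
  using integrable_Re[OF heat_kernel_cis_integrable[OF assms, of "0::'a"]] by simp

lemma heat_kernel_integral: "u > 0 \<Longrightarrow> (LINT \<xi>|lborel. heat_kernel u (\<xi>::'a::euclidean_space)) = 1"
  using heat_kernel_cos_integral[of u "0::'a"] by simp

lemma nn_integral_heat_kernel: "u > 0 \<Longrightarrow> (\<integral>\<^sup>+\<xi>. ennreal (heat_kernel u (\<xi>::'a::euclidean_space)) \<partial>lborel) = 1"
  by (simp add: nn_integral_eq_integral heat_kernel_integrable heat_kernel_integral)

lemma heat_kernel_bounded_integrable:
  fixes f :: "'a::euclidean_space \<Rightarrow> real"
  assumes "u > 0" and [measurable]: "f \<in> borel_measurable borel" and "\<And>\<xi>. \<bar>f \<xi>\<bar> \<le> 1"
  shows "integrable lborel (\<lambda>\<xi>. f \<xi> * heat_kernel u \<xi>)"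
  using heat_kernel_integrable[OF assms(1)]
  by (rule Bochner_Integration.integrable_bound) (use assms(3) in \<open>auto simp: abs_mult mult_left_le_one_le\<close>)

lemma gaussian_eq_heat_kernel:
  fixes z :: "'a::euclidean_space"
  assumes "u > 0"
  shows "exp (- u * (norm z)\<^sup>2) = (pi / u) powr (DIM('a) / 2) * heat_kernel (1 / (4 * u)) z"
  using assms by (simp add: heat_kernel_def powr_minus_divide)

lemma integrable_lborel_translate_iff:
  fixes c :: "'a::euclidean_space" and f :: "'a \<Rightarrow> 'b::{banach,second_countable_topology}"
  assumes [measurable]: "f \<in> borel_measurable borel"
  shows "integrable lborel (\<lambda>z. f (c + z)) \<longleftrightarrow> integrable lborel f"
  using integrable_distr_eq[of "(+) c" lborel borel f] by (simp add: lborel_distr_plus)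

lemma integral_lborel_translate:
  fixes c :: "'a::euclidean_space" and f :: "'a \<Rightarrow> 'b::{banach,second_countable_topology}"
  assumes [measurable]: "f \<in> borel_measurable borel"
  shows "(LINT z|lborel. f (c + z)) = (LINT z|lborel. f z)"
  using integral_distr[of "(+) c" lborel borel f] by (simp add: lborel_distr_plus)

lemma gaussian_translate_integrable:
  assumes "u > 0"
  shows "integrable lborel (\<lambda>z::'a::euclidean_space. exp (- u * (norm (x + z))\<^sup>2))"
  unfolding gaussian_eq_heat_kernel[OF assms] using assms
  by (intro integrable_mult_right) (simp add: integrable_lborel_translate_iff heat_kernel_integrable)

lemma gaussian_translate_cos_integral:
  fixes x \<xi> :: "'a::euclidean_space"
  assumes u: "u > 0"
  shows "(LINT z|lborel. exp (- u * (norm (x + z))\<^sup>2) * cos (\<xi> \<bullet> z))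
    = (2 * pi) ^ DIM('a) * (cos (\<xi> \<bullet> x) * heat_kernel u \<xi>)"
proof -
  define v where "v = 1 / (4 * u)"
  have v: "v > 0" using u by (simp add: v_def)
  have "(LINT z|lborel. heat_kernel v (x + z) * cos (\<xi> \<bullet> z)) = (LINT y|lborel. heat_kernel v y * cos (\<xi> \<bullet> (y - x)))"
    using integral_lborel_translate[of "\<lambda>y. heat_kernel v y * cos (\<xi> \<bullet> (y - x))" x] by simp
  also have "\<dots> = (LINT y|lborel. cos (\<xi> \<bullet> x) * (cos (y \<bullet> \<xi>) * heat_kernel v y) +
      sin (\<xi> \<bullet> x) * (sin (y \<bullet> \<xi>) * heat_kernel v y))"
    by (simp add: inner_diff_right cos_diff algebra_simps inner_commute)
  also have "\<dots> = cos (\<xi> \<bullet> x) * exp (- v * (norm \<xi>)\<^sup>2)"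
    using v by (subst Bochner_Integration.integral_add)
      (auto simp: heat_kernel_cos_integral heat_kernel_sin_integral
          intro!: integrable_mult_right heat_kernel_bounded_integrable)
  finally have "(LINT z|lborel. exp (- u * (norm (x + z))\<^sup>2) * cos (\<xi> \<bullet> z)) =
      (pi / u) powr (DIM('a) / 2) * (cos (\<xi> \<bullet> x) * exp (- v * (norm \<xi>)\<^sup>2))"
    unfolding gaussian_eq_heat_kernel[OF u] v_def mult.assoc by simp
  also have "(pi / u) powr (DIM('a) / 2) = (2 * pi) ^ DIM('a) * (4 * pi * u) powr (- (real DIM('a) / 2))"
  proof -
    have "(2 * pi) ^ DIM('a) = (2 * pi) powr DIM('a)"
      by (rule powr_realpow[symmetric]) simp
    also have "\<dots> = ((2 * pi) powr 2) powr (DIM('a) / 2)"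
      unfolding powr_powr by simp
    also have "(2 * pi) powr 2 = (2 * pi)\<^sup>2"
      by (rule powr_numeral) simp
    finally have "(2 * pi) ^ DIM('a) = ((2 * pi)\<^sup>2) powr (DIM('a) / 2)" .
    moreover have "(2 * pi)\<^sup>2 / (4 * pi * u) = pi / u"
      using u by (simp add: power2_eq_square)
    ultimately show ?thesis
      using u by (simp add: powr_minus_divide flip: powr_divide)
  qed
  finally show ?thesis by (simp add: heat_kernel_def v_def mult_ac)
qed

lemma heat_kernel_moment_le:
  fixes a r :: real
  assumes "a > 0" "r > 0"
  shows "(\<integral>\<^sup>+\<xi>. ennreal (norm (\<xi>::'a::euclidean_space) powr a) * ennreal (heat_kernel r \<xi>) \<partial>lborel)
    \<le> ennreal ((4 * a) powr (a / 2) * 2 powr (DIM('a) / 2) * r powr (a / 2))"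
proof -
  define C where "C = (4 * a) powr (a / 2) * 2 powr (DIM('a) / 2) * r powr (a / 2)"
  have "norm \<xi> powr a * heat_kernel r \<xi> \<le> C * heat_kernel (2 * r) \<xi>" for \<xi> :: 'a
  proof -
    define y where "y = (norm \<xi>)\<^sup>2 / (8 * r)"
    have "norm \<xi> powr a = ((norm \<xi>)\<^sup>2) powr (a / 2)"
      by (cases "\<xi> = 0") (simp_all add: powr_powr flip: powr_numeral)
    also have "\<dots> = (8 * r) powr (a / 2) * y powr (a / 2)"
      using assms by (simp add: y_def powr_divide)
    also have "\<dots> \<le> (8 * r) powr (a / 2) * ((a / 2) powr (a / 2) * exp y)"
      using assms by (intro mult_left_mono powr_le_exp) (auto simp: y_def)
    also have "\<dots> = (4 * a) powr (a / 2) * r powr (a / 2) * exp y"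
      using assms by (simp flip: powr_mult mult.assoc)
    finally have "norm \<xi> powr a * heat_kernel r \<xi> \<le>
        (4 * a) powr (a / 2) * r powr (a / 2) * (exp y * heat_kernel r \<xi>)"
      unfolding mult.assoc[symmetric] by (rule mult_right_mono) simp
    also have "exp y * heat_kernel r \<xi> = 2 powr (DIM('a) / 2) * heat_kernel (2 * r) \<xi>"
    proof -
      have "(4 * pi * (2 * r)) powr (- (real DIM('a) / 2)) =
          2 powr (- (real DIM('a) / 2)) * (4 * pi * r) powr (- (real DIM('a) / 2))"
        by (subst mult.left_commute, subst powr_mult) (use assms in auto)
      moreover have "(2::real) powr (DIM('a) / 2) * 2 powr (- (real DIM('a) / 2)) = 1"
        by (simp flip: powr_add)
      moreover have "exp y * exp (- (norm \<xi>)\<^sup>2 / (4 * r)) = exp (- (norm \<xi>)\<^sup>2 / (4 * (2 * r)))"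
        using assms by (simp add: y_def field_simps flip: exp_add)
      ultimately show ?thesis by (simp add: heat_kernel_def)
    qed
    finally show ?thesis by (simp add: C_def mult_ac)
  qed
  then have "(\<integral>\<^sup>+\<xi>. ennreal (norm (\<xi>::'a) powr a) * ennreal (heat_kernel r \<xi>) \<partial>lborel) \<le>
      (\<integral>\<^sup>+\<xi>. ennreal C * ennreal (heat_kernel (2 * r) (\<xi>::'a)) \<partial>lborel)"
    by (intro nn_integral_mono) (auto simp: C_def simp flip: ennreal_mult intro!: ennreal_leI)
  also have "\<dots> = ennreal C"
    using assms by (simp add: nn_integral_cmult nn_integral_heat_kernel)
  finally show ?thesis by (simp add: C_def)
qed

definition riesz_const :: "nat \<Rightarrow> real \<Rightarrow> real" where
  "riesz_const d a = (4 * pi) powr (- (real d / 2)) * 4 powr a * Gamma a"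

lemma riesz_const_pos: "a > 0 \<Longrightarrow> riesz_const d a > 0"
  by (simp add: riesz_const_def Gamma_real_pos)

lemma nn_integral_heat_kernel_mixture:
  fixes \<xi> :: "'a::euclidean_space" and a :: real
  assumes "a > 0" "\<xi> \<noteq> 0"
  shows "(\<integral>\<^sup>+r\<in>{0<..}. ennreal (r powr (DIM('a) / 2 - a - 1)) * ennreal (heat_kernel r \<xi>) \<partial>lborel)
    = ennreal (riesz_const DIM('a) a * norm \<xi> powr (- 2 * a))"
proof -
  define c where "c = (4 * pi) powr (- (real DIM('a) / 2))"
  define s where "s = (norm \<xi>)\<^sup>2 / 4"
  have "s > 0" using assms by (simp add: s_def)
  have "r powr (DIM('a) / 2 - a - 1) * heat_kernel r \<xi> = c * (r powr (- a - 1) * exp (- s / r))" if "r > 0" for r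
  proof -
    have "r powr (DIM('a) / 2 - a - 1) * r powr (- (real DIM('a) / 2)) = r powr (- a - 1)"
      unfolding powr_add[symmetric] by simp
    then show ?thesis
      using that by (simp add: heat_kernel_def c_def s_def powr_mult mult_ac)
  qed
  then have "(\<integral>\<^sup>+r\<in>{0<..}. ennreal (r powr (DIM('a) / 2 - a - 1)) * ennreal (heat_kernel r \<xi>) \<partial>lborel)
      = (\<integral>\<^sup>+r. ennreal c * (ennreal (r powr (- a - 1)) * ennreal (exp (- s / r)) * indicator {0<..} r) \<partial>lborel)"
    by (intro nn_integral_cong) (auto simp: indicator_def c_def simp flip: ennreal_mult)
  also have "\<dots> = ennreal (c * (Gamma a * s powr (- a)))"
    using assms nn_integral_inverse_Gamma[OF assms(1) \<open>s > 0\<close>]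
    by (simp add: nn_integral_cmult c_def Gamma_real_nonneg ennreal_mult)
  also have "s powr (- a) = 4 powr a * norm \<xi> powr (- 2 * a)"
  proof -
    have "((norm \<xi>)\<^sup>2) powr a = norm \<xi> powr (2 * a)"
      using assms by (simp add: powr_powr flip: powr_numeral)
    then show ?thesis by (simp add: s_def powr_minus_divide powr_divide)
  qed
  finally show ?thesis by (simp add: riesz_const_def c_def mult_ac)
qed

lemma integrable_one_plus_norm_sq_powr:
  fixes p :: real
  assumes p: "p > real DIM('a::euclidean_space) / 2"
  shows "integrable lborel (\<lambda>\<xi>::'a. (1 + (norm \<xi>)\<^sup>2) powr (- p))"
proof (rule integrableI_nonneg)
  define g where "g u \<xi> = ennreal (u powr (p - 1)) * ennreal (exp (- (1 + (norm (\<xi>::'a))\<^sup>2) * u)) *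
      indicator {0<..} u" for u \<xi>
  have [measurable]: "(\<lambda>(u, \<xi>). g u \<xi>) \<in> borel_measurable (borel \<Otimes>\<^sub>M borel)"
    unfolding g_def by measurable
  have p0: "p > 0" using p by (rule le_less_trans[rotated]) simp
  have "(\<integral>\<^sup>+u. g u \<xi> \<partial>lborel) = ennreal (Gamma p * (1 + (norm \<xi>)\<^sup>2) powr (- p))" for \<xi>
    unfolding g_def using p0 by (intro nn_integral_Gamma) (auto simp: add_pos_nonneg)
  then have "ennreal (Gamma p) * (\<integral>\<^sup>+\<xi>. ennreal ((1 + (norm (\<xi>::'a))\<^sup>2) powr (- p)) \<partial>lborel) =
      (\<integral>\<^sup>+\<xi>. \<integral>\<^sup>+u. g u \<xi> \<partial>lborel \<partial>lborel)"
    using p0 by (simp add: ennreal_mult Gamma_real_nonneg nn_integral_cmult)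
  also have "\<dots> = (\<integral>\<^sup>+u. \<integral>\<^sup>+\<xi>. g u \<xi> \<partial>lborel \<partial>lborel)"
    by (rule lborel_pair.Fubini') measurable
  also have "\<dots> = (\<integral>\<^sup>+u. ennreal (pi powr (DIM('a) / 2)) *
      (ennreal (u powr ((p - DIM('a) / 2) - 1)) * ennreal (exp (- 1 * u)) * indicator {0<..} u) \<partial>lborel)"
  proof (rule nn_integral_cong)
    fix u :: real
    show "(\<integral>\<^sup>+\<xi>. g u \<xi> \<partial>lborel) = ennreal (pi powr (DIM('a) / 2)) *
        (ennreal (u powr ((p - DIM('a) / 2) - 1)) * ennreal (exp (- 1 * u)) * indicator {0<..} u)"
    proof (cases "u > 0")
      case True
      have "g u \<xi> = ennreal (u powr (p - 1) * exp (- u) * (pi / u) powr (DIM('a) / 2)) *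
          ennreal (heat_kernel (1 / (4 * u)) \<xi>)" for \<xi>
      proof -
        have "exp (- (1 + (norm \<xi>)\<^sup>2) * u) = exp (- u) * exp (- u * (norm \<xi>)\<^sup>2)"
          by (simp add: algebra_simps flip: exp_add)
        then show ?thesis
          unfolding g_def gaussian_eq_heat_kernel[OF True] using True by (simp add: mult.assoc flip: ennreal_mult)
      qed
      then have "(\<integral>\<^sup>+\<xi>. g u \<xi> \<partial>lborel) = ennreal (u powr (p - 1) * exp (- u) * (pi / u) powr (DIM('a) / 2))"
        using True by (simp add: nn_integral_cmult nn_integral_heat_kernel)
      then show ?thesis
        using True by (simp add: powr_divide powr_diff mult_ac flip: ennreal_mult)
    qed (simp add: g_def)
  qed
  also have "\<dots> < \<infinity>"
    using p nn_integral_Gamma[of "p - DIM('a) / 2" 1] by (simp add: nn_integral_cmult ennreal_mult_less_top)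
  finally show "(\<integral>\<^sup>+\<xi>. ennreal ((1 + (norm (\<xi>::'a))\<^sup>2) powr (- p)) \<partial>lborel) < \<infinity>"
    using Gamma_real_pos[OF p0] by (auto simp: ennreal_mult_less_top ennreal_mult_eq_top_iff less_top)
qed auto

section \<open>The stable kernel integrated against Gaussians\<close>

lemma
  fixes f :: "'a::euclidean_space \<Rightarrow> 'b::euclidean_space \<Rightarrow> real"
  assumes meas [measurable]: "(\<lambda>(x, y). f x y) \<in> borel_measurable (borel \<Otimes>\<^sub>M borel)"
    and fin: "(\<integral>\<^sup>+y. \<integral>\<^sup>+x. ennreal \<bar>f x y\<bar> \<partial>lborel \<partial>lborel) < \<infinity>"
  shows Fubini_integral_lborel: "(LINT x|lborel. LINT y|lborel. f x y) = (LINT y|lborel. LINT x|lborel. f x y)"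
    and Fubini_integrable_fst_lborel: "integrable lborel (\<lambda>x. LINT y|lborel. f x y)"
    and Fubini_integrable_snd_lborel: "integrable lborel (\<lambda>y. LINT x|lborel. f x y)"
proof -
  have "(\<integral>\<^sup>+p. ennreal (norm ((\<lambda>(x, y). f x y) p)) \<partial>(lborel \<Otimes>\<^sub>M lborel)) =
      (\<integral>\<^sup>+y. \<integral>\<^sup>+x. ennreal \<bar>f x y\<bar> \<partial>lborel \<partial>lborel)"
    by (subst lborel_pair.nn_integral_snd[symmetric]) auto
  then have int: "integrable (lborel \<Otimes>\<^sub>M lborel) (\<lambda>(x, y). f x y)"
    using fin by (intro integrableI_bounded) auto
  show "(LINT x|lborel. LINT y|lborel. f x y) = (LINT y|lborel. LINT x|lborel. f x y)"
    using lborel_pair.Fubini_integral[OF int] by simp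
  show "integrable lborel (\<lambda>x. LINT y|lborel. f x y)"
    using lborel_pair.integrable_fst[OF int] by simp
  show "integrable lborel (\<lambda>y. LINT x|lborel. f x y)"
    using lborel_pair.integrable_snd[OF int] by simp
qed

lemma one_plus_power2_powr_le:
  fixes r p :: real
  assumes r: "0 \<le> r" and p: "0 < p"
  shows "(1 + r\<^sup>2) powr p \<le> 2 powr p * (1 + r powr (2 * p))"
proof -
  have "(1 + r\<^sup>2) powr p \<le> (2 * max 1 (r\<^sup>2)) powr p"
    using p by (intro powr_mono2) auto
  also have "\<dots> \<le> 2 powr p * (1 + r powr (2 * p))"
  proof (cases "r \<le> 1")
    case True
    then have "r\<^sup>2 \<le> 1" using r by (simp add: power_le_one)
    then show ?thesis by (simp add: max_absorb1)
  next
    case False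
    then have "max 1 (r\<^sup>2) = r powr 2" by (simp add: max_absorb2)
    then show ?thesis by (simp add: powr_mult powr_powr)
  qed
  finally show ?thesis .
qed

lemma exp_neg_powr_le:
  fixes s r p \<alpha> :: real
  assumes \<alpha>: "0 < \<alpha>" and s: "0 < s" and p: "0 < p" and r: "0 \<le> r"
  defines "c \<equiv> 2 * p / \<alpha>"
  shows "exp (- s * r powr \<alpha>) \<le> 2 powr p * (1 + s powr (- c) * c powr c) * (1 + r\<^sup>2) powr (- p)"
proof -
  define y where "y = s * r powr \<alpha>"
  have y: "y \<ge> 0" and c: "c > 0" using assms by (auto simp: y_def)
  have "r powr (2 * p) = s powr (- c) * y powr c"
    using \<alpha> s r by (simp add: y_def c_def powr_mult powr_powr powr_minus)
  also have "\<dots> \<le> s powr (- c) * (c powr c * exp y)"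
    using c y by (intro mult_left_mono powr_le_exp) auto
  finally have "1 + r powr (2 * p) \<le> (1 + s powr (- c) * c powr c) * exp y"
    using y by (simp add: distrib_right add_mono mult.assoc)
  then have "2 powr p * (1 + r powr (2 * p)) \<le> 2 powr p * (1 + s powr (- c) * c powr c) * exp y"
    unfolding mult.assoc by (rule mult_left_mono) simp
  with one_plus_power2_powr_le[OF r p]
  have "(1 + r\<^sup>2) powr p \<le> 2 powr p * (1 + s powr (- c) * c powr c) * exp y"
    by (rule order_trans)
  moreover have "1 + r\<^sup>2 \<noteq> 0"
    using zero_le_power2[of r] by linarith
  ultimately show ?thesis
    unfolding mult_minus_left y_def[symmetric] by (simp add: powr_minus exp_minus field_simps)
qed

lemma exp_neg_norm_powr_integrable:
  assumes "\<alpha> > 0" "s > 0"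
  shows "integrable lborel (\<lambda>\<xi>::'a::euclidean_space. exp (- s * norm \<xi> powr \<alpha>))"
proof -
  define p where "p = real DIM('a)"
  define C where "C = 2 powr p * (1 + s powr (- (2 * p / \<alpha>)) * (2 * p / \<alpha>) powr (2 * p / \<alpha>))"
  have bound: "exp (- s * norm \<xi> powr \<alpha>) \<le> C * (1 + (norm \<xi>)\<^sup>2) powr (- p)" for \<xi> :: 'a
    unfolding C_def using assms by (intro exp_neg_powr_le) (auto simp: p_def)
  show ?thesis
  proof (rule Bochner_Integration.integrable_bound)
    show "integrable lborel (\<lambda>\<xi>::'a. C * (1 + (norm \<xi>)\<^sup>2) powr (- p))"
      by (intro integrable_mult_right integrable_one_plus_norm_sq_powr) (simp add: p_def)
    show "AE \<xi> in lborel. norm (exp (- s * norm (\<xi>::'a) powr \<alpha>)) \<le> norm (C * (1 + (norm \<xi>)\<^sup>2) powr (- p))"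
      using bound by (intro AE_I2) (metis abs_exp_cancel abs_ge_self order_trans real_norm_def)
  qed measurable
qed

lemma borel_measurable_stable_kernel [measurable]:
  assumes [measurable]: "f \<in> borel_measurable M" "g \<in> borel_measurable M"
  shows "(\<lambda>w. stable_kernel \<alpha> (f w) (g w :: 'a::euclidean_space)) \<in> borel_measurable M"
  unfolding stable_kernel_def by measurable

definition stable_gauss :: "real \<Rightarrow> real \<Rightarrow> real \<Rightarrow> 'a::euclidean_space \<Rightarrow> real" where
  "stable_gauss \<alpha> s u x = (LINT \<xi>|lborel. cos (\<xi> \<bullet> x) * (exp (- s * norm \<xi> powr \<alpha>) * heat_kernel u \<xi>))"

lemma borel_measurable_stable_gauss [measurable]:
  assumes [measurable]: "f \<in> borel_measurable M" "g \<in> borel_measurable M" "h \<in> borel_measurable M"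
  shows "(\<lambda>w. stable_gauss \<alpha> (f w) (g w) (h w :: 'a::euclidean_space)) \<in> borel_measurable M"
  unfolding stable_gauss_def by measurable

lemma stable_gauss_zero_time: "u > 0 \<Longrightarrow> stable_gauss \<alpha> 0 u x = exp (- u * (norm x)\<^sup>2)"
  by (simp add: stable_gauss_def heat_kernel_cos_integral)

lemma stable_gauss_integrable:
  fixes x :: "'a::euclidean_space"
  assumes "s \<ge> 0" "u > 0"
  shows "integrable lborel (\<lambda>\<xi>. cos (\<xi> \<bullet> x) * (exp (- s * norm \<xi> powr \<alpha>) * heat_kernel u \<xi>))"
  unfolding mult.assoc[symmetric] using assms
  by (intro heat_kernel_bounded_integrable) (auto simp: abs_mult intro!: mult_le_one)

lemma
  fixes x :: "'a::euclidean_space"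
  assumes \<alpha>: "\<alpha> > 0" and s: "s > 0" and u: "u > 0"
  shows stable_kernel_gauss_integrable: "integrable lborel (\<lambda>z. stable_kernel \<alpha> s z * exp (- u * (norm (x + z))\<^sup>2))"
    and stable_kernel_gauss_integral:
      "(LINT z|lborel. stable_kernel \<alpha> s z * exp (- u * (norm (x + z))\<^sup>2)) = stable_gauss \<alpha> s u x"
proof -
  define c where "c = 1 / (2 * pi) ^ DIM('a)"
  have c: "c > 0" by (simp add: c_def)
  define f where "f z \<xi> = c * (exp (- s * norm \<xi> powr \<alpha>) * cos (\<xi> \<bullet> z)) * exp (- u * (norm (x + z))\<^sup>2)" for z \<xi> :: 'a
  have meas [measurable]: "(\<lambda>(z, \<xi>). f z \<xi>) \<in> borel_measurable (borel \<Otimes>\<^sub>M borel)"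
    unfolding f_def by measurable
  have fin: "(\<integral>\<^sup>+\<xi>. \<integral>\<^sup>+z. ennreal \<bar>f z \<xi>\<bar> \<partial>lborel \<partial>lborel) < \<infinity>"
  proof -
    have bound: "\<bar>f z \<xi>\<bar> \<le> c * exp (- s * norm \<xi> powr \<alpha>) * exp (- u * (norm (x + z))\<^sup>2)" for z \<xi>
      using c by (simp add: f_def abs_mult mult_left_le)
    have "(\<integral>\<^sup>+\<xi>. \<integral>\<^sup>+z. ennreal \<bar>f z \<xi>\<bar> \<partial>lborel \<partial>lborel) \<le>
        (\<integral>\<^sup>+\<xi>. \<integral>\<^sup>+z. ennreal (c * exp (- s * norm (\<xi>::'a) powr \<alpha>)) *
            ennreal (exp (- u * (norm (x + z))\<^sup>2)) \<partial>lborel \<partial>lborel)"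
      using c by (intro nn_integral_mono order_trans[OF ennreal_leI[OF bound]]) (simp flip: ennreal_mult)
    also have "\<dots> = (\<integral>\<^sup>+\<xi>. ennreal (c * exp (- s * norm (\<xi>::'a) powr \<alpha>)) \<partial>lborel) *
        (\<integral>\<^sup>+z. ennreal (exp (- u * (norm (x + z))\<^sup>2)) \<partial>lborel)"
      by (simp add: nn_integral_cmult nn_integral_multc)
    also have "\<dots> < \<infinity>"
      using c exp_neg_norm_powr_integrable[OF \<alpha> s, where 'a = 'a] gaussian_translate_integrable[OF u, of x]
      by (simp add: nn_integral_eq_integral ennreal_mult_less_top)
    finally show ?thesis .
  qed
  have int_\<xi>: "(LINT \<xi>|lborel. f z \<xi>) = stable_kernel \<alpha> s z * exp (- u * (norm (x + z))\<^sup>2)" for z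
    by (simp add: f_def stable_kernel_def c_def)
  have int_z: "(LINT z|lborel. f z \<xi>) = cos (\<xi> \<bullet> x) * (exp (- s * norm \<xi> powr \<alpha>) * heat_kernel u \<xi>)" for \<xi>
  proof -
    have "(LINT z|lborel. f z \<xi>) = (LINT z|lborel. c * exp (- s * norm \<xi> powr \<alpha>) *
        (exp (- u * (norm (x + z))\<^sup>2) * cos (\<xi> \<bullet> z)))"
      by (simp add: f_def mult_ac)
    also have "\<dots> = c * exp (- s * norm \<xi> powr \<alpha>) * ((2 * pi) ^ DIM('a) * (cos (\<xi> \<bullet> x) * heat_kernel u \<xi>))"
      by (simp only: integral_mult_right_zero gaussian_translate_cos_integral[OF u])
    finally show ?thesis by (simp add: c_def)
  qed
  show "integrable lborel (\<lambda>z. stable_kernel \<alpha> s z * exp (- u * (norm (x + z))\<^sup>2))"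
    using Fubini_integrable_fst_lborel[OF meas fin] by (simp add: int_\<xi>)
  show "(LINT z|lborel. stable_kernel \<alpha> s z * exp (- u * (norm (x + z))\<^sup>2)) = stable_gauss \<alpha> s u x"
    using Fubini_integral_lborel[OF meas fin] by (simp add: int_\<xi> int_z stable_gauss_def)
qed

lemma stable_gauss_le_1:
  assumes "s \<ge> 0" "u > 0"
  shows "stable_gauss \<alpha> s u (x::'a::euclidean_space) \<le> 1"
proof -
  have "cos (\<xi> \<bullet> x) * (exp (- s * norm \<xi> powr \<alpha>) * heat_kernel u \<xi>) \<le> heat_kernel u \<xi>" for \<xi>
  proof -
    have "cos (\<xi> \<bullet> x) * exp (- s * norm \<xi> powr \<alpha>) \<le> 1 * 1"
      using assms by (intro mult_mono) auto
    then show ?thesis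
      using mult_right_mono[OF _ heat_kernel_nonneg[of u \<xi>]] by (fastforce simp: mult.assoc)
  qed
  then have "stable_gauss \<alpha> s u x \<le> (LINT \<xi>|lborel. heat_kernel u (\<xi>::'a))"
    unfolding stable_gauss_def using assms
    by (intro integral_mono stable_gauss_integrable heat_kernel_integrable)
  then show ?thesis using assms by (simp add: heat_kernel_integral)
qed

lemma heat_kernel_one_minus_exp_le:
  assumes "\<alpha> > 0" "t > 0"
  obtains C where "C \<ge> 0"
    and "\<And>r. r > 0 \<Longrightarrow> (\<integral>\<^sup>+\<xi>. ennreal (1 - exp (- t * norm (\<xi>::'a::euclidean_space) powr \<alpha>)) *
        ennreal (heat_kernel r \<xi>) \<partial>lborel)
      \<le> ennreal (min 1 (C * r powr (\<alpha> / 2)))"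
proof
  define K where "K = (4 * \<alpha>) powr (\<alpha> / 2) * 2 powr (DIM('a) / 2)"
  define e where "e \<xi> = 1 - exp (- t * norm (\<xi>::'a) powr \<alpha>)" for \<xi>
  show "t * K \<ge> 0" using assms by (simp add: K_def)
  fix r :: real assume r: "r > 0"
  have e: "0 \<le> e \<xi>" "e \<xi> \<le> 1" "e \<xi> \<le> t * norm \<xi> powr \<alpha>" for \<xi>
    using assms exp_ge_add_one_self[of "- t * norm \<xi> powr \<alpha>"] by (auto simp: e_def)
  have "(\<integral>\<^sup>+\<xi>. ennreal (e \<xi>) * ennreal (heat_kernel r \<xi>) \<partial>lborel) \<le> (\<integral>\<^sup>+\<xi>. ennreal (heat_kernel r (\<xi>::'a)) \<partial>lborel)"
    using e by (intro nn_integral_mono) (auto simp: mult_left_le_one_le intro!: ennreal_leI simp flip: ennreal_mult)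
  also have "\<dots> = ennreal 1"
    using r by (simp add: nn_integral_heat_kernel)
  finally have le_1: "(\<integral>\<^sup>+\<xi>. ennreal (e \<xi>) * ennreal (heat_kernel r \<xi>) \<partial>lborel) \<le> ennreal 1" .
  have "(\<integral>\<^sup>+\<xi>. ennreal (e \<xi>) * ennreal (heat_kernel r \<xi>) \<partial>lborel) \<le>
      (\<integral>\<^sup>+\<xi>. ennreal t * (ennreal (norm (\<xi>::'a) powr \<alpha>) * ennreal (heat_kernel r \<xi>)) \<partial>lborel)"
    using e assms
    by (intro nn_integral_mono) (auto simp: mult_right_mono mult.assoc[symmetric]
        intro!: ennreal_leI simp flip: ennreal_mult)
  also have "\<dots> \<le> ennreal t * ennreal (K * r powr (\<alpha> / 2))"
    using heat_kernel_moment_le[OF assms(1) r, where 'a = 'a]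
    by (subst nn_integral_cmult) (auto simp: K_def intro!: mult_left_mono)
  also have "\<dots> = ennreal (t * K * r powr (\<alpha> / 2))"
    using assms by (simp add: K_def mult.assoc flip: ennreal_mult)
  finally show "(\<integral>\<^sup>+\<xi>. ennreal (1 - exp (- t * norm (\<xi>::'a) powr \<alpha>)) * ennreal (heat_kernel r \<xi>) \<partial>lborel)
      \<le> ennreal (min 1 (t * K * r powr (\<alpha> / 2)))"
    using le_1 by (simp add: e_def min_def)
qed

lemma stable_gauss_origin_tendsto:
  assumes "\<alpha> > 0" "t > 0"
  shows "((\<lambda>u. 1 - stable_gauss \<alpha> t u (0::'a::euclidean_space)) \<longlongrightarrow> 0) (at_right 0)"
proof -
  obtain C where C: "C \<ge> 0"
    "\<And>r. r > 0 \<Longrightarrow> (\<integral>\<^sup>+\<xi>. ennreal (1 - exp (- t * norm (\<xi>::'a) powr \<alpha>)) * ennreal (heat_kernel r \<xi>) \<partial>lborel)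
      \<le> ennreal (min 1 (C * r powr (\<alpha> / 2)))"
    using heat_kernel_one_minus_exp_le[OF assms] by blast
  have bound: "1 - stable_gauss \<alpha> t u (0::'a) \<le> C * u powr (\<alpha> / 2)" if u: "u > 0" for u
  proof -
    let ?f = "\<lambda>\<xi>::'a. heat_kernel u \<xi> - cos (\<xi> \<bullet> 0) * (exp (- t * norm \<xi> powr \<alpha>) * heat_kernel u \<xi>)"
    have int: "integrable lborel ?f"
      using u assms by (intro Bochner_Integration.integrable_diff heat_kernel_integrable stable_gauss_integrable) auto
    have f: "?f \<xi> = (1 - exp (- t * norm \<xi> powr \<alpha>)) * heat_kernel u \<xi>" for \<xi>
      by (simp add: algebra_simps)
    have "ennreal (1 - stable_gauss \<alpha> t u (0::'a)) = ennreal (LINT \<xi>|lborel. ?f \<xi>)"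
      using u assms stable_gauss_integrable[of t u "0::'a"]
      by (subst Bochner_Integration.integral_diff)
        (auto simp: heat_kernel_integrable heat_kernel_integral stable_gauss_def)
    also have "\<dots> = (\<integral>\<^sup>+\<xi>. ennreal (?f \<xi>) \<partial>lborel)"
      using assms by (intro nn_integral_eq_integral[symmetric] int AE_I2) (simp only: f, simp)
    also have "\<dots> \<le> ennreal (min 1 (C * u powr (\<alpha> / 2)))"
      unfolding f using C(2)[OF u] assms by (simp add: ennreal_mult)
    finally show ?thesis
      using C(1) by (simp add: ennreal_le_iff)
  qed
  have "((\<lambda>u. C * u powr (\<alpha> / 2)) \<longlongrightarrow> C * 0) (at_right 0)"
    using assms by (intro tendsto_mult tendsto_const tendsto_zero_powrI[where b = "\<alpha> / 2"] tendsto_ident_at)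
      (auto simp: eventually_at_filter)
  then have upper: "((\<lambda>u. C * u powr (\<alpha> / 2)) \<longlongrightarrow> 0) (at_right 0)" by simp
  have pos: "eventually (\<lambda>u::real. 0 < u) (at_right 0)" by (rule eventually_at_right_less)
  show ?thesis
  proof (rule tendsto_sandwich[OF _ _ tendsto_const upper])
    show "eventually (\<lambda>u. 0 \<le> 1 - stable_gauss \<alpha> t u (0::'a)) (at_right 0)"
      using pos by eventually_elim (use assms in \<open>simp add: stable_gauss_le_1\<close>)
    show "eventually (\<lambda>u. 1 - stable_gauss \<alpha> t u (0::'a) \<le> C * u powr (\<alpha> / 2)) (at_right 0)"
      using pos by eventually_elim (rule bound)
  qed
qed

text \<open>The total mass of the positive part forces the negative part to vanish: tested against wide
  Gaussians, the kernel itself also has total mass \<open>1\<close> in the limit.\<close>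

lemma stable_kernel_nonneg_AE:
  assumes \<alpha>: "\<alpha> > 0" and s: "s > 0"
    and mass: "(\<integral>\<^sup>+z. ennreal (stable_kernel \<alpha> s (z::'a::euclidean_space)) \<partial>lborel) = 1"
  shows "AE z in lborel. 0 \<le> stable_kernel \<alpha> s (z::'a)"
proof -
  define p where "p = (stable_kernel \<alpha> s :: 'a \<Rightarrow> real)"
  define n where "n z = max 0 (- p z)" for z
  define q where "q z = max 0 (p z)" for z
  define g where "g u z = exp (- u * (norm (z::'a))\<^sup>2)" for u z
  have [measurable]: "p \<in> borel_measurable borel" "n \<in> borel_measurable borel" "q \<in> borel_measurable borel"
    unfolding p_def n_def q_def by measurable
  have int_p: "integrable lborel (\<lambda>z. p z * g u z)" if "u > 0" for u
    using stable_kernel_gauss_integrable[OF \<alpha> s that, of "0::'a"] by (simp add: p_def g_def)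
  have int_n: "integrable lborel (\<lambda>z. n z * g u z)" and int_q: "integrable lborel (\<lambda>z. q z * g u z)" if "u > 0" for u
    by (rule Bochner_Integration.integrable_bound[OF int_p[OF that]]; simp add: n_def q_def g_def abs_mult)+
  have "(LINT z|lborel. n z * g 1 z) \<le> 1 - stable_gauss \<alpha> s u (0::'a)" if u: "0 < u" "u \<le> 1" for u
  proof -
    have "ennreal (LINT z|lborel. q z * g u z) = (\<integral>\<^sup>+z. ennreal (q z * g u z) \<partial>lborel)"
      using int_q[OF u(1)] by (intro nn_integral_eq_integral[symmetric]) (auto simp: q_def g_def)
    also have "\<dots> \<le> (\<integral>\<^sup>+z. ennreal (p z) \<partial>lborel)"
      using u by (intro nn_integral_mono) (auto simp: q_def g_def max_def mult_left_le ennreal_leI)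
    finally have q_le: "(LINT z|lborel. q z * g u z) \<le> 1"
      using mass by (simp add: p_def)
    have "(LINT z|lborel. n z * g 1 z) \<le> (LINT z|lborel. n z * g u z)"
      using u by (intro integral_mono int_n mult_left_mono) (auto simp: n_def g_def mult_left_le_one_le)
    also have "\<dots> = (LINT z|lborel. q z * g u z - p z * g u z)"
      by (intro Bochner_Integration.integral_cong refl) (auto simp: n_def q_def max_def)
    also have "\<dots> = (LINT z|lborel. q z * g u z) - stable_gauss \<alpha> s u (0::'a)"
      using stable_kernel_gauss_integral[OF \<alpha> s u(1), of "0::'a"] int_p[OF u(1)] int_q[OF u(1)]
      by (simp add: p_def g_def)
    finally show ?thesis using q_le by simp
  qed
  then have "(LINT z|lborel. n z * g 1 z) \<le> 0"
    by (intro tendsto_lowerbound[OF stable_gauss_origin_tendsto[OF \<alpha> s, where 'a = 'a]])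
      (auto simp: eventually_at_right_field intro!: exI[of _ 1])
  moreover have nonneg: "AE z in lborel. 0 \<le> n z * g 1 z"
    by (auto simp: n_def g_def)
  ultimately have "(LINT z|lborel. n z * g 1 z) = 0"
    using integral_nonneg_AE[OF nonneg] by simp
  then have "AE z in lborel. n z * g 1 z = 0"
    using integral_nonneg_eq_0_iff_AE[OF int_n nonneg] by simp
  then show ?thesis
    by eventually_elim (auto simp: n_def p_def g_def max_def split: if_splits)
qed

section \<open>Gaussian mixtures on the Fourier side\<close>

definition spectral_density :: "real \<Rightarrow> real \<Rightarrow> real \<Rightarrow> 'a::euclidean_space \<Rightarrow> real" where
  "spectral_density \<alpha> \<beta> t \<xi> = (1 - exp (- t * norm \<xi> powr \<alpha>)) * norm \<xi> powr (- (real DIM('a) + \<beta>))"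

definition spectral_integral :: "real \<Rightarrow> real \<Rightarrow> real \<Rightarrow> 'a::euclidean_space \<Rightarrow> real" where
  "spectral_integral \<alpha> \<beta> t x = (LINT \<xi>|lborel. cos (\<xi> \<bullet> x) * spectral_density \<alpha> \<beta> t \<xi>)"

lemma borel_measurable_spectral_density [measurable]: "spectral_density \<alpha> \<beta> t \<in> borel_measurable borel"
  unfolding spectral_density_def[abs_def] by measurable

lemma integral_cos_mult_spectral_density:
  "(LINT \<xi>|lborel. cos (\<xi> \<bullet> x) * (c * spectral_density \<alpha> \<beta> t \<xi>)) = c * spectral_integral \<alpha> \<beta> t x"
  unfolding spectral_integral_def mult.left_commute[of _ c] by simp

lemma spectral_density_nonneg: "t \<ge> 0 \<Longrightarrow> 0 \<le> spectral_density \<alpha> \<beta> t \<xi>"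
  by (simp add: spectral_density_def)

lemma nn_integral_spectral_mixture:
  fixes \<xi> :: "'a::euclidean_space" and \<alpha> \<beta> t :: real
  assumes "0 < \<beta>" "t > 0" "\<xi> \<noteq> 0"
  shows "(\<integral>\<^sup>+r\<in>{0<..}. ennreal (r powr (- \<beta> / 2 - 1)) *
      (ennreal (1 - exp (- t * norm \<xi> powr \<alpha>)) * ennreal (heat_kernel r \<xi>)) \<partial>lborel)
    = ennreal (riesz_const DIM('a) ((DIM('a) + \<beta>) / 2) * spectral_density \<alpha> \<beta> t \<xi>)"
proof -
  define a where "a = (real DIM('a) + \<beta>) / 2"
  have a: "a > 0" using assms by (auto simp: a_def intro: add_nonneg_pos)
  have twice_a: "- 2 * a = - (real DIM('a) + \<beta>)" by (simp add: a_def)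
  have exponent: "- \<beta> / 2 - 1 = DIM('a) / 2 - a - 1" by (simp add: a_def add_divide_distrib)
  have "(\<integral>\<^sup>+r\<in>{0<..}. ennreal (r powr (- \<beta> / 2 - 1)) *
      (ennreal (1 - exp (- t * norm \<xi> powr \<alpha>)) * ennreal (heat_kernel r \<xi>)) \<partial>lborel)
      = ennreal (1 - exp (- t * norm \<xi> powr \<alpha>)) *
        (\<integral>\<^sup>+r\<in>{0<..}. ennreal (r powr (DIM('a) / 2 - a - 1)) * ennreal (heat_kernel r \<xi>) \<partial>lborel)"
    unfolding exponent by (subst nn_integral_cmult[symmetric]) (auto simp: mult_ac)
  also have "\<dots> = ennreal (riesz_const DIM('a) a * spectral_density \<alpha> \<beta> t \<xi>)"
    using assms riesz_const_pos[OF a, of "DIM('a)"]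
    unfolding nn_integral_heat_kernel_mixture[OF a \<open>\<xi> \<noteq> 0\<close>] twice_a
    by (simp add: spectral_density_def mult_ac flip: ennreal_mult)
  finally show ?thesis by (simp add: a_def)
qed

lemma spectral_density_integrable:
  fixes \<alpha> \<beta> t :: real
  assumes "0 < \<beta>" "\<beta> < \<alpha>" "t > 0"
  shows "integrable lborel (spectral_density \<alpha> \<beta> t :: 'a::euclidean_space \<Rightarrow> real)"
proof -
  define c where "c = riesz_const DIM('a) ((DIM('a) + \<beta>) / 2)"
  define w where "w r \<xi> = ennreal (r powr (- \<beta> / 2 - 1)) *
      (ennreal (1 - exp (- t * norm \<xi> powr \<alpha>)) * ennreal (heat_kernel r \<xi>)) *
    indicator {0<..} r" for r and \<xi> :: 'a
  have c: "c > 0" unfolding c_def using assms by (intro riesz_const_pos divide_pos_pos add_nonneg_pos) auto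
  have [measurable]: "(\<lambda>(r, \<xi>). w r \<xi>) \<in> borel_measurable (borel \<Otimes>\<^sub>M borel)"
    unfolding w_def by measurable
  obtain C where C: "C \<ge> 0"
    "\<And>r. r > 0 \<Longrightarrow> (\<integral>\<^sup>+\<xi>. ennreal (1 - exp (- t * norm (\<xi>::'a) powr \<alpha>)) * ennreal (heat_kernel r \<xi>) \<partial>lborel)
      \<le> ennreal (min 1 (C * r powr (\<alpha> / 2)))"
    using heat_kernel_one_minus_exp_le[OF less_trans[OF assms(1,2)] assms(3), where 'a = 'a] by blast
  have "(\<integral>\<^sup>+\<xi>. ennreal (c * spectral_density \<alpha> \<beta> t (\<xi>::'a)) \<partial>lborel) = (\<integral>\<^sup>+\<xi>. \<integral>\<^sup>+r. w r \<xi> \<partial>lborel \<partial>lborel)"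
  proof (rule nn_integral_cong_AE)
    have "AE \<xi> in lborel. \<xi> \<noteq> (0::'a)" by (rule AE_lborel_singleton)
    then show "AE \<xi> in lborel. ennreal (c * spectral_density \<alpha> \<beta> t (\<xi>::'a)) = (\<integral>\<^sup>+r. w r \<xi> \<partial>lborel)"
      unfolding w_def c_def by eventually_elim (rule nn_integral_spectral_mixture[OF assms(1,3), symmetric])
  qed
  also have "\<dots> = (\<integral>\<^sup>+r. \<integral>\<^sup>+\<xi>. w r \<xi> \<partial>lborel \<partial>lborel)"
    by (rule lborel_pair.Fubini') measurable
  also have "\<dots> \<le> (\<integral>\<^sup>+r\<in>{0<..}. ennreal (r powr (- \<beta> / 2 - 1) * min 1 (C * r powr (\<alpha> / 2))) \<partial>lborel)"
  proof (rule nn_integral_mono)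
    fix r :: real
    have "(\<integral>\<^sup>+\<xi>. w r \<xi> \<partial>lborel) = ennreal (r powr (- \<beta> / 2 - 1)) * indicator {0<..} r *
        (\<integral>\<^sup>+\<xi>. ennreal (1 - exp (- t * norm (\<xi>::'a) powr \<alpha>)) * ennreal (heat_kernel r \<xi>) \<partial>lborel)"
      unfolding w_def by (subst nn_integral_cmult[symmetric]) (auto simp: mult_ac)
    then show "(\<integral>\<^sup>+\<xi>. w r \<xi> \<partial>lborel) \<le> ennreal (r powr (- \<beta> / 2 - 1) * min 1 (C * r powr (\<alpha> / 2))) *
        indicator {0<..} r"
      using C by (cases "r > 0") (auto simp: ennreal_mult intro!: mult_left_mono)
  qed
  also have "\<dots> < \<infinity>"
    using assms C(1) by (intro nn_integral_powr_min_finite) auto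
  finally have "integrable lborel (\<lambda>\<xi>::'a. c * spectral_density \<alpha> \<beta> t \<xi>)"
    using assms c by (intro integrableI_nonneg) (auto simp: spectral_density_nonneg)
  then show ?thesis using c by simp
qed

lemma
  fixes w :: "'t::euclidean_space \<Rightarrow> 'a::euclidean_space \<Rightarrow> real"
  assumes [measurable]: "(\<lambda>(\<tau>, \<xi>). w \<tau> \<xi>) \<in> borel_measurable (borel \<Otimes>\<^sub>M borel)"
    and w: "\<And>\<tau> \<xi>. 0 \<le> w \<tau> \<xi>"
    and F: "integrable lborel F" "\<And>\<xi>. 0 \<le> F \<xi>"
    and mixture: "\<And>\<xi>. \<xi> \<noteq> 0 \<Longrightarrow> (\<integral>\<^sup>+\<tau>. ennreal (w \<tau> \<xi>) \<partial>lborel) = ennreal (F \<xi>)"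
  shows cos_mixture_integrable: "integrable lborel (\<lambda>\<tau>. LINT \<xi>|lborel. cos (\<xi> \<bullet> x) * w \<tau> \<xi>)"
    and cos_mixture_integral: "(LINT \<tau>|lborel. LINT \<xi>|lborel. cos (\<xi> \<bullet> x) * w \<tau> \<xi>) =
        (LINT \<xi>|lborel. cos (\<xi> \<bullet> x) * F \<xi>)"
proof -
  have [measurable]: "F \<in> borel_measurable borel" using F(1) by simp
  have meas: "(\<lambda>(\<tau>, \<xi>). cos (\<xi> \<bullet> x) * w \<tau> \<xi>) \<in> borel_measurable (borel \<Otimes>\<^sub>M borel)"
    by measurable
  have "AE \<xi> in lborel. \<xi> \<noteq> (0::'a)" by (rule AE_lborel_singleton)
  then have AE_mixture: "AE \<xi> in lborel. (\<integral>\<^sup>+\<tau>. ennreal (w \<tau> \<xi>) \<partial>lborel) = ennreal (F \<xi>)"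
    by eventually_elim (rule mixture)
  have "(\<integral>\<^sup>+\<xi>. \<integral>\<^sup>+\<tau>. ennreal \<bar>cos (\<xi> \<bullet> x) * w \<tau> \<xi>\<bar> \<partial>lborel \<partial>lborel) \<le> (\<integral>\<^sup>+\<xi>. \<integral>\<^sup>+\<tau>. ennreal (w \<tau> \<xi>) \<partial>lborel \<partial>lborel)"
    using w by (intro nn_integral_mono ennreal_leI) (auto simp: abs_mult mult_left_le_one_le)
  also have "\<dots> = (\<integral>\<^sup>+\<xi>. ennreal (F \<xi>) \<partial>lborel)"
    by (rule nn_integral_cong_AE[OF AE_mixture])
  also have "\<dots> < \<infinity>"
    using F by (simp add: nn_integral_eq_integral)
  finally have fin: "(\<integral>\<^sup>+\<xi>. \<integral>\<^sup>+\<tau>. ennreal \<bar>cos (\<xi> \<bullet> x) * w \<tau> \<xi>\<bar> \<partial>lborel \<partial>lborel) < \<infinity>" .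
  show "integrable lborel (\<lambda>\<tau>. LINT \<xi>|lborel. cos (\<xi> \<bullet> x) * w \<tau> \<xi>)"
    by (rule Fubini_integrable_fst_lborel[OF meas fin])
  have "AE \<xi> in lborel. (LINT \<tau>|lborel. cos (\<xi> \<bullet> x) * w \<tau> \<xi>) = cos (\<xi> \<bullet> x) * F \<xi>"
    using AE_mixture
  proof eventually_elim
    case (elim \<xi>)
    then have "(LINT \<tau>|lborel. w \<tau> \<xi>) = F \<xi>"
      using w F(2) by (subst integral_eq_nn_integral) auto
    then show ?case by simp
  qed
  then show "(LINT \<tau>|lborel. LINT \<xi>|lborel. cos (\<xi> \<bullet> x) * w \<tau> \<xi>) = (LINT \<xi>|lborel. cos (\<xi> \<bullet> x) * F \<xi>)"
    unfolding Fubini_integral_lborel[OF meas fin]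
    using Fubini_integrable_snd_lborel[OF meas fin] by (intro integral_cong_AE) auto
qed

lemma
  fixes x :: "'a::euclidean_space" and \<alpha> \<beta> t :: real
  assumes "0 < \<beta>" "\<beta> < \<alpha>" "t > 0"
  shows gauss_difference_integrable:
      "integrable lborel (\<lambda>r. indicator {0<..} r * r powr (- \<beta> / 2 - 1) *
          (exp (- r * (norm x)\<^sup>2) - stable_gauss \<alpha> t r x))"
    and gauss_difference_integral:
      "(LINT r|lborel. indicator {0<..} r * r powr (- \<beta> / 2 - 1) * (exp (- r * (norm x)\<^sup>2) - stable_gauss \<alpha> t r x))
        = riesz_const DIM('a) ((DIM('a) + \<beta>) / 2) * spectral_integral \<alpha> \<beta> t x"
proof -
  define c where "c = riesz_const DIM('a) ((DIM('a) + \<beta>) / 2)"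
  define w where "w r \<xi> = indicator {0<..} r * r powr (- \<beta> / 2 - 1) *
      ((1 - exp (- t * norm \<xi> powr \<alpha>)) * heat_kernel r \<xi>)"
    for r and \<xi> :: 'a
  have [measurable]: "(\<lambda>(r, \<xi>). w r \<xi>) \<in> borel_measurable (borel \<Otimes>\<^sub>M borel)"
    unfolding w_def by measurable
  have w: "0 \<le> w r \<xi>" for r \<xi> using assms by (simp add: w_def)
  have c: "c > 0" unfolding c_def using assms by (intro riesz_const_pos divide_pos_pos add_nonneg_pos) auto
  have F: "integrable lborel (\<lambda>\<xi>::'a. c * spectral_density \<alpha> \<beta> t \<xi>)" "0 \<le> c * spectral_density \<alpha> \<beta> t \<xi>" for \<xi> :: 'a
    using assms c by (simp_all add: spectral_density_integrable spectral_density_nonneg)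
  have mixture: "(\<integral>\<^sup>+r. ennreal (w r \<xi>) \<partial>lborel) = ennreal (c * spectral_density \<alpha> \<beta> t \<xi>)" if "\<xi> \<noteq> 0" for \<xi>
    unfolding c_def nn_integral_spectral_mixture[OF assms(1,3) that, symmetric] w_def using assms
    by (intro nn_integral_cong) (auto simp: indicator_def simp flip: ennreal_mult)
  have inner: "(LINT \<xi>|lborel. cos (\<xi> \<bullet> x) * w r \<xi>) =
      indicator {0<..} r * r powr (- \<beta> / 2 - 1) * (exp (- r * (norm x)\<^sup>2) - stable_gauss \<alpha> t r x)" for r
  proof (cases "r > 0")
    case True
    have "(LINT \<xi>|lborel. cos (\<xi> \<bullet> x) * w r \<xi>) = (LINT \<xi>|lborel. r powr (- \<beta> / 2 - 1) *
        (cos (\<xi> \<bullet> x) * heat_kernel r \<xi> - cos (\<xi> \<bullet> x) * (exp (- t * norm \<xi> powr \<alpha>) * heat_kernel r \<xi>)))"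
      using True by (simp add: w_def algebra_simps)
    also have "\<dots> = r powr (- \<beta> / 2 - 1) * (exp (- r * (norm x)\<^sup>2) - stable_gauss \<alpha> t r x)"
      using True assms heat_kernel_bounded_integrable[OF True, of "\<lambda>\<xi>. cos (\<xi> \<bullet> x)"] stable_gauss_integrable[of t r x \<alpha>]
      by (simp add: heat_kernel_cos_integral stable_gauss_def)
    finally show ?thesis using True by simp
  qed (simp add: w_def)
  show "integrable lborel (\<lambda>r. indicator {0<..} r * r powr (- \<beta> / 2 - 1) *
      (exp (- r * (norm x)\<^sup>2) - stable_gauss \<alpha> t r x))"
    using cos_mixture_integrable[OF _ w F mixture, of x] by (simp add: inner)
  show "(LINT r|lborel. indicator {0<..} r * r powr (- \<beta> / 2 - 1) * (exp (- r * (norm x)\<^sup>2) - stable_gauss \<alpha> t r x))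
      = riesz_const DIM('a) ((DIM('a) + \<beta>) / 2) * spectral_integral \<alpha> \<beta> t x"
    using cos_mixture_integral[OF _ w F mixture, of x]
    by (simp add: inner integral_cos_mult_spectral_density c_def)
qed

lemma nn_integral_spectral_potential:
  fixes \<xi> :: "'a::euclidean_space" and \<alpha> \<beta> t :: real
  assumes "0 < \<beta>" "\<alpha> < real DIM('a)" "t > 0" "\<xi> \<noteq> 0"
  shows "(\<integral>\<^sup>+s\<in>{0..t}. (\<integral>\<^sup>+u\<in>{0<..}. ennreal (u powr ((\<alpha> - \<beta>) / 2 - 1)) *
      (ennreal (exp (- s * norm \<xi> powr \<alpha>)) * ennreal (heat_kernel u \<xi>)) \<partial>lborel) \<partial>lborel)
    = ennreal (riesz_const DIM('a) ((DIM('a) + \<beta> - \<alpha>) / 2) * spectral_density \<alpha> \<beta> t \<xi>)"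
proof -
  define a where "a = (real DIM('a) + \<beta> - \<alpha>) / 2"
  have a: "a > 0" using assms by (simp add: a_def)
  have exponent: "(\<alpha> - \<beta>) / 2 - 1 = DIM('a) / 2 - a - 1" by (simp add: a_def add_divide_distrib diff_divide_distrib)
  have "(\<integral>\<^sup>+u\<in>{0<..}. ennreal (u powr ((\<alpha> - \<beta>) / 2 - 1)) *
      (ennreal (exp (- s * norm \<xi> powr \<alpha>)) * ennreal (heat_kernel u \<xi>)) \<partial>lborel)
      = ennreal (exp (- s * norm \<xi> powr \<alpha>)) * ennreal (riesz_const DIM('a) a * norm \<xi> powr (- 2 * a))" for s
    unfolding exponent nn_integral_heat_kernel_mixture[OF a \<open>\<xi> \<noteq> 0\<close>, symmetric]
    by (subst nn_integral_cmult[symmetric]) (auto simp: mult_ac)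
  then have "(\<integral>\<^sup>+s\<in>{0..t}. (\<integral>\<^sup>+u\<in>{0<..}. ennreal (u powr ((\<alpha> - \<beta>) / 2 - 1)) *
      (ennreal (exp (- s * norm \<xi> powr \<alpha>)) * ennreal (heat_kernel u \<xi>)) \<partial>lborel) \<partial>lborel)
      = (\<integral>\<^sup>+s\<in>{0..t}. ennreal (exp (- s * norm \<xi> powr \<alpha>)) \<partial>lborel) *
          ennreal (riesz_const DIM('a) a * norm \<xi> powr (- 2 * a))"
    by (subst nn_integral_multc[symmetric]) (auto simp: mult_ac)
  also have "\<dots> = ennreal ((1 - exp (- t * norm \<xi> powr \<alpha>)) / norm \<xi> powr \<alpha> *
      (riesz_const DIM('a) a * norm \<xi> powr (- 2 * a)))"
    using assms riesz_const_pos[OF a, of "DIM('a)"] by (subst nn_integral_exp_Icc) (simp_all flip: ennreal_mult)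
  also have "(1 - exp (- t * norm \<xi> powr \<alpha>)) / norm \<xi> powr \<alpha> * (riesz_const DIM('a) a * norm \<xi> powr (- 2 * a)) =
      riesz_const DIM('a) a * spectral_density \<alpha> \<beta> t \<xi>"
  proof -
    have "- 2 * a = - (real DIM('a) + \<beta>) + \<alpha>" by (simp add: a_def)
    then have "norm \<xi> powr (- 2 * a) = norm \<xi> powr (- (real DIM('a) + \<beta>)) * norm \<xi> powr \<alpha>"
      by (simp only: powr_add)
    then show ?thesis using assms by (simp add: spectral_density_def)
  qed
  finally show ?thesis by (simp add: a_def)
qed

lemma
  fixes x :: "'a::euclidean_space" and \<alpha> \<beta> t :: real
  assumes "0 < \<beta>" "\<beta> < \<alpha>" "\<alpha> < real DIM('a)" "t > 0"
  shows gauss_potential_integrable: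
      "integrable lborel (\<lambda>(s, u). indicator {0..t} s *
          (indicator {0<..} u * u powr ((\<alpha> - \<beta>) / 2 - 1)) * stable_gauss \<alpha> s u x)"
    and gauss_potential_integral:
      "(LINT (s, u)|lborel. indicator {0..t} s * (indicator {0<..} u * u powr ((\<alpha> - \<beta>) / 2 - 1)) *
          stable_gauss \<alpha> s u x)
        = riesz_const DIM('a) ((DIM('a) + \<beta> - \<alpha>) / 2) * spectral_integral \<alpha> \<beta> t x"
proof -
  define c where "c = riesz_const DIM('a) ((DIM('a) + \<beta> - \<alpha>) / 2)"
  define m where "m = (\<lambda>(s, u). indicator {0..t} s * (indicator {0<..} u * u powr ((\<alpha> - \<beta>) / 2 - 1)) :: real)"
  define w where "w \<tau> \<xi> = m \<tau> * (exp (- fst \<tau> * norm \<xi> powr \<alpha>) * heat_kernel (snd \<tau>) \<xi>)" for \<tau> and \<xi> :: 'a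
  have [measurable]: "m \<in> borel_measurable (borel \<Otimes>\<^sub>M borel)"
    unfolding m_def by measurable
  have [measurable]: "(\<lambda>(\<tau>, \<xi>). w \<tau> \<xi>) \<in> borel_measurable (borel \<Otimes>\<^sub>M borel)"
    unfolding w_def borel_prod[symmetric] by measurable
  have w: "0 \<le> w \<tau> \<xi>" for \<tau> \<xi> by (auto simp: w_def m_def split: prod.split)
  have c: "c > 0" unfolding c_def using assms by (intro riesz_const_pos) simp
  have F: "integrable lborel (\<lambda>\<xi>::'a. c * spectral_density \<alpha> \<beta> t \<xi>)" "0 \<le> c * spectral_density \<alpha> \<beta> t \<xi>" for \<xi> :: 'a
    using assms c by (simp_all add: spectral_density_integrable spectral_density_nonneg)
  have mixture: "(\<integral>\<^sup>+\<tau>. ennreal (w \<tau> \<xi>) \<partial>lborel) = ennreal (c * spectral_density \<alpha> \<beta> t \<xi>)" if "\<xi> \<noteq> 0" for \<xi>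
  proof -
    have "(\<integral>\<^sup>+\<tau>. ennreal (w \<tau> \<xi>) \<partial>lborel) = (\<integral>\<^sup>+s. \<integral>\<^sup>+u. ennreal (w (s, u) \<xi>) \<partial>lborel \<partial>lborel)"
      unfolding lborel_prod[symmetric] by (rule lborel.nn_integral_fst[symmetric]) (simp add: lborel_prod)
    also have "\<dots> = (\<integral>\<^sup>+s\<in>{0..t}. (\<integral>\<^sup>+u\<in>{0<..}. ennreal (u powr ((\<alpha> - \<beta>) / 2 - 1)) *
        (ennreal (exp (- s * norm \<xi> powr \<alpha>)) * ennreal (heat_kernel u \<xi>)) \<partial>lborel) \<partial>lborel)"
      by (intro nn_integral_cong, subst nn_integral_multc[symmetric])
        (auto simp: w_def m_def indicator_def intro!: nn_integral_cong simp flip: ennreal_mult)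
    finally show ?thesis
      unfolding c_def nn_integral_spectral_potential[OF assms(1,3,4) that] .
  qed
  have inner: "(LINT \<xi>|lborel. cos (\<xi> \<bullet> x) * w \<tau> \<xi>) =
      (case \<tau> of (s, u) \<Rightarrow> indicator {0..t} s * (indicator {0<..} u * u powr ((\<alpha> - \<beta>) / 2 - 1)) *
          stable_gauss \<alpha> s u x)" for \<tau>
    by (cases \<tau>) (simp add: w_def m_def stable_gauss_def mult.left_commute[of "cos _"])
  show "integrable lborel (\<lambda>(s, u). indicator {0..t} s *
      (indicator {0<..} u * u powr ((\<alpha> - \<beta>) / 2 - 1)) * stable_gauss \<alpha> s u x)"
    using cos_mixture_integrable[OF _ w F mixture, of x] by (simp add: inner)
  show "(LINT (s, u)|lborel. indicator {0..t} s * (indicator {0<..} u * u powr ((\<alpha> - \<beta>) / 2 - 1)) *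
      stable_gauss \<alpha> s u x)
      = riesz_const DIM('a) ((DIM('a) + \<beta> - \<alpha>) / 2) * spectral_integral \<alpha> \<beta> t x"
    using cos_mixture_integral[OF _ w F mixture, of x]
    by (simp add: inner integral_cos_mult_spectral_density c_def)
qed

section \<open>Atomless distribution functions\<close>

lemma closed_lower_set_eq_atMost:
  fixes S :: "real set"
  assumes "closed S" and lower: "\<And>x y. x \<le> y \<Longrightarrow> y \<in> S \<Longrightarrow> x \<in> S" and "S \<noteq> {}" "S \<noteq> UNIV"
  obtains \<sigma> where "S = {..\<sigma>}"
proof
  obtain z where "z \<notin> S" using \<open>S \<noteq> UNIV\<close> by blast
  then have bdd: "bdd_above S"
    using lower by (intro bdd_aboveI[of _ z]) (metis linear)
  then have "Sup S \<in> S"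
    using assms by (intro closed_contains_Sup)
  then show "S = {..Sup S}"
    using bdd lower by (auto intro: cSup_upper)
qed

lemma (in finite_borel_measure) cdf_sublevel_endpoint:
  assumes sublevel: "{x. cdf M x \<le> c} = {..\<sigma>}"
  shows "cdf M \<sigma> = c"
proof (rule antisym)
  have cdf_le_iff: "cdf M y \<le> c \<longleftrightarrow> y \<le> \<sigma>" for y
    using sublevel by (simp add: set_eq_iff)
  then show "cdf M \<sigma> \<le> c" by simp
  have "eventually (\<lambda>y. c \<le> cdf M y) (at_right \<sigma>)"
    using eventually_at_right_less[of \<sigma>] by eventually_elim (use cdf_le_iff in \<open>metis linear not_le\<close>)
  then show "c \<le> cdf M \<sigma>"
    using cdf_is_right_cont[of \<sigma>] by (intro tendsto_lowerbound) (auto simp: continuous_within)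
qed

lemma (in finite_borel_measure) measure_cdf_le:
  assumes atomless: "\<And>x. measure M {x} = 0"
  shows "measure M {x. cdf M x \<le> c} = max 0 (min c (measure M (space M)))"
proof -
  define S where "S = {x. cdf M x \<le> c}"
  define T where "T = measure M (space M)"
  have cont: "continuous_on UNIV (cdf M)"
    by (simp add: continuous_on_eq_continuous_at isCont_cdf atomless)
  consider (empty) "S = {}" | (univ) "S = UNIV" | (proper) "S \<noteq> {}" "S \<noteq> UNIV" by blast
  then have "measure M S = max 0 (min c T)"
  proof cases
    case empty
    then have "eventually (\<lambda>x. c \<le> cdf M x) at_bot"
      by (auto simp: S_def not_le intro!: always_eventually less_imp_le)
    then have "c \<le> 0"
      by (intro tendsto_lowerbound[OF cdf_lim_at_bot]) auto
    then show ?thesis using empty by simp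
  next
    case univ
    then have "eventually (\<lambda>x. cdf M x \<le> c) at_top"
      by (auto simp: S_def intro!: always_eventually)
    then have "T \<le> c"
      unfolding T_def by (intro tendsto_upperbound[OF cdf_lim_at_top]) auto
    then show ?thesis using univ by (simp add: T_def borel_UNIV)
  next
    case proper
    have "closed S"
      unfolding S_def by (intro closed_Collect_le cont continuous_on_const)
    moreover have "x \<in> S" if "x \<le> y" "y \<in> S" for x y
      using cdf_nondecreasing[OF that(1)] that(2) by (simp add: S_def)
    ultimately obtain \<sigma> where \<sigma>: "S = {..\<sigma>}"
      using closed_lower_set_eq_atMost[OF _ _ proper] by blast
    then have "cdf M \<sigma> = c"
      by (intro cdf_sublevel_endpoint) (simp add: S_def)
    then show ?thesis
      using cdf_nonneg[of \<sigma>] cdf_bounded[of \<sigma>] by (simp add: \<sigma> T_def flip: cdf_def2)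
  qed
  then show ?thesis by (simp add: S_def T_def)
qed

lemma (in finite_borel_measure) distr_cdf_atomless:
  assumes atomless: "\<And>x. measure M {x} = 0"
  shows "distr M borel (cdf M) = density lborel (indicator {0..measure M (space M)})"
proof (rule measure_eqI_lessThan)
  define T where "T = measure M (space M)"
  have [measurable]: "cdf M \<in> borel_measurable borel"
    by (intro borel_measurable_continuous_onI) (simp add: continuous_on_eq_continuous_at isCont_cdf atomless)
  then have [measurable]: "cdf M \<in> borel_measurable M"
    by (simp add: measurable_cong_sets[OF M_is_borel refl])
  fix c :: real
  have "cdf M -` {c<..} \<inter> space M = space M - {x. cdf M x \<le> c}"
    by auto
  moreover have "{x. cdf M x \<le> c} \<in> sets M"
    by (rule sets_M) measurable
  ultimately have "emeasure (distr M borel (cdf M)) {c<..} = ennreal (T - max 0 (min c T))"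
    using finite_measure_compl[of "{x. cdf M x \<le> c}"] measure_cdf_le[OF atomless]
    by (simp add: emeasure_distr emeasure_eq_measure T_def)
  also have "\<dots> = emeasure lborel ({0..T} \<inter> {c<..})"
  proof -
    have "T \<ge> 0" by (simp add: T_def)
    moreover have "{0..T} \<inter> {c<..} = (if c < 0 then {0..T} else {c<..T})" by auto
    ultimately show ?thesis by (auto simp: max_def min_def)
  qed
  also have "\<dots> = emeasure (density lborel (indicator {0..T})) {c<..}"
    by (subst emeasure_density) (auto simp flip: nn_integral_indicator
        intro!: nn_integral_cong split: split_indicator)
  finally show "emeasure (distr M borel (cdf M)) {c<..} =
      emeasure (density lborel (indicator {0..measure M (space M)})) {c<..}"
    by (simp add: T_def)
  show "emeasure (distr M borel (cdf M)) {c<..} < \<infinity>"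
    by (simp add: emeasure_distr emeasure_eq_measure)
qed auto

lemma (in finite_borel_measure) nn_integral_exp_neg_cdf:
  assumes "\<And>x. measure M {x} = 0"
  shows "(\<integral>\<^sup>+x. ennreal (exp (- cdf M x)) \<partial>M) = ennreal (1 - exp (- measure M (space M)))"
proof -
  have "cdf M \<in> borel_measurable M"
    unfolding measurable_cong_sets[OF M_is_borel refl]
    by (intro borel_measurable_continuous_onI) (simp add: continuous_on_eq_continuous_at isCont_cdf assms)
  then have "(\<integral>\<^sup>+x. ennreal (exp (- cdf M x)) \<partial>M) = (\<integral>\<^sup>+a. ennreal (exp (- a)) \<partial>distr M borel (cdf M))"
    by (simp add: nn_integral_distr)
  also have "\<dots> = (\<integral>\<^sup>+a\<in>{0..measure M (space M)}. ennreal (exp (- a * 1)) \<partial>lborel)"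
    unfolding distr_cdf_atomless[OF assms] by (subst nn_integral_density) (auto simp: mult.commute)
  also have "\<dots> = ennreal (1 - exp (- measure M (space M)))"
    by (subst nn_integral_exp_Icc) auto
  finally show ?thesis .
qed

lemma one_minus_exp_neg_nn_integral:
  fixes f :: "real \<Rightarrow> ennreal"
  assumes [measurable]: "f \<in> borel_measurable borel" and "t \<ge> 0"
    and fin: "(\<integral>\<^sup>+r\<in>{0..t}. f r \<partial>lborel) < \<infinity>"
  shows "ennreal (1 - exp (- enn2real (\<integral>\<^sup>+r\<in>{0..t}. f r \<partial>lborel)))
    = (\<integral>\<^sup>+s\<in>{0..t}. f s * ennreal (exp (- enn2real (\<integral>\<^sup>+r\<in>{0..s}. f r \<partial>lborel))) \<partial>lborel)"
proof -
  define \<mu> where "\<mu> = density lborel (\<lambda>s. f s * indicator {0..t} s)"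
  have em: "emeasure \<mu> A = (\<integral>\<^sup>+s. f s * indicator {0..t} s * indicator A s \<partial>lborel)" if "A \<in> sets borel" for A
    unfolding \<mu>_def using that by (subst emeasure_density) auto
  have space: "space \<mu> = UNIV" and sets: "sets \<mu> = sets borel" by (simp_all add: \<mu>_def)
  have "finite_measure \<mu>"
    using fin em[of UNIV] by (intro finite_measureI) (simp add: space)
  then interpret \<mu>: finite_borel_measure \<mu>
    by (intro finite_borel_measure.intro finite_borel_measure_axioms.intro sets)
  have cdf: "cdf \<mu> s = enn2real (\<integral>\<^sup>+r\<in>{0..s}. f r \<partial>lborel)" if "s \<in> {0..t}" for s
    unfolding cdf_def2 measure_def
    using that by (subst em) (auto intro!: arg_cong[where f = enn2real] nn_integral_cong split: split_indicator)
  have total: "measure \<mu> (space \<mu>) = enn2real (\<integral>\<^sup>+r\<in>{0..t}. f r \<partial>lborel)"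
    using em[of UNIV] by (simp add: measure_def space)
  have atomless: "measure \<mu> {x} = 0" for x
  proof -
    have "AE s in lborel. s \<noteq> x" by (rule AE_lborel_singleton)
    then have "(\<integral>\<^sup>+s. f s * indicator {0..t} s * indicator {x} s \<partial>lborel) = (\<integral>\<^sup>+s. 0 \<partial>(lborel :: real measure))"
      by (intro nn_integral_cong_AE) (auto elim!: eventually_mono)
    then show ?thesis by (simp add: measure_def em)
  qed
  have "cdf \<mu> \<in> borel_measurable borel"
    by (intro borel_measurable_continuous_onI) (simp add: continuous_on_eq_continuous_at \<mu>.isCont_cdf atomless)
  then have "(\<integral>\<^sup>+s. ennreal (exp (- cdf \<mu> s)) \<partial>\<mu>) =
      (\<integral>\<^sup>+s. f s * indicator {0..t} s * ennreal (exp (- cdf \<mu> s)) \<partial>lborel)"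
    unfolding \<mu>_def by (subst nn_integral_density) auto
  also have "\<dots> = (\<integral>\<^sup>+s\<in>{0..t}. f s * ennreal (exp (- enn2real (\<integral>\<^sup>+r\<in>{0..s}. f r \<partial>lborel))) \<partial>lborel)"
    by (intro nn_integral_cong) (auto simp: cdf split: split_indicator)
  finally show ?thesis
    using \<mu>.nn_integral_exp_neg_cdf[OF atomless] by (simp add: total)
qed

section \<open>Independence and conditional expectation\<close>

lemma (in prob_space) nn_integral_indep_set:
  assumes F: "subalgebra M F" and Y [measurable]: "random_variable T Y"
    and indep: "indep_set (sets F) {Y -` B \<inter> space M |B. B \<in> sets T}"
    and h [measurable]: "h \<in> borel_measurable (F \<Otimes>\<^sub>M T)"
  shows "(\<integral>\<^sup>+\<omega>. h (\<omega>, Y \<omega>) \<partial>M) = (\<integral>\<^sup>+\<omega>. \<integral>\<^sup>+\<omega>'. h (\<omega>, Y \<omega>') \<partial>M \<partial>M)"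
proof -
  have space: "space F = space M" and id [measurable]: "(\<lambda>\<omega>. \<omega>) \<in> measurable M F"
    using F by (auto simp: subalgebra_def intro!: measurableI)
  interpret F: prob_space "distr M F (\<lambda>\<omega>. \<omega>)" by (rule prob_space_distr[OF id])
  interpret T: prob_space "distr M T Y" by (rule prob_space_distr[OF Y])
  have joint: "distr M F (\<lambda>\<omega>. \<omega>) \<Otimes>\<^sub>M distr M T Y = distr M (F \<Otimes>\<^sub>M T) (\<lambda>\<omega>. (\<omega>, Y \<omega>))"
  proof (rule pair_measure_eqI)
    fix A B assume "A \<in> sets (distr M F (\<lambda>\<omega>. \<omega>))" "B \<in> sets (distr M T Y)"
    then have A: "A \<in> sets F" and B: "B \<in> sets T" by simp_all
    then have "prob (A \<inter> (Y -` B \<inter> space M)) = prob A * prob (Y -` B \<inter> space M)"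
      using indep by (intro indep_setD) auto
    moreover have "(\<lambda>\<omega>. (\<omega>, Y \<omega>)) -` (A \<times> B) \<inter> space M = A \<inter> (Y -` B \<inter> space M)" by auto
    moreover have "A \<inter> space M = A"
      using sets.sets_into_space[OF A] by (auto simp: space)
    ultimately show "emeasure (distr M F (\<lambda>\<omega>. \<omega>)) A * emeasure (distr M T Y) B =
        emeasure (distr M (F \<Otimes>\<^sub>M T) (\<lambda>\<omega>. (\<omega>, Y \<omega>))) (A \<times> B)"
      using A B by (simp add: emeasure_distr emeasure_eq_measure ennreal_mult)
  qed (unfold_locales, simp)
  have "(\<integral>\<^sup>+\<omega>. h (\<omega>, Y \<omega>) \<partial>M) = (\<integral>\<^sup>+v. h v \<partial>distr M (F \<Otimes>\<^sub>M T) (\<lambda>\<omega>. (\<omega>, Y \<omega>)))"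
    by (rule nn_integral_distr[symmetric]) measurable
  also have "\<dots> = (\<integral>\<^sup>+\<omega>. \<integral>\<^sup>+y. h (\<omega>, y) \<partial>distr M T Y \<partial>distr M F (\<lambda>\<omega>. \<omega>))"
    unfolding joint[symmetric] by (rule T.nn_integral_fst[symmetric]) measurable
  also have "\<dots> = (\<integral>\<^sup>+\<omega>. \<integral>\<^sup>+y. h (\<omega>, y) \<partial>distr M T Y \<partial>M)"
    by (rule nn_integral_distr) measurable
  also have "\<dots> = (\<integral>\<^sup>+\<omega>. \<integral>\<^sup>+\<omega>'. h (\<omega>, Y \<omega>') \<partial>M \<partial>M)"
    using space by (intro nn_integral_cong nn_integral_distr) measurable
  finally show ?thesis .
qed

lemma Int_stable_vimage:
  assumes "Int_stable A"
  shows "Int_stable {f -` E \<inter> \<Omega> |E. E \<in> A}"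
proof (rule Int_stableI)
  fix a b assume "a \<in> {f -` E \<inter> \<Omega> |E. E \<in> A}" "b \<in> {f -` E \<inter> \<Omega> |E. E \<in> A}"
  then obtain C D where "C \<in> A" "D \<in> A" and "a \<inter> b = f -` (C \<inter> D) \<inter> \<Omega>" by auto
  moreover have "C \<inter> D \<in> A"
    using assms \<open>C \<in> A\<close> \<open>D \<in> A\<close> by (rule Int_stableD)
  ultimately show "a \<inter> b \<in> {f -` E \<inter> \<Omega> |E. E \<in> A}" by blast
qed

lemma (in prob_space) indep_vars_last:
  assumes D: "indep_vars (\<lambda>_. borel) D {..<Suc n}"
    and U: "U \<in> measurable (PiM {..<n} (\<lambda>_. borel)) (count_space UNIV)" and C [measurable]: "C \<in> sets borel"
  shows "prob ({\<omega>\<in>space M. U (\<lambda>i\<in>{..<n}. D i \<omega>)} \<inter> {\<omega>\<in>space M. D n \<omega> \<in> C}) =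
    prob {\<omega>\<in>space M. U (\<lambda>i\<in>{..<n}. D i \<omega>)} * prob {\<omega>\<in>space M. D n \<omega> \<in> C}"
proof -
  have "indep_var (PiM {..<n} (\<lambda>_. borel)) (\<lambda>\<omega>. \<lambda>i\<in>{..<n}. D i \<omega>) (PiM {n} (\<lambda>_. borel)) (\<lambda>\<omega>. \<lambda>i\<in>{n}. D i \<omega>)"
    by (rule indep_var_restrict[OF D]) auto
  moreover have "(\<lambda>d. d n \<in> C) \<in> measurable (PiM {n} (\<lambda>_. borel)) (count_space UNIV)"
    by measurable
  ultimately have "indep_var (count_space UNIV) (U \<circ> (\<lambda>\<omega>. \<lambda>i\<in>{..<n}. D i \<omega>))
      (count_space UNIV) ((\<lambda>d. d n \<in> C) \<circ> (\<lambda>\<omega>. \<lambda>i\<in>{n}. D i \<omega>))"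
    using U by (intro indep_var_compose)
  from indep_varD[OF this, of "{True}" "{True}"] show ?thesis
    by (simp add: vimage_def Int_def conj_ac cong: conj_cong)
qed

lemma (in prob_space) indep_set_vimage_PiM:
  assumes X: "\<And>i. i \<in> I \<Longrightarrow> random_variable (N i) (X i)" and B: "Int_stable B" "B \<subseteq> events"
    and cylinders: "\<And>J G b. finite J \<Longrightarrow> J \<subseteq> I \<Longrightarrow> (\<And>j. j \<in> J \<Longrightarrow> G j \<in> sets (N j)) \<Longrightarrow> b \<in> B \<Longrightarrow>
      prob ({\<omega>\<in>space M. \<forall>j\<in>J. X j \<omega> \<in> G j} \<inter> b) = prob {\<omega>\<in>space M. \<forall>j\<in>J. X j \<omega> \<in> G j} * prob b"
  shows "indep_set (sets (vimage_algebra (space M) (\<lambda>\<omega>. \<lambda>i\<in>I. X i \<omega>) (PiM I N))) B"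
proof -
  let ?path = "\<lambda>\<omega>. \<lambda>i\<in>I. X i \<omega>"
  define A where "A = {?path -` E \<inter> space M |E. E \<in> prod_algebra I N}"
  have path: "random_variable (PiM I N) ?path"
    using X by measurable
  have "indep_set A B"
  proof (rule indep_setI[OF _ B(2)])
    show "A \<subseteq> events"
      using measurable_sets[OF path] by (auto simp: A_def sets_PiM intro: sigma_sets.Basic)
    fix a b assume "a \<in> A" "b \<in> B"
    then obtain E where E: "E \<in> prod_algebra I N" "a = ?path -` E \<inter> space M"
      by (auto simp: A_def)
    from prod_algebraE[OF E(1)] obtain J G where J: "E = prod_emb I N J (\<Pi>\<^sub>E j\<in>J. G j)" "finite J" "J \<subseteq> I"
      and G: "\<And>i. i \<in> J \<Longrightarrow> G i \<in> sets (N i)"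
      by metis
    have "a = {\<omega>\<in>space M. \<forall>j\<in>J. X j \<omega> \<in> G j}"
      unfolding E(2) J(1) using J(3) measurable_space[OF path]
      by (auto simp: prod_emb_def space_PiM Int_absorb1 PiE_iff)
    then show "prob (a \<inter> b) = prob a * prob b"
      using cylinders[OF J(2,3) G \<open>b \<in> B\<close>] by simp
  qed
  moreover have "Int_stable A"
    unfolding A_def by (rule Int_stable_vimage[OF Int_stable_prod_algebra])
  ultimately have "indep_set (sigma_sets (space M) A) (sigma_sets (space M) B)"
    using B(1) by (rule indep_set_sigma_sets)
  then have indep: "indep_set (sigma_sets (space M) A) B"
    unfolding indep_set_def by (rule indep_sets_mono_sets) (auto split: bool.split)
  have "?path \<in> space M \<rightarrow> (\<Pi>\<^sub>E i\<in>I. space (N i))"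
    using measurable_space[OF path] by (auto simp: space_PiM)
  then have "{?path -` E \<inter> space M |E. E \<in> sets (PiM I N)} = sigma_sets (space M) A"
    unfolding A_def sets_PiM by (rule sigma_sets_vimage_commute)
  moreover have "A \<subseteq> Pow (space M)"
    by (auto simp: A_def)
  ultimately show ?thesis
    using indep by (simp add: sets_vimage_algebra sigma_sets_sigma_sets_eq)
qed

lemma integrable_bounded_mult:
  fixes u g :: "'a \<Rightarrow> real"
  assumes g: "integrable M g" and [measurable]: "u \<in> borel_measurable M" and bounded: "\<And>\<omega>. \<bar>u \<omega>\<bar> \<le> b"
  shows "integrable M (\<lambda>\<omega>. u \<omega> * g \<omega>)"
proof (rule Bochner_Integration.integrable_bound)
  show "integrable M (\<lambda>\<omega>. b * \<bar>g \<omega>\<bar>)"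
    using g by (intro integrable_mult_right integrable_abs)
  show "AE \<omega> in M. norm (u \<omega> * g \<omega>) \<le> norm (b * \<bar>g \<omega>\<bar>)"
    by (intro AE_I2) (auto simp: abs_mult intro!: mult_right_mono order_trans[OF bounded abs_ge_self])
qed (use g in measurable)

lemma (in finite_measure_subalgebra)
  assumes "integrable M (\<lambda>\<omega>. u \<omega> * Z \<omega>)" "u \<in> borel_measurable F" "Z \<in> borel_measurable M"
  shows integrable_mult_real_cond_exp_residual: "integrable M (\<lambda>\<omega>. u \<omega> * (Z \<omega> - real_cond_exp M F Z \<omega>))"
    and integral_mult_real_cond_exp_residual: "(LINT \<omega>|M. u \<omega> * (Z \<omega> - real_cond_exp M F Z \<omega>)) = 0"
  using assms(1) real_cond_exp_intg[OF assms] by (simp_all add: right_diff_distrib)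

lemma (in finite_measure_subalgebra) AE_eq_real_cond_exp:
  assumes [measurable]: "Z \<in> borel_measurable M" and bounded: "\<And>\<omega>. \<bar>Z \<omega>\<bar> \<le> c"
    and orthogonal: "(LINT \<omega>|M. Z \<omega> * (Z \<omega> - real_cond_exp M F Z \<omega>)) = 0"
  shows "AE \<omega> in M. Z \<omega> = real_cond_exp M F Z \<omega>"
proof -
  define Z' where "Z' = real_cond_exp M F Z"
  define h where "h \<omega> = Z \<omega> - Z' \<omega>" for \<omega>
  have int_Z: "integrable M Z"
    using bounded by (intro integrable_const_bound[of _ c]) auto
  then have int_Z': "integrable M Z'"
    unfolding Z'_def by (rule real_cond_exp_int(1))
  have int_Z_h: "integrable M (\<lambda>\<omega>. Z \<omega> * h \<omega>)"
    using int_Z int_Z' bounded by (intro integrable_bounded_mult) (auto simp: h_def)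
  have "integrable M (\<lambda>\<omega>. Z' \<omega> * Z \<omega>)"
    using integrable_bounded_mult[OF int_Z' assms(1) bounded] by (simp add: mult.commute)
  moreover have "Z' \<in> borel_measurable F"
    unfolding Z'_def by (rule borel_measurable_cond_exp)
  ultimately have Z'_h: "integrable M (\<lambda>\<omega>. Z' \<omega> * h \<omega>)" "(LINT \<omega>|M. Z' \<omega> * h \<omega>) = 0"
    using integrable_mult_real_cond_exp_residual[of Z' Z] integral_mult_real_cond_exp_residual[of Z' Z]
    by (simp_all add: h_def Z'_def)
  have square: "(h \<omega>)\<^sup>2 = Z \<omega> * h \<omega> - Z' \<omega> * h \<omega>" for \<omega>
    by (simp add: h_def power2_eq_square left_diff_distrib)
  have "integrable M (\<lambda>\<omega>. (h \<omega>)\<^sup>2)" "(LINT \<omega>|M. (h \<omega>)\<^sup>2) = 0"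
    unfolding square using int_Z_h Z'_h orthogonal by (simp_all add: h_def Z'_def)
  then have "AE \<omega> in M. (h \<omega>)\<^sup>2 = 0"
    using integral_nonneg_eq_0_iff_AE[of M "\<lambda>\<omega>. (h \<omega>)\<^sup>2"] by simp
  then show ?thesis
    by eventually_elim (simp add: h_def Z'_def)
qed

lemma (in finite_measure) abs_integral_le_measure_space:
  fixes f :: "'a \<Rightarrow> real"
  assumes bounded: "\<And>r. \<bar>f r\<bar> \<le> c"
  shows "\<bar>LINT r|M. f r\<bar> \<le> c * measure M (space M)"
proof (cases "integrable M f")
  case True
  have "\<bar>LINT r|M. f r\<bar> \<le> (LINT r|M. \<bar>f r\<bar>)"
    by (rule integral_abs_bound)
  also have "\<dots> \<le> (LINT r|M. c)"
    using True bounded by (intro integral_mono) auto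
  finally show ?thesis by (simp add: mult.commute)
next
  case False
  have "0 \<le> c" using bounded[of undefined] by linarith
  then show ?thesis using False by (simp add: not_integrable_integral_eq)
qed

text \<open>For a residual \<open>h = Z - E(Z | F)\<close>, Fubini turns \<open>E(Z h)\<close> into the integral over \<open>r\<close> of
  \<open>E(w r h) = 0\<close>, so that \<open>E(h\<^sup>2) = 0\<close>.\<close>

lemma (in finite_measure_subalgebra) parameter_integral_eq_real_cond_exp:
  fixes w :: "'b \<Rightarrow> 'a \<Rightarrow> real"
  assumes "finite_measure N" and w [measurable]: "(\<lambda>(r, \<omega>). w r \<omega>) \<in> borel_measurable (N \<Otimes>\<^sub>M M)"
    and adapted: "\<And>r. r \<in> space N \<Longrightarrow> w r \<in> borel_measurable F"
    and bounded: "\<And>r \<omega>. \<bar>w r \<omega>\<bar> \<le> c"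
  shows "AE \<omega> in M. (LINT r|N. w r \<omega>) = real_cond_exp M F (\<lambda>\<omega>. LINT r|N. w r \<omega>) \<omega>"
proof -
  interpret N: finite_measure N by fact
  interpret pair_sigma_finite N M ..
  define Z where "Z \<omega> = (LINT r|N. w r \<omega>)" for \<omega>
  define h where "h \<omega> = Z \<omega> - real_cond_exp M F Z \<omega>" for \<omega>
  have [measurable]: "Z \<in> borel_measurable M" unfolding Z_def by measurable
  have Z_bound: "\<bar>Z \<omega>\<bar> \<le> c * measure N (space N)" for \<omega>
    unfolding Z_def by (rule N.abs_integral_le_measure_space[OF bounded])
  have int_Z: "integrable M Z"
    using Z_bound by (intro integrable_const_bound[of _ "c * measure N (space N)"]) auto
  have int_h: "integrable M h"
    unfolding h_def using int_Z real_cond_exp_int(1)[OF int_Z] by simp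
  have w_h: "(LINT \<omega>|M. w r \<omega> * h \<omega>) = 0" if "r \<in> space N" for r
    unfolding h_def using adapted[OF that] measurable_from_subalg[OF subalg] bounded
    by (intro integral_mult_real_cond_exp_residual integrable_bounded_mult[OF int_Z]) auto
  have "(LINT \<omega>|M. Z \<omega> * h \<omega>) = (LINT \<omega>|M. LINT r|N. w r \<omega> * h \<omega>)"
    by (simp add: Z_def)
  also have "\<dots> = (LINT r|N. LINT \<omega>|M. w r \<omega> * h \<omega>)"
  proof (rule Fubini_integral)
    have [measurable]: "h \<in> borel_measurable M" using int_h by simp
    have c: "0 \<le> c" using bounded[of undefined undefined] by linarith
    have "(\<integral>\<^sup>+\<omega>. \<integral>\<^sup>+r. ennreal \<bar>w r \<omega> * h \<omega>\<bar> \<partial>N \<partial>M) \<le> (\<integral>\<^sup>+\<omega>. \<integral>\<^sup>+r. ennreal (c * \<bar>h \<omega>\<bar>) \<partial>N \<partial>M)"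
      using bounded by (intro nn_integral_mono ennreal_leI) (auto simp: abs_mult intro: mult_right_mono)
    also have "\<dots> < \<infinity>"
      using int_h c
      by (simp add: nn_integral_multc nn_integral_eq_integral ennreal_mult_less_top N.emeasure_eq_measure)
    finally show "integrable (N \<Otimes>\<^sub>M M) (\<lambda>(r, \<omega>). w r \<omega> * h \<omega>)"
      by (intro integrableI_bounded) (simp_all add: nn_integral_snd[symmetric])
  qed
  also have "\<dots> = 0"
    using w_h by (simp cong: Bochner_Integration.integral_cong)
  finally have "(LINT \<omega>|M. Z \<omega> * h \<omega>) = 0" .
  then show ?thesis
    using AE_eq_real_cond_exp[of Z, OF _ Z_bound] unfolding h_def Z_def[abs_def] by simp
qed

lemma (in finite_measure) nn_integral_eq_SUP_truncated:
  assumes [measurable]: "f \<in> borel_measurable M"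
  shows "(\<integral>\<^sup>+x. f x \<partial>M) = (SUP n. ennreal (LINT x|M. enn2real (min (f x) (of_nat n))))"
proof -
  have trunc: "ennreal (enn2real (min (f x) (of_nat n))) = min (f x) (of_nat n)" for x and n :: nat
    by (rule ennreal_enn2real) (simp add: min_less_iff_disj ennreal_of_nat_eq_real_of_nat)
  have "f x = (SUP n. min (f x) (of_nat n))" for x
    by (simp add: inf_min[symmetric] inf_SUP[symmetric] ennreal_SUP_of_nat_eq_top)
  then have "(\<integral>\<^sup>+x. f x \<partial>M) = (\<integral>\<^sup>+x. (SUP n. min (f x) (of_nat n)) \<partial>M)"
    by (simp cong: nn_integral_cong)
  also have "\<dots> = (SUP n. \<integral>\<^sup>+x. min (f x) (of_nat n) \<partial>M)"
    by (rule nn_integral_monotone_convergence_SUP)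
      (auto simp: incseq_def le_fun_def intro: min.coboundedI2 of_nat_mono)
  also have "\<dots> = (SUP n. ennreal (LINT x|M. enn2real (min (f x) (of_nat n))))"
  proof (intro SUP_cong refl)
    fix n :: nat
    have "enn2real (min (f x) (of_nat n)) \<le> real n" for x
      using enn2real_mono[of "min (f x) (of_nat n)" "of_nat n"] by (simp add: ennreal_of_nat_eq_real_of_nat)
    then have "integrable M (\<lambda>x. enn2real (min (f x) (of_nat n)))"
      by (intro integrable_const_bound[of _ "real n"]) auto
    then show "(\<integral>\<^sup>+x. min (f x) (of_nat n) \<partial>M) = ennreal (LINT x|M. enn2real (min (f x) (of_nat n)))"
      by (subst nn_integral_eq_integral[symmetric]) (auto simp: trunc)
  qed
  finally show ?thesis .
qed

lemma (in finite_measure_subalgebra) nn_parameter_integral_AE_eq: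
  fixes w :: "'b \<Rightarrow> 'a \<Rightarrow> ennreal"
  assumes "finite_measure N" and w [measurable]: "(\<lambda>(r, \<omega>). w r \<omega>) \<in> borel_measurable (N \<Otimes>\<^sub>M M)"
    and adapted: "\<And>r. r \<in> space N \<Longrightarrow> w r \<in> borel_measurable F"
  shows "\<exists>Z\<in>borel_measurable F. AE \<omega> in M. (\<integral>\<^sup>+r. w r \<omega> \<partial>N) = Z \<omega>"
proof
  interpret N: finite_measure N by fact
  define v where "v n r \<omega> = enn2real (min (w r \<omega>) (of_nat n))" for n :: nat and r \<omega>
  define Z where "Z n = real_cond_exp M F (\<lambda>\<omega>. LINT r|N. v n r \<omega>)" for n
  have v: "\<bar>v n r \<omega>\<bar> \<le> real n" for n r \<omega>
    using enn2real_mono[of "min (w r \<omega>) (of_nat n)" "of_nat n"] by (simp add: v_def ennreal_of_nat_eq_real_of_nat)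
  have [measurable]: "(\<lambda>(r, \<omega>). v n r \<omega>) \<in> borel_measurable (N \<Otimes>\<^sub>M M)" for n
    unfolding v_def by measurable
  have "AE \<omega> in M. (LINT r|N. v n r \<omega>) = Z n \<omega>" for n
    unfolding Z_def using adapted \<open>finite_measure N\<close> v
    by (intro parameter_integral_eq_real_cond_exp[where c = "real n"]) (auto simp: v_def)
  then have "AE \<omega> in M. \<forall>n. (LINT r|N. v n r \<omega>) = Z n \<omega>"
    by (simp add: AE_all_countable)
  then show "AE \<omega> in M. (\<integral>\<^sup>+r. w r \<omega> \<partial>N) = (SUP n. ennreal (Z n \<omega>))"
    using AE_space
  proof eventually_elim
    case (elim \<omega>)
    have "(\<lambda>r. w r \<omega>) \<in> borel_measurable N"
      using elim(2) by measurable
    from N.nn_integral_eq_SUP_truncated[OF this] show ?case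
      using elim(1) by (simp add: v_def)
  qed
  show "(\<lambda>\<omega>. SUP n. ennreal (Z n \<omega>)) \<in> borel_measurable F"
    unfolding Z_def by measurable
qed

section \<open>Processes with stationary independent increments\<close>

locale stationary_independent_increments = prob_space M
  for M :: "'b measure" +
  fixes X :: "real \<Rightarrow> 'b \<Rightarrow> 'a::euclidean_space" and x0 :: 'a
  assumes X_joint: "(\<lambda>(s, \<omega>). X s \<omega>) \<in> borel_measurable (lborel \<Otimes>\<^sub>M M)"
    and X_0: "X 0 \<omega> = x0"
    and stationary: "0 \<le> s \<Longrightarrow> s < t \<Longrightarrow>
      distr M borel (\<lambda>\<omega>. X t \<omega> - X s \<omega>) = distr M borel (\<lambda>\<omega>. X (t - s) \<omega> - x0)"
    and independent: "sorted_wrt (<) ts \<Longrightarrow> ts \<noteq> [] \<Longrightarrow> 0 \<le> hd ts \<Longrightarrow>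
      indep_vars (\<lambda>_. borel) (\<lambda>i \<omega>. X (ts ! Suc i) \<omega> - X (ts ! i) \<omega>) {..<length ts - 1}"
begin

lemma X_measurable [measurable (raw)]:
  assumes [measurable]: "f \<in> borel_measurable N" "g \<in> measurable N M"
  shows "(\<lambda>w. X (f w) (g w)) \<in> borel_measurable N"
proof -
  have "(\<lambda>w. (f w, g w)) \<in> measurable N (lborel \<Otimes>\<^sub>M M)" by measurable
  from measurable_comp[OF this X_joint] show ?thesis by (simp add: comp_def)
qed

definition P :: "real \<Rightarrow> ('a \<Rightarrow> ennreal) \<Rightarrow> 'a \<Rightarrow> ennreal" where
  "P t f x = (\<integral>\<^sup>+\<omega>. f (x + (X t \<omega> - x0)) \<partial>M)"

lemma P_measurable [measurable (raw)]:
  assumes [measurable]: "h \<in> borel_measurable borel" "f \<in> borel_measurable N" "g \<in> borel_measurable N"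
  shows "(\<lambda>w. P (f w) h (g w)) \<in> borel_measurable N"
  unfolding P_def by measurable

lemma P_start: "P t f x0 = (\<integral>\<^sup>+\<omega>. f (X t \<omega>) \<partial>M)"
  by (simp add: P_def)

lemma P_cmult:
  assumes [measurable]: "f \<in> borel_measurable borel"
  shows "P t (\<lambda>y. c * f y) x = c * P t f x"
  unfolding P_def by (rule nn_integral_cmult) measurable

lemma P_add:
  assumes [measurable]: "f \<in> borel_measurable borel" "g \<in> borel_measurable borel"
  shows "P t (\<lambda>y. f y + g y) x = P t f x + P t g x"
  unfolding P_def by (rule nn_integral_add) measurable

lemma P_const: "P t (\<lambda>y. c) x = c"
  by (simp add: P_def emeasure_space_1)

lemma P_mono: "(\<And>y. f y \<le> g y) \<Longrightarrow> P t f x \<le> P t g x"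
  unfolding P_def by (intro nn_integral_mono)

lemma P_nn_integral:
  fixes h :: "real \<Rightarrow> 'a \<Rightarrow> ennreal"
  assumes [measurable]: "(\<lambda>(u, y). h u y) \<in> borel_measurable (borel \<Otimes>\<^sub>M borel)"
  shows "P t (\<lambda>y. \<integral>\<^sup>+u. h u y \<partial>lborel) x = (\<integral>\<^sup>+u. P t (h u) x \<partial>lborel)"
proof -
  interpret pair_sigma_finite lborel M ..
  show ?thesis unfolding P_def by (rule Fubini') measurable
qed

lemma P_increment:
  assumes "0 \<le> s" "s < t" and [measurable]: "f \<in> borel_measurable borel"
  shows "(\<integral>\<^sup>+\<omega>. f (y + (X t \<omega> - X s \<omega>)) \<partial>M) = P (t - s) f y"
proof -
  have "(\<integral>\<^sup>+\<omega>. f (y + (X t \<omega> - X s \<omega>)) \<partial>M) = (\<integral>\<^sup>+z. f (y + z) \<partial>distr M borel (\<lambda>\<omega>. X t \<omega> - X s \<omega>))"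
    by (rule nn_integral_distr[symmetric]) measurable
  also have "\<dots> = P (t - s) f y"
    unfolding stationary[OF assms(1,2)] P_def by (rule nn_integral_distr) measurable
  finally show ?thesis .
qed

definition past :: "real \<Rightarrow> 'b measure" where
  "past s = vimage_algebra (space M) (\<lambda>\<omega>. \<lambda>r\<in>{0..s}. X r \<omega>) (PiM {0..s} (\<lambda>_. borel))"

lemma path_measurable: "(\<lambda>\<omega>. \<lambda>r\<in>{0..s}. X r \<omega>) \<in> measurable M (PiM {0..s} (\<lambda>_. borel))"
  by measurable

lemma subalgebra_past: "subalgebra M (past s)"
  unfolding subalgebra_def past_def by (simp add: sets_image_in_sets[OF refl path_measurable])

lemma X_past_measurable:
  assumes "0 \<le> r" "r \<le> s"
  shows "X r \<in> borel_measurable (past s)"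
proof -
  have "(\<lambda>\<omega>. (\<lambda>r\<in>{0..s}. X r \<omega>) r) \<in> borel_measurable (past s)"
    unfolding past_def using assms
    by (intro measurable_compose[OF measurable_vimage_algebra1 measurable_component_singleton]
        Pi_I measurable_space[OF path_measurable]) auto
  then show ?thesis using assms by simp
qed

lemma prob_cylinder_Int_increment:
  assumes s: "0 < s" "s < t" and J: "finite J" "J \<subseteq> {0..s}"
    and G [measurable]: "\<And>r. r \<in> J \<Longrightarrow> G r \<in> sets borel" and C [measurable]: "C \<in> sets borel"
  shows "prob ({\<omega>\<in>space M. \<forall>r\<in>J. X r \<omega> \<in> G r} \<inter> {\<omega>\<in>space M. X t \<omega> - X s \<omega> \<in> C}) =
    prob {\<omega>\<in>space M. \<forall>r\<in>J. X r \<omega> \<in> G r} * prob {\<omega>\<in>space M. X t \<omega> - X s \<omega> \<in> C}"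
proof -
  define L where "L = 0 # sorted_list_of_set (J \<inter> {0<..<s}) @ [s]"
  define n where "n = length L - 1"
  define D where "D i \<omega> = X ((L @ [t]) ! Suc i) \<omega> - X ((L @ [t]) ! i) \<omega>" for i \<omega>
  have L: "length L = Suc n" "L ! 0 = 0" "L ! n = s" "set L = insert 0 (insert s (J \<inter> {0<..<s}))"
    using J by (auto simp: L_def n_def nth_append)
  have "sorted_wrt (<) (L @ [t])"
    using J s by (auto simp: L_def sorted_wrt_append)
  then have D: "indep_vars (\<lambda>_. borel) D {..<Suc n}"
    using independent[of "L @ [t]"] by (simp add: L_def n_def D_def[abs_def])
  have D_n: "D n \<omega> = X t \<omega> - X s \<omega>" for \<omega>
    using L by (simp add: D_def nth_append)
  have X_L: "X (L ! k) \<omega> = x0 + (\<Sum>i<k. D i \<omega>)" if "k \<le> n" for k \<omega>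
    using that L sum_lessThan_telescope[of "\<lambda>i. X ((L @ [t]) ! i) \<omega>" k] by (simp add: D_def nth_append X_0)
  have "\<exists>k\<le>n. L ! k = r" if "r \<in> J" for r
  proof -
    have "r \<in> set L" using that J(2) by (force simp: L(4))
    then show ?thesis using L(1) by (auto simp: in_set_conv_nth less_Suc_eq_le)
  qed
  then obtain k where k: "\<And>r. r \<in> J \<Longrightarrow> k r \<le> n" "\<And>r. r \<in> J \<Longrightarrow> L ! k r = r" by metis
  have X_J: "X r \<omega> = x0 + (\<Sum>i<k r. D i \<omega>)" if "r \<in> J" for r \<omega>
    using X_L[OF k(1)[OF that]] k(2)[OF that] by simp
  define U where "U d \<longleftrightarrow> (\<forall>r\<in>J. x0 + (\<Sum>i<k r. d i) \<in> G r)" for d :: "nat \<Rightarrow> 'a"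
  have U: "U \<in> measurable (PiM {..<n} (\<lambda>_. borel)) (count_space UNIV)"
  proof -
    have [measurable]: "(\<lambda>d. x0 + (\<Sum>i<k r. d i)) \<in> borel_measurable (PiM {..<n} (\<lambda>_. borel))" if "r \<in> J" for r
      using k(1)[OF that] by (intro borel_measurable_add borel_measurable_const borel_measurable_sum
          measurable_component_singleton) auto
    show ?thesis unfolding U_def[abs_def] using J(1) by measurable
  qed
  have "U (\<lambda>i\<in>{..<n}. D i \<omega>) \<longleftrightarrow> (\<forall>r\<in>J. X r \<omega> \<in> G r)" for \<omega>
  proof -
    have "(\<Sum>i<k r. (\<lambda>i\<in>{..<n}. D i \<omega>) i) = (\<Sum>i<k r. D i \<omega>)" if "r \<in> J" for r
      using k(1)[OF that] by (intro sum.cong) auto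
    then show ?thesis by (simp add: U_def X_J)
  qed
  then show ?thesis
    using indep_vars_last[OF D U C] by (simp only: D_n)
qed

lemma indep_set_past:
  assumes "0 < s" "s < t"
  shows "indep_set (sets (past s)) {(\<lambda>\<omega>. X t \<omega> - X s \<omega>) -` C \<inter> space M |C. C \<in> sets borel}"
  unfolding past_def
proof (rule indep_set_vimage_PiM)
  show "Int_stable {(\<lambda>\<omega>. X t \<omega> - X s \<omega>) -` C \<inter> space M |C. C \<in> sets borel}"
    by (rule Int_stable_vimage[OF sets.Int_stable])
  show "{(\<lambda>\<omega>. X t \<omega> - X s \<omega>) -` C \<inter> space M |C. C \<in> sets borel} \<subseteq> events"
    by auto
  fix J b and G :: "real \<Rightarrow> 'a set"
  assume J: "finite J" "J \<subseteq> {0..s}" "\<And>r. r \<in> J \<Longrightarrow> G r \<in> sets borel"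
    and "b \<in> {(\<lambda>\<omega>. X t \<omega> - X s \<omega>) -` C \<inter> space M |C. C \<in> sets borel}"
  then obtain C where "C \<in> sets borel" "b = {\<omega>\<in>space M. X t \<omega> - X s \<omega> \<in> C}" by auto
  then show "prob ({\<omega>\<in>space M. \<forall>r\<in>J. X r \<omega> \<in> G r} \<inter> b) = prob {\<omega>\<in>space M. \<forall>r\<in>J. X r \<omega> \<in> G r} * prob b"
    using prob_cylinder_Int_increment[OF assms J] by simp
qed measurable

lemma markov:
  assumes s: "0 < s" "s < t" and [measurable]: "f \<in> borel_measurable borel"
    and H: "AE \<omega> in M. H \<omega> = H' \<omega>" and H' [measurable]: "H' \<in> borel_measurable (past s)"
  shows "(\<integral>\<^sup>+\<omega>. H \<omega> * f (X t \<omega>) \<partial>M) = (\<integral>\<^sup>+\<omega>. H \<omega> * P (t - s) f (X s \<omega>) \<partial>M)"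
proof -
  have [measurable]: "X s \<in> borel_measurable (past s)"
    using s by (intro X_past_measurable) auto
  have "(\<integral>\<^sup>+\<omega>. H \<omega> * f (X t \<omega>) \<partial>M) = (\<integral>\<^sup>+\<omega>. H' \<omega> * f (X s \<omega> + (X t \<omega> - X s \<omega>)) \<partial>M)"
    by (rule nn_integral_cong_AE) (use H in eventually_elim, simp)
  also have "\<dots> = (\<integral>\<^sup>+\<omega>. \<integral>\<^sup>+\<omega>'. H' \<omega> * f (X s \<omega> + (X t \<omega>' - X s \<omega>')) \<partial>M \<partial>M)"
    using nn_integral_indep_set[OF subalgebra_past _ indep_set_past[OF s], of "\<lambda>(\<omega>, z). H' \<omega> * f (X s \<omega> + z)"] by simp
  also have "\<dots> = (\<integral>\<^sup>+\<omega>. H' \<omega> * P (t - s) f (X s \<omega>) \<partial>M)"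
    using s by (simp add: nn_integral_cmult P_increment)
  also have "\<dots> = (\<integral>\<^sup>+\<omega>. H \<omega> * P (t - s) f (X s \<omega>) \<partial>M)"
    by (rule nn_integral_cong_AE) (use H in eventually_elim, simp)
  finally show ?thesis .
qed

end

section \<open>Killing at a nonnegative rate\<close>

locale killed_process = stationary_independent_increments M X x0
  for M :: "'b measure" and X :: "real \<Rightarrow> 'b \<Rightarrow> 'a::euclidean_space" and x0 :: 'a +
  fixes V :: "'a \<Rightarrow> real"
  assumes V_measurable [measurable]: "V \<in> borel_measurable borel"
    and V_nonneg: "0 \<le> V y"
    and potential_finite: "0 < t \<Longrightarrow> (\<integral>\<^sup>+r\<in>{0..t}. P r (\<lambda>y. ennreal (V y)) x0 \<partial>lborel) < \<infinity>"
begin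

definition clock :: "real \<Rightarrow> 'b \<Rightarrow> ennreal" where
  "clock s \<omega> = (\<integral>\<^sup>+r\<in>{0..s}. ennreal (V (X r \<omega>)) \<partial>lborel)"

definition survival :: "real \<Rightarrow> 'b \<Rightarrow> real" where
  "survival s \<omega> = exp (- enn2real (clock s \<omega>))"

lemma clock_measurable [measurable (raw)]:
  assumes [measurable]: "f \<in> borel_measurable N" "g \<in> measurable N M"
  shows "(\<lambda>w. clock (f w) (g w)) \<in> borel_measurable N"
  unfolding clock_def by (intro borel_measurable_nn_integral_Icc) measurable

lemma survival_measurable [measurable (raw)]:
  assumes [measurable]: "f \<in> borel_measurable N" "g \<in> measurable N M"
  shows "(\<lambda>w. survival (f w) (g w)) \<in> borel_measurable N"
  unfolding survival_def by measurable

lemma survival_bounds: "0 \<le> survival s \<omega>" "survival s \<omega> \<le> 1"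
  by (simp_all add: survival_def)

lemma clock_finite:
  assumes "t > 0"
  shows "AE \<omega> in M. clock t \<omega> < \<infinity>"
proof -
  interpret pair_sigma_finite lborel M ..
  have "(\<integral>\<^sup>+\<omega>. clock t \<omega> \<partial>M) = (\<integral>\<^sup>+r. \<integral>\<^sup>+\<omega>. ennreal (V (X r \<omega>)) * indicator {0..t} r \<partial>M \<partial>lborel)"
    unfolding clock_def by (rule Fubini') measurable
  also have "\<dots> = (\<integral>\<^sup>+r\<in>{0..t}. P r (\<lambda>y. ennreal (V y)) x0 \<partial>lborel)"
    unfolding P_start by (intro nn_integral_cong nn_integral_multc) measurable
  finally have "(\<integral>\<^sup>+\<omega>. clock t \<omega> \<partial>M) \<noteq> \<infinity>"
    using potential_finite[OF assms] by simp
  then have "AE \<omega> in M. clock t \<omega> \<noteq> \<infinity>"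
    by (rule nn_integral_PInf_AE[rotated]) measurable
  then show ?thesis by eventually_elim (simp add: less_top)
qed

text \<open>Without path regularity \<open>clock s\<close> need not be measurable for the past of \<open>s\<close>; it only agrees
  almost surely with a function that is.\<close>

lemma survival_past:
  "\<exists>S\<in>borel_measurable (past s). AE \<omega> in M. survival s \<omega> = S \<omega>"
proof -
  interpret past: finite_measure_subalgebra M "past s"
    by standard (rule subalgebra_past)
  define N where "N = restrict_space lborel {0..s}"
  have N: "finite_measure N" "space N = {0..s}"
    by (auto simp: N_def space_restrict_space emeasure_restrict_space emeasure_lborel_Icc_eq intro!: finite_measureI)
  have "\<exists>C\<in>borel_measurable (past s). AE \<omega> in M. (\<integral>\<^sup>+r. ennreal (V (X r \<omega>)) \<partial>N) = C \<omega>"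
  proof (rule past.nn_parameter_integral_AE_eq[OF N(1)])
    have [measurable]: "(\<lambda>r. r) \<in> borel_measurable N"
      unfolding N_def by (rule measurable_restrict_space1) simp
    show "(\<lambda>(r, \<omega>). ennreal (V (X r \<omega>))) \<in> borel_measurable (N \<Otimes>\<^sub>M M)"
      by measurable
    fix r assume "r \<in> space N"
    then have [measurable]: "X r \<in> borel_measurable (past s)"
      by (intro X_past_measurable) (auto simp: N(2))
    show "(\<lambda>\<omega>. ennreal (V (X r \<omega>))) \<in> borel_measurable (past s)" by measurable
  qed
  then obtain C where [measurable]: "C \<in> borel_measurable (past s)" and "AE \<omega> in M. clock s \<omega> = C \<omega>"
    by (auto simp: N_def nn_integral_restrict_space clock_def)
  then show ?thesis
    by (intro bexI[of _ "\<lambda>\<omega>. exp (- enn2real (C \<omega>))"]) (auto simp: survival_def elim!: eventually_mono)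
qed

lemma markov_survival:
  assumes s: "0 < s" "s < t" and [measurable]: "f \<in> borel_measurable borel"
  shows "(\<integral>\<^sup>+\<omega>. ennreal (V (X s \<omega>)) * ennreal (survival s \<omega>) * f (X t \<omega>) \<partial>M) =
    (\<integral>\<^sup>+\<omega>. ennreal (V (X s \<omega>)) * ennreal (survival s \<omega>) * P (t - s) f (X s \<omega>) \<partial>M)"
proof -
  obtain S where [measurable]: "S \<in> borel_measurable (past s)" and S: "AE \<omega> in M. survival s \<omega> = S \<omega>"
    using survival_past by blast
  have [measurable]: "X s \<in> borel_measurable (past s)"
    using s by (intro X_past_measurable) auto
  have "AE \<omega> in M. ennreal (V (X s \<omega>)) * ennreal (survival s \<omega>) = ennreal (V (X s \<omega>)) * ennreal (S \<omega>)"
    using S by eventually_elim simp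
  then show ?thesis by (rule markov[OF s assms(3)]) measurable
qed

lemma one_minus_survival:
  assumes "t > 0"
  shows "AE \<omega> in M. ennreal (1 - survival t \<omega>) =
    (\<integral>\<^sup>+s\<in>{0..t}. ennreal (V (X s \<omega>)) * ennreal (survival s \<omega>) \<partial>lborel)"
  using clock_finite[OF assms] AE_space
proof eventually_elim
  case (elim \<omega>)
  have "(\<lambda>r. ennreal (V (X r \<omega>))) \<in> borel_measurable borel" using elim(2) by measurable
  then show ?case
    using one_minus_exp_neg_nn_integral[of "\<lambda>r. ennreal (V (X r \<omega>))" t] elim(1) assms
    by (simp add: survival_def clock_def)
qed

lemma fk_weight_eq_survival:
  assumes "t > 0"
  shows "AE \<omega> in M. fk_weight (\<lambda>y. - V y) X t \<omega> = survival t \<omega>"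
  using clock_finite[OF assms] AE_space
proof eventually_elim
  case (elim \<omega>)
  have [measurable]: "(\<lambda>r. V (X r \<omega>)) \<in> borel_measurable borel" using elim(2) by measurable
  have clock: "(\<integral>\<^sup>+r. ennreal (indicator {0..t} r *\<^sub>R V (X r \<omega>)) \<partial>lborel) = clock t \<omega>"
    unfolding clock_def by (intro nn_integral_cong) (auto simp: indicator_def)
  have "integrable lborel (\<lambda>r. indicator {0..t} r *\<^sub>R V (X r \<omega>))"
    using clock elim(1) V_nonneg by (intro integrableI_nonneg) (auto simp: indicator_def)
  moreover have "(LINT r|lborel. indicator {0..t} r *\<^sub>R V (X r \<omega>)) = enn2real (clock t \<omega>)"
    unfolding clock[symmetric] using V_nonneg by (intro integral_eq_nn_integral) (auto simp: indicator_def)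
  ultimately show ?case
    by (simp add: fk_weight_def survival_def set_integrable_def set_lebesgue_integral_def)
qed

definition surviving :: "real \<Rightarrow> ('a \<Rightarrow> ennreal) \<Rightarrow> ennreal" where
  "surviving t f = (\<integral>\<^sup>+\<omega>. f (X t \<omega>) * ennreal (survival t \<omega>) \<partial>M)"

definition killed :: "real \<Rightarrow> ('a \<Rightarrow> ennreal) \<Rightarrow> ennreal" where
  "killed t f = (\<integral>\<^sup>+\<omega>. f (X t \<omega>) * ennreal (1 - survival t \<omega>) \<partial>M)"

lemma surviving_measurable [measurable (raw)]:
  assumes [measurable]: "f \<in> borel_measurable borel" "g \<in> borel_measurable N"
  shows "(\<lambda>w. surviving (g w) f) \<in> borel_measurable N"
  unfolding surviving_def by measurable

lemma killed_measurable [measurable (raw)]: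
  assumes [measurable]: "f \<in> borel_measurable borel" "g \<in> borel_measurable N"
  shows "(\<lambda>w. killed (g w) f) \<in> borel_measurable N"
  unfolding killed_def by measurable

lemma surviving_cmult:
  assumes [measurable]: "f \<in> borel_measurable borel"
  shows "surviving t (\<lambda>y. c * f y) = c * surviving t f"
  unfolding surviving_def by (simp add: mult.assoc nn_integral_cmult)

lemma surviving_add:
  assumes [measurable]: "f \<in> borel_measurable borel" "g \<in> borel_measurable borel"
  shows "surviving t (\<lambda>y. f y + g y) = surviving t f + surviving t g"
  unfolding surviving_def by (simp add: distrib_right nn_integral_add)

lemma surviving_nn_integral:
  fixes h :: "real \<Rightarrow> 'a \<Rightarrow> ennreal"
  assumes [measurable]: "(\<lambda>(u, y). h u y) \<in> borel_measurable (borel \<Otimes>\<^sub>M borel)"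
  shows "surviving t (\<lambda>y. \<integral>\<^sup>+u. h u y \<partial>lborel) = (\<integral>\<^sup>+u. surviving t (h u) \<partial>lborel)"
proof -
  interpret pair_sigma_finite lborel M ..
  have "surviving t (\<lambda>y. \<integral>\<^sup>+u. h u y \<partial>lborel) = (\<integral>\<^sup>+\<omega>. \<integral>\<^sup>+u. h u (X t \<omega>) * ennreal (survival t \<omega>) \<partial>lborel \<partial>M)"
    unfolding surviving_def by (intro nn_integral_cong nn_integral_multc[symmetric]) measurable
  also have "\<dots> = (\<integral>\<^sup>+u. surviving t (h u) \<partial>lborel)"
    unfolding surviving_def by (rule Fubini') measurable
  finally show ?thesis .
qed

lemma surviving_add_killed:
  assumes [measurable]: "f \<in> borel_measurable borel"
  shows "surviving t f + killed t f = P t f x0"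
proof -
  have "ennreal (survival t \<omega>) + ennreal (1 - survival t \<omega>) = 1" for \<omega>
    using survival_bounds[of t \<omega>] by (simp flip: ennreal_plus)
  then show ?thesis
    unfolding surviving_def killed_def P_start
    by (subst nn_integral_add[symmetric]) (simp_all flip: distrib_left)
qed

lemma killed_duhamel:
  assumes t: "t > 0" and [measurable]: "f \<in> borel_measurable borel"
  shows "killed t f = (\<integral>\<^sup>+s\<in>{0..t}. surviving s (\<lambda>y. ennreal (V y) * P (t - s) f y) \<partial>lborel)"
proof -
  interpret pair_sigma_finite lborel M ..
  define W where "W s \<omega> = ennreal (V (X s \<omega>)) * ennreal (survival s \<omega>)" for s \<omega>
  have [measurable]: "(\<lambda>(s, \<omega>). W s \<omega>) \<in> borel_measurable (lborel \<Otimes>\<^sub>M M)"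
    unfolding W_def by measurable
  have "killed t f = (\<integral>\<^sup>+\<omega>. \<integral>\<^sup>+s. W s \<omega> * f (X t \<omega>) * indicator {0..t} s \<partial>lborel \<partial>M)"
    unfolding killed_def
  proof (rule nn_integral_cong_AE)
    show "AE \<omega> in M. f (X t \<omega>) * ennreal (1 - survival t \<omega>) = (\<integral>\<^sup>+s. W s \<omega> * f (X t \<omega>) * indicator {0..t} s \<partial>lborel)"
      using one_minus_survival[OF t] AE_space
    proof eventually_elim
      case (elim \<omega>)
      have [measurable]: "(\<lambda>s. W s \<omega>) \<in> borel_measurable borel" using elim(2) by measurable
      show ?case
        unfolding elim(1) W_def[symmetric] by (subst nn_integral_cmult[symmetric]) (auto simp: mult_ac)
    qed
  qed
  also have "\<dots> = (\<integral>\<^sup>+s. \<integral>\<^sup>+\<omega>. W s \<omega> * f (X t \<omega>) * indicator {0..t} s \<partial>M \<partial>lborel)"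
    by (rule Fubini') measurable
  also have "\<dots> = (\<integral>\<^sup>+s\<in>{0..t}. (\<integral>\<^sup>+\<omega>. W s \<omega> * f (X t \<omega>) \<partial>M) \<partial>lborel)"
    by (intro nn_integral_cong nn_integral_multc) measurable
  also have "\<dots> = (\<integral>\<^sup>+s\<in>{0..t}. surviving s (\<lambda>y. ennreal (V y) * P (t - s) f y) \<partial>lborel)"
    unfolding W_def surviving_def by (intro nn_integral_Icc_cong_Ioo) (simp add: markov_survival, simp add: mult_ac)
  finally show ?thesis .
qed

theorem surviving_dynkin:
  assumes t: "t > 0" and [measurable]: "h \<in> borel_measurable borel" "k \<in> borel_measurable borel"
    and dynkin: "\<And>s x. s > 0 \<Longrightarrow> P s h x = h x + (\<integral>\<^sup>+r\<in>{0..s}. P r k x \<partial>lborel)"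
    and fin: "(\<integral>\<^sup>+r\<in>{0..t}. P r k x0 \<partial>lborel) < \<infinity>"
  shows "surviving t h + (\<integral>\<^sup>+s\<in>{0..t}. surviving s (\<lambda>y. ennreal (V y) * h y) \<partial>lborel)
    = h x0 + (\<integral>\<^sup>+s\<in>{0..t}. surviving s k \<partial>lborel)"
proof -
  define C where "C = (\<integral>\<^sup>+s\<in>{0..t}. surviving s k \<partial>lborel)"
  define K where "K = (\<integral>\<^sup>+s\<in>{0..t}. killed s k \<partial>lborel)"
  have split: "(\<integral>\<^sup>+r\<in>{0..t}. P r k x0 \<partial>lborel) = C + K"
    unfolding C_def K_def
    by (subst nn_integral_add[symmetric]) (simp_all add: surviving_add_killed flip: distrib_right)
  have "killed t h = (\<integral>\<^sup>+s\<in>{0..t}. surviving s (\<lambda>y. ennreal (V y) * P (t - s) h y) \<partial>lborel)"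
    by (rule killed_duhamel[OF t]) measurable
  also have "\<dots> = (\<integral>\<^sup>+s\<in>{0..t}. surviving s (\<lambda>y. ennreal (V y) * h y) +
      (\<integral>\<^sup>+r\<in>{0..t - s}. surviving s (\<lambda>y. ennreal (V y) * P r k y) \<partial>lborel) \<partial>lborel)"
  proof (rule nn_integral_Icc_cong_Ioo)
    fix s assume "0 < s" "s < t"
    then have "surviving s (\<lambda>y. ennreal (V y) * P (t - s) h y) =
        surviving s (\<lambda>y. ennreal (V y) * h y + (\<integral>\<^sup>+r. (ennreal (V y) * P r k y) * indicator {0..t - s} r \<partial>lborel))"
      by (simp add: dynkin distrib_left nn_integral_cmult mult.assoc)
    also have "\<dots> = surviving s (\<lambda>y. ennreal (V y) * h y) +
        (\<integral>\<^sup>+r. surviving s (\<lambda>y. (ennreal (V y) * P r k y) * indicator {0..t - s} r) \<partial>lborel)"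
      by (subst surviving_add) (simp_all add: surviving_nn_integral)
    finally show "surviving s (\<lambda>y. ennreal (V y) * P (t - s) h y) = surviving s (\<lambda>y. ennreal (V y) * h y) +
        (\<integral>\<^sup>+r\<in>{0..t - s}. surviving s (\<lambda>y. ennreal (V y) * P r k y) \<partial>lborel)"
      by (simp add: mult.commute[of _ "indicator _ _"] surviving_cmult)
  qed
  also have "\<dots> = (\<integral>\<^sup>+s\<in>{0..t}. surviving s (\<lambda>y. ennreal (V y) * h y) \<partial>lborel) +
      (\<integral>\<^sup>+s\<in>{0..t}. (\<integral>\<^sup>+r\<in>{0..t - s}. surviving s (\<lambda>y. ennreal (V y) * P r k y) \<partial>lborel) \<partial>lborel)"
    by (subst nn_integral_add[symmetric])
      (auto simp: distrib_right surviving_def intro!: borel_measurable_times_ennreal borel_measurable_nn_integral_Icc)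
  also have "(\<integral>\<^sup>+s\<in>{0..t}. (\<integral>\<^sup>+r\<in>{0..t - s}. surviving s (\<lambda>y. ennreal (V y) * P r k y) \<partial>lborel) \<partial>lborel) = K"
    unfolding K_def
    by (subst nn_integral_triangle) (auto simp: killed_duhamel surviving_def intro!: nn_integral_Icc_cong_Ioo)
  finally have killed_h: "killed t h = (\<integral>\<^sup>+s\<in>{0..t}. surviving s (\<lambda>y. ennreal (V y) * h y) \<partial>lborel) + K" .
  have "surviving t h + killed t h = h x0 + (C + K)"
    using t by (simp add: surviving_add_killed dynkin split)
  then have "K + (surviving t h + (\<integral>\<^sup>+s\<in>{0..t}. surviving s (\<lambda>y. ennreal (V y) * h y) \<partial>lborel)) = K + (h x0 + C)"
    by (simp add: killed_h ac_simps)
  moreover have "K \<noteq> \<infinity>"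
    using fin by (auto simp: split)
  ultimately show ?thesis
    by (simp add: ennreal_add_left_cancel C_def)
qed

end

section \<open>The constants \<open>\<kappa>\<^sub>\<beta>\<close>\<close>

lemma kappa_eq_riesz_const:
  assumes "0 < \<beta>" "\<beta> < \<alpha>" "\<alpha> < 2" "\<alpha> < real d"
  shows "- kappa d \<alpha> \<beta> = riesz_const d ((d + \<beta>) / 2) * Gamma ((\<alpha> - \<beta>) / 2) /
    (- Gamma_neg_half \<beta> * riesz_const d ((d + \<beta> - \<alpha>) / 2))"
proof -
  have "4 powr ((d + \<beta>) / 2) = 4 powr (\<alpha> / 2 + (d + \<beta> - \<alpha>) / 2)"
    by (simp flip: add_divide_distrib)
  also have "\<dots> = (2 powr 2) powr (\<alpha> / 2) * 4 powr ((d + \<beta> - \<alpha>) / 2)"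
    unfolding powr_add by simp
  also have "(2 powr 2) powr (\<alpha> / 2) = (2::real) powr \<alpha>"
    unfolding powr_powr by simp
  finally have powr_4: "4 powr ((d + \<beta>) / 2) = 2 powr \<alpha> * 4 powr ((d + \<beta> - \<alpha>) / 2)" .
  have "Gamma ((d + \<beta> - \<alpha>) / 2) \<noteq> 0" "Gamma_neg_half \<beta> \<noteq> 0"
    using assms Gamma_neg_half_neg[of \<beta>] by (simp_all add: Gamma_real_pos less_imp_neq[symmetric])
  then show ?thesis
    unfolding kappa_def riesz_const_def powr_4 by (simp add: field_simps)
qed

definition kappa_slope :: "nat \<Rightarrow> real \<Rightarrow> real \<Rightarrow> real" where
  "kappa_slope d \<alpha> \<beta> = 2 powr \<alpha> * Gamma ((\<alpha> - \<beta>) / 2) * Gamma ((real d + \<beta>) / 2)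
    / (2 * Gamma (1 - \<beta> / 2) * Gamma ((real d + \<beta> - \<alpha>) / 2))"

lemma kappa_eq_slope: "0 < \<beta> \<Longrightarrow> \<beta> < 2 \<Longrightarrow> kappa d \<alpha> \<beta> = - \<beta> * kappa_slope d \<alpha> \<beta>"
  by (simp add: kappa_def kappa_slope_def Gamma_neg_half_eq)

lemma kappa_slope_pos:
  assumes "0 \<le> \<beta>" "\<beta> < \<alpha>" "\<alpha> < 2" "\<alpha> < real d"
  shows "kappa_slope d \<alpha> \<beta> > 0"
  unfolding kappa_slope_def using assms by (intro divide_pos_pos mult_pos_pos Gamma_real_pos) auto

lemma kappa_neg: "0 < \<beta> \<Longrightarrow> \<beta> < \<alpha> \<Longrightarrow> \<alpha> < 2 \<Longrightarrow> \<alpha> < real d \<Longrightarrow> kappa d \<alpha> \<beta> < 0"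
  by (simp add: kappa_eq_slope kappa_slope_pos)

lemma isCont_kappa_slope_0:
  assumes "0 < \<alpha>" "\<alpha> < real d"
  shows "isCont (kappa_slope d \<alpha>) 0"
proof -
  have "z \<notin> \<int>\<^sub>\<le>\<^sub>0" if "z > 0" for z :: real
    using that by (auto elim!: nonpos_Ints_cases)
  moreover have "Gamma ((real d - \<alpha>) / 2) \<noteq> 0"
    using assms by (simp add: Gamma_real_pos less_imp_neq[symmetric])
  ultimately show ?thesis
    unfolding kappa_slope_def[abs_def] using assms by (intro continuous_intros) auto
qed

section \<open>Power moments of the stable process\<close>

abbreviation (input) npowr :: "real \<Rightarrow> 'a::real_normed_vector \<Rightarrow> ennreal" where
  "npowr e \<equiv> (\<lambda>y. ennreal (norm y powr e))"

locale stable_path = prob_space M for M :: "'b measure" +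
  fixes \<alpha> :: real and X :: "real \<Rightarrow> 'b \<Rightarrow> 'a::euclidean_space" and x0 :: 'a
  assumes \<alpha>: "0 < \<alpha>" "\<alpha> < 2" "\<alpha> < real DIM('a)"
    and process: "stable_process \<alpha> M X x0"
    and start: "X 0 \<omega> = x0"
begin

lemma increment_distributed:
  "0 \<le> s \<Longrightarrow> s < t \<Longrightarrow> distributed M lborel (\<lambda>\<omega>. X t \<omega> - X s \<omega>) (\<lambda>z. ennreal (stable_kernel \<alpha> (t - s) z))"
  using process by (simp add: stable_process_def)

sublocale stationary_independent_increments M X x0
proof
  fix s t :: real assume st: "0 \<le> s" "s < t"
  have distr: "distr M borel Y = density lborel f" if "distributed M lborel Y f" for Y :: "'b \<Rightarrow> 'a" and f
    using distributed_distr_eq_density[OF that] by (simp cong: distr_cong)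
  show "distr M borel (\<lambda>\<omega>. X t \<omega> - X s \<omega>) = distr M borel (\<lambda>\<omega>. X (t - s) \<omega> - x0)"
    using distr[OF increment_distributed[OF st]] distr[OF increment_distributed[of 0 "t - s"]] st
    by (simp add: start)
qed (use process in \<open>simp_all add: stable_process_def start\<close>)

lemma P_eq_stable_kernel:
  assumes "t > 0" and [measurable]: "f \<in> borel_measurable borel"
  shows "P t f x = (\<integral>\<^sup>+z. f (x + z) * ennreal (stable_kernel \<alpha> t z) \<partial>lborel)"
  using distributed_nn_integral[OF increment_distributed[of 0 t], of "\<lambda>z. f (x + z)"] assms
  by (simp add: P_def start mult.commute)

lemma P_cong_nonzero:
  assumes "t > 0" and eq: "\<And>y. y \<noteq> 0 \<Longrightarrow> f y = g y"
  shows "P t f x = P t g x"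
  unfolding P_def
proof (rule nn_integral_cong_AE)
  have "AE z in lborel. z \<noteq> - x" by (rule AE_lborel_singleton)
  then have "AE \<omega> in M. X t \<omega> - X 0 \<omega> \<noteq> - x"
    using assms(1) by (subst distributed_AE2[OF increment_distributed]) auto
  then show "AE \<omega> in M. f (x + (X t \<omega> - x0)) = g (x + (X t \<omega> - x0))"
    by eventually_elim (auto intro!: eq simp: start add_eq_0_iff)
qed

lemma P_mixture:
  fixes m :: "real \<Rightarrow> ennreal" and \<phi> :: "real \<Rightarrow> 'a \<Rightarrow> ennreal"
  assumes "t > 0" and [measurable]: "m \<in> borel_measurable borel" "f \<in> borel_measurable borel"
    "(\<lambda>(r, y). \<phi> r y) \<in> borel_measurable (borel \<Otimes>\<^sub>M borel)"
    and mixture: "\<And>y. y \<noteq> 0 \<Longrightarrow> (\<integral>\<^sup>+r\<in>{0<..}. m r * \<phi> r y \<partial>lborel) = c * f y"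
  shows "c * P t f x = (\<integral>\<^sup>+r\<in>{0<..}. m r * P t (\<phi> r) x \<partial>lborel)"
proof -
  have "c * P t f x = P t (\<lambda>y. c * f y) x"
    by (rule P_cmult[symmetric]) measurable
  also have "\<dots> = P t (\<lambda>y. \<integral>\<^sup>+r. (m r * indicator {0<..} r) * \<phi> r y \<partial>lborel) x"
    using assms(1) by (rule P_cong_nonzero) (simp add: mixture[symmetric] mult_ac)
  also have "\<dots> = (\<integral>\<^sup>+r. P t (\<lambda>y. (m r * indicator {0<..} r) * \<phi> r y) x \<partial>lborel)"
    by (rule P_nn_integral) measurable
  also have "\<dots> = (\<integral>\<^sup>+r. (m r * indicator {0<..} r) * P t (\<phi> r) x \<partial>lborel)"
    by (intro nn_integral_cong P_cmult) measurable
  also have "\<dots> = (\<integral>\<^sup>+r\<in>{0<..}. m r * P t (\<phi> r) x \<partial>lborel)"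
    by (simp only: mult_ac)
  finally show ?thesis .
qed

lemma
  assumes t: "t > 0" and u: "u > 0"
  shows P_gauss: "P t (\<lambda>y. ennreal (exp (- u * (norm y)\<^sup>2))) x = ennreal (stable_gauss \<alpha> t u x)"
    and stable_gauss_nonneg: "0 \<le> stable_gauss \<alpha> t u x"
proof -
  have mass: "(\<integral>\<^sup>+z. ennreal (stable_kernel \<alpha> t (z::'a)) \<partial>lborel) = 1"
    using P_eq_stable_kernel[OF t, of "\<lambda>_. 1"] by (simp add: P_const)
  have nonneg: "AE z in lborel. 0 \<le> stable_kernel \<alpha> t (z::'a)"
    by (rule stable_kernel_nonneg_AE[OF \<alpha>(1) t mass])
  then have gauss_nonneg: "AE z in lborel. 0 \<le> stable_kernel \<alpha> t z * exp (- u * (norm (x + z))\<^sup>2)"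
    by eventually_elim simp
  show "0 \<le> stable_gauss \<alpha> t u x"
    using integral_nonneg_AE[OF gauss_nonneg] unfolding stable_kernel_gauss_integral[OF \<alpha>(1) t u] .
  have "P t (\<lambda>y. ennreal (exp (- u * (norm y)\<^sup>2))) x =
      (\<integral>\<^sup>+z. ennreal (stable_kernel \<alpha> t z * exp (- u * (norm (x + z))\<^sup>2)) \<partial>lborel)"
    by (subst P_eq_stable_kernel[OF t], simp, rule nn_integral_cong_AE)
      (use nonneg in eventually_elim, simp add: ennreal_mult mult.commute)
  also have "\<dots> = ennreal (stable_gauss \<alpha> t u x)"
    unfolding stable_kernel_gauss_integral[OF \<alpha>(1) t u, symmetric]
    by (rule nn_integral_eq_integral[OF stable_kernel_gauss_integrable[OF \<alpha>(1) t u] gauss_nonneg])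
  finally show "P t (\<lambda>y. ennreal (exp (- u * (norm y)\<^sup>2))) x = ennreal (stable_gauss \<alpha> t u x)" .
qed

lemma P_one_minus_gauss:
  assumes t: "t > 0" and u: "u > 0"
  shows "P t (\<lambda>y. ennreal (1 - exp (- u * (norm y)\<^sup>2))) x = ennreal (1 - stable_gauss \<alpha> t u x)"
proof -
  let ?g = "\<lambda>y. exp (- u * (norm (y::'a))\<^sup>2)"
  have "P t (\<lambda>y. ennreal (?g y)) x + P t (\<lambda>y. ennreal (1 - ?g y)) x = P t (\<lambda>y. ennreal (?g y) + ennreal (1 - ?g y)) x"
    by (rule P_add[symmetric]) measurable
  also have "(\<lambda>y. ennreal (?g y) + ennreal (1 - ?g y)) = (\<lambda>y. 1)"
    using u by (simp add: fun_eq_iff flip: ennreal_plus)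
  also have "P t (\<lambda>y. 1) x = ennreal (stable_gauss \<alpha> t u x) + ennreal (1 - stable_gauss \<alpha> t u x)"
    using t u stable_gauss_le_1[of t u \<alpha> x] stable_gauss_nonneg[OF t u, of x]
    by (simp add: P_const flip: ennreal_plus)
  finally show ?thesis
    unfolding P_gauss[OF t u] by (simp add: ennreal_add_left_cancel)
qed

lemma P_npowr_neg_gauss_mixture:
  assumes t: "t > 0" and \<gamma>: "\<gamma> > 0"
  shows "ennreal (Gamma (\<gamma> / 2)) * P t (npowr (- \<gamma>)) x =
    (\<integral>\<^sup>+u\<in>{0<..}. ennreal (u powr (\<gamma> / 2 - 1)) * ennreal (stable_gauss \<alpha> t u x) \<partial>lborel)"
proof -
  have "ennreal (Gamma (\<gamma> / 2)) * P t (npowr (- \<gamma>)) x =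
      (\<integral>\<^sup>+u\<in>{0<..}. ennreal (u powr (\<gamma> / 2 - 1)) * P t (\<lambda>y. ennreal (exp (- u * (norm y)\<^sup>2))) x \<partial>lborel)"
  proof (rule P_mixture[OF t])
    fix y :: 'a assume y: "y \<noteq> 0"
    then have "((norm y)\<^sup>2) powr (- (\<gamma> / 2)) = norm y powr (- \<gamma>)"
      by (simp add: powr_powr flip: powr_numeral)
    then show "(\<integral>\<^sup>+u\<in>{0<..}. ennreal (u powr (\<gamma> / 2 - 1)) * ennreal (exp (- u * (norm y)\<^sup>2)) \<partial>lborel) =
        ennreal (Gamma (\<gamma> / 2)) * npowr (- \<gamma>) y"
      using nn_integral_Gamma[of "\<gamma> / 2" "(norm y)\<^sup>2"] \<gamma> y
      by (simp add: mult.commute[of "(norm y)\<^sup>2"] ennreal_mult Gamma_real_nonneg)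
  qed measurable
  also have "\<dots> = (\<integral>\<^sup>+u\<in>{0<..}. ennreal (u powr (\<gamma> / 2 - 1)) * ennreal (stable_gauss \<alpha> t u x) \<partial>lborel)"
    by (intro nn_integral_cong) (use P_gauss[OF t] in \<open>auto simp: indicator_def\<close>)
  finally show ?thesis .
qed

lemma P_npowr_pos_gauss_mixture:
  assumes t: "t > 0" and \<beta>: "0 < \<beta>" "\<beta> < 2"
  shows "ennreal (- Gamma_neg_half \<beta>) * P t (npowr \<beta>) x =
    (\<integral>\<^sup>+r\<in>{0<..}. ennreal (r powr (- \<beta> / 2 - 1)) * ennreal (1 - stable_gauss \<alpha> t r x) \<partial>lborel)"
proof -
  have "ennreal (- Gamma_neg_half \<beta>) * P t (npowr \<beta>) x =
      (\<integral>\<^sup>+r\<in>{0<..}. ennreal (r powr (- \<beta> / 2 - 1)) * P t (\<lambda>y. ennreal (1 - exp (- r * (norm y)\<^sup>2))) x \<partial>lborel)"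
  proof (rule P_mixture[OF t])
    fix y :: 'a
    show "(\<integral>\<^sup>+r\<in>{0<..}. ennreal (r powr (- \<beta> / 2 - 1)) * ennreal (1 - exp (- r * (norm y)\<^sup>2)) \<partial>lborel) =
        ennreal (- Gamma_neg_half \<beta>) * npowr \<beta> y"
      using Gamma_neg_half_neg[OF \<beta>] unfolding nn_integral_compensated_Gamma_scaled[OF \<beta> norm_ge_zero]
      by (intro ennreal_mult) auto
  qed measurable
  also have "\<dots> = (\<integral>\<^sup>+r\<in>{0<..}. ennreal (r powr (- \<beta> / 2 - 1)) * ennreal (1 - stable_gauss \<alpha> t r x) \<partial>lborel)"
    by (intro nn_integral_cong) (use P_one_minus_gauss[OF t] in \<open>auto simp: indicator_def\<close>)
  finally show ?thesis .
qed

lemma P_npowr_eq_spectral_integral: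
  fixes \<beta> t :: real
  assumes \<beta>: "0 < \<beta>" "\<beta> < \<alpha>" and t: "t > 0"
  shows "ennreal (- Gamma_neg_half \<beta>) * P t (npowr \<beta>) x =
    ennreal (- Gamma_neg_half \<beta> * norm x powr \<beta> +
      riesz_const DIM('a) ((DIM('a) + \<beta>) / 2) * spectral_integral \<alpha> \<beta> t x)"
proof -
  have \<beta>2: "\<beta> < 2" using \<beta> \<alpha> by simp
  define f where "f r = indicator {0<..} r * r powr (- \<beta> / 2 - 1) * (1 - exp (- r * (norm x)\<^sup>2))" for r :: real
  define g where "g r = indicator {0<..} r * r powr (- \<beta> / 2 - 1) *
      (exp (- r * (norm x)\<^sup>2) - stable_gauss \<alpha> t r x)" for r :: real
  have [measurable]: "f \<in> borel_measurable borel" unfolding f_def by measurable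
  have f: "0 \<le> f r" for r by (auto simp: f_def indicator_def)
  have "(\<integral>\<^sup>+r. ennreal (f r) \<partial>lborel) =
      (\<integral>\<^sup>+r\<in>{0<..}. ennreal (r powr (- \<beta> / 2 - 1)) * ennreal (1 - exp (- r * (norm x)\<^sup>2)) \<partial>lborel)"
    by (intro nn_integral_cong) (auto simp: f_def indicator_def ennreal_mult)
  also have "\<dots> = ennreal (- Gamma_neg_half \<beta> * norm x powr \<beta>)"
    using \<beta> \<beta>2 by (intro nn_integral_compensated_Gamma_scaled) auto
  finally have f_nn: "(\<integral>\<^sup>+r. ennreal (f r) \<partial>lborel) = ennreal (- Gamma_neg_half \<beta> * norm x powr \<beta>)" .
  then have f_int: "integrable lborel f" "(LINT r|lborel. f r) = - Gamma_neg_half \<beta> * norm x powr \<beta>"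
    using f Gamma_neg_half_neg[OF \<beta>(1) \<beta>2]
    by (auto intro!: integrableI_nonneg simp: integral_eq_nn_integral mult_nonpos_nonneg)
  have g_int: "integrable lborel g"
      "(LINT r|lborel. g r) = riesz_const DIM('a) ((DIM('a) + \<beta>) / 2) * spectral_integral \<alpha> \<beta> t x"
    unfolding g_def using \<beta> t by (intro gauss_difference_integrable gauss_difference_integral; simp)+
  have sum: "f r + g r = indicator {0<..} r * r powr (- \<beta> / 2 - 1) * (1 - stable_gauss \<alpha> t r x)" for r
    by (simp add: f_def g_def algebra_simps)
  have sum_nonneg: "0 \<le> f r + g r" for r
    unfolding sum using stable_gauss_le_1[of t r \<alpha> x] t by (auto simp: indicator_def)
  have "ennreal (- Gamma_neg_half \<beta>) * P t (npowr \<beta>) x = (\<integral>\<^sup>+r. ennreal (f r + g r) \<partial>lborel)"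
    unfolding P_npowr_pos_gauss_mixture[OF t \<beta>(1) \<beta>2] sum using stable_gauss_le_1[of t _ \<alpha> x] t
    by (intro nn_integral_cong) (auto simp: indicator_def ennreal_mult)
  also have "\<dots> = ennreal (LINT r|lborel. f r + g r)"
    using f_int(1) g_int(1) sum_nonneg by (intro nn_integral_eq_integral) auto
  finally show ?thesis using f_int g_int by simp
qed

lemma
  fixes \<beta> t :: real
  assumes \<beta>: "0 < \<beta>" "\<beta> < \<alpha>" and t: "t > 0"
  shows P_npowr_potential_eq_spectral_integral:
      "ennreal (Gamma ((\<alpha> - \<beta>) / 2)) * (\<integral>\<^sup>+s\<in>{0..t}. P s (npowr (\<beta> - \<alpha>)) x \<partial>lborel) =
        ennreal (riesz_const DIM('a) ((DIM('a) + \<beta> - \<alpha>) / 2) * spectral_integral \<alpha> \<beta> t x)"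
    and spectral_integral_nonneg: "0 \<le> spectral_integral \<alpha> \<beta> t x"
proof -
  define w where "w = (\<lambda>(s, u). indicator {0..t} s * (indicator {0<..} u * u powr ((\<alpha> - \<beta>) / 2 - 1)) *
      stable_gauss \<alpha> s u x)"
  define c where "c = riesz_const DIM('a) ((DIM('a) + \<beta> - \<alpha>) / 2)"
  have int: "integrable lborel w" and integral: "(LINT \<tau>|lborel. w \<tau>) = c * spectral_integral \<alpha> \<beta> t x"
    unfolding w_def c_def using \<beta> \<alpha> t by (intro gauss_potential_integrable gauss_potential_integral; simp)+
  have "0 \<le> stable_gauss \<alpha> s u x" if "0 \<le> s" "0 < u" for s u
    using that stable_gauss_nonneg[of s u x] by (cases "s = 0") (auto simp: stable_gauss_zero_time)
  then have w: "0 \<le> w \<tau>" for \<tau>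
    by (auto simp: w_def indicator_def split: prod.split)
  have "c > 0"
    unfolding c_def using \<alpha> \<beta> by (intro riesz_const_pos) simp
  moreover have "0 \<le> (LINT \<tau>|lborel. w \<tau>)"
    by (simp add: w integral_nonneg_AE)
  ultimately show "0 \<le> spectral_integral \<alpha> \<beta> t x"
    by (simp add: integral zero_le_mult_iff)
  have [measurable]: "w \<in> borel_measurable (lborel \<Otimes>\<^sub>M lborel)"
    using int by (simp add: lborel_prod)
  have "ennreal (Gamma ((\<alpha> - \<beta>) / 2)) * (\<integral>\<^sup>+s\<in>{0..t}. P s (npowr (\<beta> - \<alpha>)) x \<partial>lborel) =
      (\<integral>\<^sup>+s\<in>{0..t}. ennreal (Gamma ((\<alpha> - \<beta>) / 2)) * P s (npowr (- (\<alpha> - \<beta>))) x \<partial>lborel)"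
    by (subst nn_integral_cmult[symmetric]) (auto simp: mult.assoc)
  also have "\<dots> = (\<integral>\<^sup>+s\<in>{0..t}. (\<integral>\<^sup>+u. ennreal (w (s, u)) \<partial>lborel) \<partial>lborel)"
  proof (rule nn_integral_Icc_cong_Ioo)
    fix s assume "0 < s" "s < t"
    then show "ennreal (Gamma ((\<alpha> - \<beta>) / 2)) * P s (npowr (- (\<alpha> - \<beta>))) x = (\<integral>\<^sup>+u. ennreal (w (s, u)) \<partial>lborel)"
      using \<beta> stable_gauss_nonneg[of s _ x]
      by (subst P_npowr_neg_gauss_mixture) (auto simp: w_def indicator_def ennreal_mult intro!: nn_integral_cong)
  qed
  also have "\<dots> = (\<integral>\<^sup>+s. \<integral>\<^sup>+u. ennreal (w (s, u)) \<partial>lborel \<partial>lborel)"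
    by (intro nn_integral_cong) (simp add: w_def indicator_def)
  also have "\<dots> = (\<integral>\<^sup>+\<tau>. ennreal (w \<tau>) \<partial>lborel)"
    unfolding lborel_prod[symmetric] by (rule lborel.nn_integral_fst) measurable
  also have "\<dots> = ennreal (c * spectral_integral \<alpha> \<beta> t x)"
    using int w by (simp add: nn_integral_eq_integral integral)
  finally show "ennreal (Gamma ((\<alpha> - \<beta>) / 2)) * (\<integral>\<^sup>+s\<in>{0..t}. P s (npowr (\<beta> - \<alpha>)) x \<partial>lborel) =
      ennreal (riesz_const DIM('a) ((DIM('a) + \<beta> - \<alpha>) / 2) * spectral_integral \<alpha> \<beta> t x)"
    by (simp add: c_def)
qed

end

lemma ennreal_mult_left_eqD:
  assumes "ennreal c * X = ennreal y" "c > 0" "y \<ge> 0"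
  shows "X = ennreal (y / c)"
proof -
  have "X = ennreal (1 / c) * (ennreal c * X)"
    using assms(2) by (simp add: mult.assoc[symmetric] flip: ennreal_mult)
  also have "\<dots> = ennreal (y / c)" using assms by (simp flip: ennreal_mult)
  finally show ?thesis .
qed

lemma powr_mult_le_affine:
  fixes r b \<theta> :: real
  assumes "0 \<le> r" "0 \<le> \<theta>" "\<theta> \<le> 1"
  shows "r powr (\<theta> * b) \<le> 1 + \<theta> * r powr b"
proof (cases "r = 0")
  case False
  have "r powr (\<theta> * b) = (r powr b) powr \<theta> * 1 powr (1 - \<theta>)"
    by (simp add: powr_powr mult.commute)
  also have "\<dots> \<le> \<theta> * r powr b + (1 - \<theta>) * 1"
    using assms False by (intro Youngs_inequality_0) auto
  finally show ?thesis using assms by simp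
qed (use assms in simp)

context stable_path
begin

theorem
  fixes \<beta> t :: real
  assumes \<beta>: "0 < \<beta>" "\<beta> < \<alpha>" and t: "t > 0"
  shows P_npowr_dynkin: "P t (npowr \<beta>) x =
      npowr \<beta> x + ennreal (- kappa DIM('a) \<alpha> \<beta>) * (\<integral>\<^sup>+s\<in>{0..t}. P s (npowr (\<beta> - \<alpha>)) x \<partial>lborel)"
    and P_npowr_finite: "P t (npowr \<beta>) x < \<infinity>"
    and P_npowr_potential_finite: "(\<integral>\<^sup>+s\<in>{0..t}. P s (npowr (\<beta> - \<alpha>)) x \<partial>lborel) < \<infinity>"
proof -
  define G where "G = - Gamma_neg_half \<beta>"
  define g where "g = Gamma ((\<alpha> - \<beta>) / 2)"
  define c_moment where "c_moment = riesz_const DIM('a) ((DIM('a) + \<beta>) / 2)"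
  define c_potential where "c_potential = riesz_const DIM('a) ((DIM('a) + \<beta> - \<alpha>) / 2)"
  define J where "J = spectral_integral \<alpha> \<beta> t x"
  have pos: "G > 0" "g > 0" "c_moment > 0" "c_potential > 0"
    using Gamma_neg_half_neg[of \<beta>] \<beta> \<alpha> unfolding G_def g_def c_moment_def c_potential_def
    by (auto intro!: Gamma_real_pos riesz_const_pos)
  have J: "J \<ge> 0" unfolding J_def by (rule spectral_integral_nonneg[OF assms])
  have moment: "P t (npowr \<beta>) x = ennreal ((G * norm x powr \<beta> + c_moment * J) / G)"
    using P_npowr_eq_spectral_integral[OF assms, of x]
    unfolding G_def[symmetric] c_moment_def[symmetric] J_def[symmetric]
    by (rule ennreal_mult_left_eqD) (use pos J in auto)
  have potential: "(\<integral>\<^sup>+s\<in>{0..t}. P s (npowr (\<beta> - \<alpha>)) x \<partial>lborel) = ennreal (c_potential * J / g)"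
    using P_npowr_potential_eq_spectral_integral[OF assms, of x]
    unfolding g_def[symmetric] c_potential_def[symmetric] J_def[symmetric]
    by (rule ennreal_mult_left_eqD) (use pos J in auto)
  have kappa: "- kappa DIM('a) \<alpha> \<beta> = c_moment * g / (G * c_potential)"
    unfolding G_def g_def c_moment_def c_potential_def by (rule kappa_eq_riesz_const) (use \<beta> \<alpha> in auto)
  have "(G * norm x powr \<beta> + c_moment * J) / G =
      norm x powr \<beta> + c_moment * g / (G * c_potential) * (c_potential * J / g)"
    using pos by (simp add: field_simps)
  then show "P t (npowr \<beta>) x =
      npowr \<beta> x + ennreal (- kappa DIM('a) \<alpha> \<beta>) * (\<integral>\<^sup>+s\<in>{0..t}. P s (npowr (\<beta> - \<alpha>)) x \<partial>lborel)"
    unfolding moment potential kappa using pos J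
    by (simp only: ennreal_mult[symmetric] ennreal_plus[symmetric]
        divide_nonneg_nonneg mult_nonneg_nonneg less_imp_le powr_ge_zero)
  show "P t (npowr \<beta>) x < \<infinity>" unfolding moment by simp
  show "(\<integral>\<^sup>+s\<in>{0..t}. P s (npowr (\<beta> - \<alpha>)) x \<partial>lborel) < \<infinity>" unfolding potential by simp
qed

text \<open>For \<open>\<beta> \<rightarrow> 0\<close> both \<open>\<kappa>\<^sub>\<beta>\<close> and \<open>P\<^sub>t |.|\<^sup>\<beta> - |x|\<^sup>\<beta>\<close> vanish at a linear rate, which controls the
  potential of \<open>|.|\<^bsup>\<beta>-\<alpha>\<^esup>\<close> up to the critical exponent \<open>-\<alpha>\<close>.\<close>

lemma kappa_slope_mult_potential_le:
  assumes x: "x \<noteq> 0" and t: "t > 0"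
  obtains B where "\<And>\<beta>. 0 < \<beta> \<Longrightarrow> \<beta> \<le> \<alpha> / 2 \<Longrightarrow>
    ennreal (kappa_slope DIM('a) \<alpha> \<beta>) * (\<integral>\<^sup>+s\<in>{0..t}. P s (npowr (\<beta> - \<alpha>)) x \<partial>lborel) \<le> ennreal B"
proof
  define \<beta>' where "\<beta>' = \<alpha> / 2"
  define v where "v = enn2real (P t (npowr \<beta>') x)"
  have \<beta>': "0 < \<beta>'" "\<beta>' < \<alpha>" using \<alpha> by (auto simp: \<beta>'_def)
  have v: "P t (npowr \<beta>') x = ennreal v" "v \<ge> 0"
    using P_npowr_finite[OF \<beta>' t, of x] by (auto simp: v_def)
  fix \<beta> assume "0 < \<beta>" "\<beta> \<le> \<alpha> / 2"
  then have \<beta>: "0 < \<beta>" "\<beta> \<le> \<beta>'" "\<beta> < \<alpha>" "\<beta> < 2" using \<alpha> by (auto simp: \<beta>'_def)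
  define \<theta> where "\<theta> = \<beta> / \<beta>'"
  have \<theta>: "0 \<le> \<theta>" "\<theta> \<le> 1" "\<beta> = \<theta> * \<beta>'" using \<beta> \<beta>' by (auto simp: \<theta>_def)
  define i where "i = enn2real (\<integral>\<^sup>+s\<in>{0..t}. P s (npowr (\<beta> - \<alpha>)) x \<partial>lborel)"
  have i: "(\<integral>\<^sup>+s\<in>{0..t}. P s (npowr (\<beta> - \<alpha>)) x \<partial>lborel) = ennreal i" "i \<ge> 0"
    using P_npowr_potential_finite[OF \<beta>(1,3) t, of x] by (auto simp: i_def)
  define \<sigma> where "\<sigma> = kappa_slope DIM('a) \<alpha> \<beta>"
  have \<sigma>: "\<sigma> > 0" unfolding \<sigma>_def using \<beta> \<alpha> by (intro kappa_slope_pos) auto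
  have interpolation: "norm y powr \<beta> \<le> 1 + \<theta> * norm y powr \<beta>'" for y :: 'a
    unfolding \<theta>(3) using \<theta>(1,2) by (intro powr_mult_le_affine) auto
  have "ennreal (norm x powr \<beta> + \<beta> * \<sigma> * i) = P t (npowr \<beta>) x"
    unfolding P_npowr_dynkin[OF \<beta>(1,3) t] i(1) kappa_eq_slope[OF \<beta>(1,4)] \<sigma>_def[symmetric]
    using \<beta> \<sigma> i(2) by (simp add: ennreal_mult)
  also have "\<dots> \<le> P t (\<lambda>y. 1 + ennreal \<theta> * npowr \<beta>' y) x"
    using \<theta>(1) by (intro P_mono) (auto simp: interpolation
        simp flip: ennreal_mult ennreal_1 ennreal_plus intro!: ennreal_leI)
  also have "\<dots> = ennreal (1 + \<theta> * v)"
    using \<theta>(1) v by (subst P_add) (auto simp: P_const P_cmult ennreal_mult)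
  finally have "norm x powr \<beta> + \<beta> * \<sigma> * i \<le> 1 + \<theta> * v"
    using \<theta>(1) v by (subst (asm) ennreal_le_iff) auto
  moreover have "1 + \<beta> * ln (norm x) \<le> norm x powr \<beta>"
    using x exp_ge_add_one_self[of "\<beta> * ln (norm x)"] by (simp add: powr_def)
  ultimately have "\<beta> * (\<sigma> * i) \<le> \<beta> * (v / \<beta>' - ln (norm x))"
    by (simp add: \<theta>_def algebra_simps)
  then have "\<sigma> * i \<le> v / \<beta>' - ln (norm x)" using \<beta>(1) by simp
  then show "ennreal (kappa_slope DIM('a) \<alpha> \<beta>) * (\<integral>\<^sup>+s\<in>{0..t}. P s (npowr (\<beta> - \<alpha>)) x \<partial>lborel)
      \<le> ennreal (v / \<beta>' - ln (norm x))"
    unfolding i(1) \<sigma>_def[symmetric] using \<sigma> i(2) by (simp add: ennreal_leI flip: ennreal_mult)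
qed

lemma potential_npowr_liminf_le:
  assumes "b \<longlonglongrightarrow> 0"
  shows "(\<integral>\<^sup>+s\<in>{0..t}. P s (npowr (- \<alpha>)) x \<partial>lborel) \<le> liminf (\<lambda>n. \<integral>\<^sup>+s\<in>{0..t}. P s (npowr (b n - \<alpha>)) x \<partial>lborel)"
proof -
  have "npowr (- \<alpha>) y = liminf (\<lambda>n. npowr (b n - \<alpha>) y)" for y :: 'a
  proof (cases "y = 0")
    case False
    then have "(\<lambda>n. norm y powr (b n - \<alpha>)) \<longlonglongrightarrow> norm y powr (0 - \<alpha>)"
      by (intro tendsto_intros assms) auto
    then have "(\<lambda>n. npowr (b n - \<alpha>) y) \<longlonglongrightarrow> npowr (- \<alpha>) y"
      by (intro tendsto_ennrealI) simp
    then show ?thesis by (intro lim_imp_Liminf[symmetric]) auto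
  qed (simp add: Liminf_const)
  then have "P s (npowr (- \<alpha>)) x \<le> liminf (\<lambda>n. P s (npowr (b n - \<alpha>)) x)" for s
    unfolding P_def by (simp add: nn_integral_liminf)
  then have "(\<integral>\<^sup>+s\<in>{0..t}. P s (npowr (- \<alpha>)) x \<partial>lborel) \<le>
      (\<integral>\<^sup>+s. liminf (\<lambda>n. P s (npowr (b n - \<alpha>)) x * indicator {0..t} s) \<partial>lborel)"
    by (intro nn_integral_mono) (auto simp: indicator_def)
  also have "\<dots> \<le> liminf (\<lambda>n. \<integral>\<^sup>+s\<in>{0..t}. P s (npowr (b n - \<alpha>)) x \<partial>lborel)"
    by (rule nn_integral_liminf) measurable
  finally show ?thesis .
qed

theorem critical_potential_finite:
  assumes x: "x \<noteq> 0" and t: "t > 0"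
  shows "(\<integral>\<^sup>+s\<in>{0..t}. P s (npowr (- \<alpha>)) x \<partial>lborel) < \<infinity>"
proof -
  define b where "b n = \<alpha> / 2 / (real n + 1)" for n
  have b: "0 < b n" "b n \<le> \<alpha> / 2" for n using \<alpha> by (auto simp: b_def field_simps)
  have b_lim: "b \<longlonglongrightarrow> 0" unfolding b_def by real_asymp
  define \<sigma> where "\<sigma> n = kappa_slope DIM('a) \<alpha> (b n)" for n
  define c where "c = kappa_slope DIM('a) \<alpha> 0 / 2"
  have c: "c > 0" using kappa_slope_pos[of 0 \<alpha> "DIM('a)"] \<alpha> by (simp add: c_def)
  define I where "I n = (\<integral>\<^sup>+s\<in>{0..t}. P s (npowr (b n - \<alpha>)) x \<partial>lborel)" for n
  obtain B where B: "\<And>n. ennreal (\<sigma> n) * I n \<le> ennreal B"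
    unfolding \<sigma>_def I_def by (rule kappa_slope_mult_potential_le[OF x t]) (use b in blast)
  have "\<sigma> \<longlonglongrightarrow> kappa_slope DIM('a) \<alpha> 0"
    unfolding \<sigma>_def[abs_def] using \<alpha> by (intro isCont_tendsto_compose[OF isCont_kappa_slope_0 b_lim]) auto
  then have "eventually (\<lambda>n. c < \<sigma> n) sequentially"
    by (rule order_tendstoD) (use c in \<open>simp add: c_def\<close>)
  then have "eventually (\<lambda>n. I n \<le> ennreal (B / c)) sequentially"
  proof eventually_elim
    case (elim n)
    have "ennreal c * I n \<le> ennreal (\<sigma> n) * I n"
      using elim by (intro mult_right_mono ennreal_leI) auto
    also note B[of n]
    finally have "ennreal (1 / c) * (ennreal c * I n) \<le> ennreal (1 / c) * ennreal B"
      by (rule mult_left_mono) simp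
    then show ?case
      using c by (simp add: mult.assoc[symmetric] ennreal_mult'[symmetric])
  qed
  then have "liminf I \<le> ennreal (B / c)"
    using Liminf_le_Limsup[of sequentially I] by (auto intro: order_trans Limsup_bounded)
  then have "(\<integral>\<^sup>+s\<in>{0..t}. P s (npowr (- \<alpha>)) x \<partial>lborel) \<le> ennreal (B / c)"
    using potential_npowr_liminf_le[OF b_lim, of x t] by (auto simp: I_def[abs_def] intro: order_trans)
  then show ?thesis by (rule le_less_trans) simp
qed

end

section \<open>The Hardy potential\<close>

locale hardy_path = stable_path M \<alpha> X x0
  for M :: "'b measure" and \<alpha> :: real and X :: "real \<Rightarrow> 'b \<Rightarrow> 'a::euclidean_space" and x0 :: 'a +
  fixes \<delta> :: real
  assumes \<delta>: "0 < \<delta>" "\<delta> < \<alpha>" and start_nonzero: "x0 \<noteq> 0"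
begin

lemma minus_hardy_pot_eq: "- hardy_pot \<alpha> \<delta> y = - kappa DIM('a) \<alpha> \<delta> * norm y powr (- \<alpha>)" for y :: 'a
  by (simp add: hardy_pot_def powr_minus_divide)

sublocale killed_process M X x0 "\<lambda>y. - hardy_pot \<alpha> \<delta> y"
proof
  have kappa: "0 \<le> - kappa DIM('a) \<alpha> \<delta>"
    using kappa_neg[of \<delta> \<alpha> "DIM('a)"] \<delta> \<alpha> by simp
  show "(\<lambda>y::'a. - hardy_pot \<alpha> \<delta> y) \<in> borel_measurable borel"
    unfolding minus_hardy_pot_eq by measurable
  show "0 \<le> - hardy_pot \<alpha> \<delta> y" for y :: 'a
    unfolding minus_hardy_pot_eq using kappa by (intro mult_nonneg_nonneg) auto
  fix t :: real assume t: "0 < t"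
  have "(\<integral>\<^sup>+r\<in>{0..t}. P r (\<lambda>y. ennreal (- hardy_pot \<alpha> \<delta> y)) x0 \<partial>lborel) =
      ennreal (- kappa DIM('a) \<alpha> \<delta>) * (\<integral>\<^sup>+r\<in>{0..t}. P r (npowr (- \<alpha>)) x0 \<partial>lborel)"
    unfolding minus_hardy_pot_eq ennreal_mult[OF kappa powr_ge_zero]
    by (simp add: P_cmult mult.assoc nn_integral_cmult)
  then show "(\<integral>\<^sup>+r\<in>{0..t}. P r (\<lambda>y. ennreal (- hardy_pot \<alpha> \<delta> y)) x0 \<partial>lborel) < \<infinity>"
    using critical_potential_finite[OF start_nonzero t] by (simp add: ennreal_mult_less_top)
qed

lemma surviving_le_P: "f \<in> borel_measurable borel \<Longrightarrow> surviving t f \<le> P t f x0"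
  by (simp flip: surviving_add_killed)

lemma surviving_npowr_dynkin:
  fixes \<beta> t :: real
  assumes \<beta>: "0 < \<beta>" "\<beta> < \<alpha>" and t: "t > 0"
  shows "surviving t (npowr \<beta>)
      + ennreal (- kappa DIM('a) \<alpha> \<delta>) * (\<integral>\<^sup>+s\<in>{0..t}. surviving s (npowr (\<beta> - \<alpha>)) \<partial>lborel) =
    npowr \<beta> x0
      + ennreal (- kappa DIM('a) \<alpha> \<beta>) * (\<integral>\<^sup>+s\<in>{0..t}. surviving s (npowr (\<beta> - \<alpha>)) \<partial>lborel)"
proof -
  have "- hardy_pot \<alpha> \<delta> y * norm y powr \<beta> = - kappa DIM('a) \<alpha> \<delta> * norm y powr (\<beta> - \<alpha>)" for y :: 'a
    by (simp add: hardy_pot_def powr_diff)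
  moreover have "0 \<le> - kappa DIM('a) \<alpha> \<delta>"
    using kappa_neg[of \<delta> \<alpha> "DIM('a)"] \<delta> \<alpha> by simp
  ultimately have "ennreal (- hardy_pot \<alpha> \<delta> y) * npowr \<beta> y =
      ennreal (- kappa DIM('a) \<alpha> \<delta>) * npowr (\<beta> - \<alpha>) y" for y :: 'a
    using V_nonneg[of y] by (simp only: ennreal_mult[symmetric] powr_ge_zero)
  moreover have "surviving t (npowr \<beta>) +
      (\<integral>\<^sup>+s\<in>{0..t}. surviving s (\<lambda>y. ennreal (- hardy_pot \<alpha> \<delta> y) * npowr \<beta> y) \<partial>lborel) =
      npowr \<beta> x0 + (\<integral>\<^sup>+s\<in>{0..t}. surviving s (\<lambda>y. ennreal (- kappa DIM('a) \<alpha> \<beta>) * npowr (\<beta> - \<alpha>) y) \<partial>lborel)"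
    using P_npowr_potential_finite[OF assms, of x0]
    by (intro surviving_dynkin[OF t])
      (simp_all add: P_npowr_dynkin[OF \<beta>] P_cmult mult.assoc nn_integral_cmult ennreal_mult_less_top)
  ultimately show ?thesis by (simp add: surviving_cmult mult.assoc nn_integral_cmult)
qed

theorem
  fixes \<beta> t :: real
  assumes \<beta>: "0 < \<beta>" "\<beta> < \<alpha>" and t: "t > 0"
  shows surviving_npowr_finite: "surviving t (npowr \<beta>) < \<infinity>"
    and surviving_npowr_potential_finite: "(\<integral>\<^sup>+s\<in>{0..t}. surviving s (npowr (\<beta> - \<alpha>)) \<partial>lborel) < \<infinity>"
    and enn2real_surviving_npowr: "enn2real (surviving t (npowr \<beta>)) = norm x0 powr \<beta> +
      (kappa DIM('a) \<alpha> \<delta> - kappa DIM('a) \<alpha> \<beta>) * enn2real (\<integral>\<^sup>+s\<in>{0..t}. surviving s (npowr (\<beta> - \<alpha>)) \<partial>lborel)"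
proof -
  have "surviving t (npowr \<beta>) \<le> P t (npowr \<beta>) x0"
    by (rule surviving_le_P) measurable
  then show moment: "surviving t (npowr \<beta>) < \<infinity>"
    using P_npowr_finite[OF assms] by (rule le_less_trans)
  have "(\<integral>\<^sup>+s\<in>{0..t}. surviving s (npowr (\<beta> - \<alpha>)) \<partial>lborel) \<le> (\<integral>\<^sup>+s\<in>{0..t}. P s (npowr (\<beta> - \<alpha>)) x0 \<partial>lborel)"
    by (intro nn_integral_mono mult_right_mono surviving_le_P) auto
  then show potential: "(\<integral>\<^sup>+s\<in>{0..t}. surviving s (npowr (\<beta> - \<alpha>)) \<partial>lborel) < \<infinity>"
    using P_npowr_potential_finite[OF assms] by (rule le_less_trans)
  define m where "m = enn2real (surviving t (npowr \<beta>))"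
  define i where "i = enn2real (\<integral>\<^sup>+s\<in>{0..t}. surviving s (npowr (\<beta> - \<alpha>)) \<partial>lborel)"
  have m: "surviving t (npowr \<beta>) = ennreal m" "0 \<le> m"
    and i: "(\<integral>\<^sup>+s\<in>{0..t}. surviving s (npowr (\<beta> - \<alpha>)) \<partial>lborel) = ennreal i" "0 \<le> i"
    using moment potential by (simp_all add: m_def i_def)
  have "0 \<le> - kappa DIM('a) \<alpha> \<delta>" "0 \<le> - kappa DIM('a) \<alpha> \<beta>"
    using kappa_neg[of \<delta> \<alpha> "DIM('a)"] kappa_neg[of \<beta> \<alpha> "DIM('a)"] \<beta> \<delta> \<alpha> by simp_all
  then have "m + (- kappa DIM('a) \<alpha> \<delta>) * i = norm x0 powr \<beta> + (- kappa DIM('a) \<alpha> \<beta>) * i"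
    using surviving_npowr_dynkin[OF assms] m(2) i(2) unfolding m(1) i(1)
    by (simp only: ennreal_mult[symmetric] ennreal_plus[symmetric] ennreal_inj
        mult_nonneg_nonneg add_nonneg_nonneg powr_ge_zero)
  then show "enn2real (surviving t (npowr \<beta>)) = norm x0 powr \<beta> +
      (kappa DIM('a) \<alpha> \<delta> - kappa DIM('a) \<alpha> \<beta>) * enn2real (\<integral>\<^sup>+s\<in>{0..t}. surviving s (npowr (\<beta> - \<alpha>)) \<partial>lborel)"
    unfolding m_def[symmetric] i_def[symmetric] by (simp add: algebra_simps)
qed

end

lemma stable_process_recentre:
  assumes "stable_process \<alpha> M X x"
  shows "stable_process \<alpha> M (\<lambda>s \<omega>. x + (X s \<omega> - X 0 \<omega>)) x"
proof -
  have X: "(\<lambda>(s, \<omega>). X s \<omega>) \<in> borel_measurable (lborel \<Otimes>\<^sub>M M)"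
    using assms by (simp add: stable_process_def)
  have "(\<lambda>w. (0, snd w)) \<in> measurable (lborel \<Otimes>\<^sub>M M) (lborel \<Otimes>\<^sub>M M)"
    by measurable
  from measurable_comp[OF this X] have [measurable]: "(\<lambda>w. X 0 (snd w)) \<in> borel_measurable (lborel \<Otimes>\<^sub>M M)"
    by (simp add: comp_def)
  have [measurable]: "(\<lambda>w. X (fst w) (snd w)) \<in> borel_measurable (lborel \<Otimes>\<^sub>M M)"
    using X by (simp add: case_prod_beta)
  have "(\<lambda>(s, \<omega>). x + (X s \<omega> - X 0 \<omega>)) \<in> borel_measurable (lborel \<Otimes>\<^sub>M M)"
    unfolding case_prod_beta by measurable
  then show ?thesis
    using assms by (simp add: stable_process_def)
qed

lemma fk_kernel_stable_path:
  fixes pt :: "real \<Rightarrow> 'a::euclidean_space \<Rightarrow> 'a \<Rightarrow> real"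
  assumes "0 < \<alpha>" "\<alpha> < min (real DIM('a)) 2" and "is_fk_kernel \<alpha> \<delta> pt TYPE('b)" and "x \<noteq> 0"
  obtains M :: "'b measure" and X where "stable_path M \<alpha> X x"
    and "\<And>t f. t > 0 \<Longrightarrow> f \<in> borel_measurable borel \<Longrightarrow> (\<integral>\<^sup>+y. f y * ennreal (pt t x y) \<partial>lborel) =
      (\<integral>\<^sup>+\<omega>. f (X t \<omega>) * ennreal (fk_weight (hardy_pot \<alpha> \<delta>) X t \<omega>) \<partial>M)"
proof -
  obtain M :: "'b measure" and X where process: "stable_process \<alpha> M X x"
    and fk: "\<forall>t>0. \<forall>f. f \<in> borel_measurable borel \<longrightarrow> (\<integral>\<^sup>+y. f y * ennreal (pt t x y) \<partial>lborel) =
      (\<integral>\<^sup>+\<omega>. f (X t \<omega>) * ennreal (fk_weight (hardy_pot \<alpha> \<delta>) X t \<omega>) \<partial>M)"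
    using assms(3)[unfolded is_fk_kernel_def] assms(4) by (elim conjE allE[of _ x] impE exE)
  define Y where "Y s \<omega> = x + (X s \<omega> - X 0 \<omega>)" for s \<omega>
  have "AE \<omega> in M. \<forall>s. Y s \<omega> = X s \<omega>"
    using process by (auto simp: Y_def stable_process_def elim!: eventually_mono)
  then have "(\<integral>\<^sup>+\<omega>. f (X t \<omega>) * ennreal (fk_weight (hardy_pot \<alpha> \<delta>) X t \<omega>) \<partial>M) =
      (\<integral>\<^sup>+\<omega>. f (Y t \<omega>) * ennreal (fk_weight (hardy_pot \<alpha> \<delta>) Y t \<omega>) \<partial>M)" for t f
    by (intro nn_integral_cong_AE) (auto simp: fk_weight_def elim!: eventually_mono)
  moreover have "prob_space M"
    using process by (simp add: stable_process_def)
  then have "stable_path M \<alpha> Y x"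
    using stable_process_recentre[OF process] assms(1,2)
    by (simp add: stable_path_def stable_path_axioms_def Y_def[abs_def])
  ultimately show ?thesis using that[of M Y] fk by simp
qed

lemma
  fixes pt :: "real \<Rightarrow> 'a::euclidean_space \<Rightarrow> 'a \<Rightarrow> real" and x :: 'a
  assumes \<alpha>: "0 < \<alpha>" "\<alpha> < min (real DIM('a)) 2" and \<delta>: "0 < \<delta>" "\<delta> < \<alpha>"
    and fk: "is_fk_kernel \<alpha> \<delta> pt TYPE('b)" and \<beta>: "0 < \<beta>" "\<beta> < \<alpha>" and t: "t > 0"
  defines "m \<equiv> \<integral>\<^sup>+y. ennreal (pt t x y * norm y powr \<beta>) \<partial>lborel"
    and "i \<equiv> \<integral>\<^sup>+s\<in>{0..t}. (\<integral>\<^sup>+y. ennreal (pt s x y * norm y powr (\<beta> - \<alpha>)) \<partial>lborel) \<partial>lborel"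
  shows fk_kernel_moment_finite: "m < \<infinity>"
    and fk_kernel_potential_finite: "i < \<infinity>"
    and fk_kernel_moment_identity: "enn2real m =
      norm x powr \<beta> + (kappa DIM('a) \<alpha> \<delta> - kappa DIM('a) \<alpha> \<beta>) * enn2real i"
proof -
  have "m < \<infinity> \<and> i < \<infinity> \<and> enn2real m = norm x powr \<beta> + (kappa DIM('a) \<alpha> \<delta> - kappa DIM('a) \<alpha> \<beta>) * enn2real i"
  proof (cases "x = 0")
    case True
    then have zero: "pt s x y = 0" if "s > 0" for s y
      using fk that by (simp add: is_fk_kernel_def)
    have "m = 0"
      unfolding m_def by (simp add: zero[OF t])
    moreover have "i = (\<integral>\<^sup>+s\<in>{0..t}. 0 \<partial>lborel)"
      unfolding i_def by (rule nn_integral_Icc_cong_Ioo) (simp add: zero)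
    ultimately show ?thesis using True by simp
  next
    case False
    obtain M :: "'b measure" and X where "stable_path M \<alpha> X x"
      and kernel: "\<And>t f. t > 0 \<Longrightarrow> f \<in> borel_measurable borel \<Longrightarrow> (\<integral>\<^sup>+y. f y * ennreal (pt t x y) \<partial>lborel) =
        (\<integral>\<^sup>+\<omega>. f (X t \<omega>) * ennreal (fk_weight (hardy_pot \<alpha> \<delta>) X t \<omega>) \<partial>M)"
      using fk_kernel_stable_path[OF \<alpha> fk False] by blast
    then interpret hardy_path M \<alpha> X x \<delta>
      using \<delta> False by (simp add: hardy_path_def hardy_path_axioms_def)
    have moment: "(\<integral>\<^sup>+y. ennreal (pt s x y * norm y powr \<gamma>) \<partial>lborel) = surviving s (npowr \<gamma>)" if "s > 0" for s \<gamma>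
    proof -
      have "(\<integral>\<^sup>+y. ennreal (pt s x y * norm y powr \<gamma>) \<partial>lborel) = (\<integral>\<^sup>+y. npowr \<gamma> y * ennreal (pt s x y) \<partial>lborel)"
        using fk that by (intro nn_integral_cong) (simp add: is_fk_kernel_def ennreal_mult mult.commute)
      also have "\<dots> = surviving s (npowr \<gamma>)"
        unfolding surviving_def using fk_weight_eq_survival[OF that]
        by (subst kernel[OF that]) (auto intro!: nn_integral_cong_AE elim!: eventually_mono)
      finally show ?thesis .
    qed
    have "i = (\<integral>\<^sup>+s\<in>{0..t}. surviving s (npowr (\<beta> - \<alpha>)) \<partial>lborel)"
      unfolding i_def by (rule nn_integral_Icc_cong_Ioo) (simp add: moment)
    then show ?thesis
      using enn2real_surviving_npowr[OF \<beta> t] surviving_npowr_finite[OF \<beta> t] surviving_npowr_potential_finite[OF \<beta> t]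
      by (simp add: m_def moment[OF t])
  qed
  then show "m < \<infinity>" "i < \<infinity>"
    "enn2real m = norm x powr \<beta> + (kappa DIM('a) \<alpha> \<delta> - kappa DIM('a) \<alpha> \<beta>) * enn2real i"
    by blast+
qed

theorem theorem2p4:
  fixes \<alpha> \<delta> :: real
    and pt :: "real \<Rightarrow> 'a::euclidean_space \<Rightarrow> 'a \<Rightarrow> real"
  assumes "0 < \<alpha>" and "\<alpha> < min (real DIM('a)) 2"
    and "0 < \<delta>" and "\<delta> < \<alpha>"
    and "is_fk_kernel \<alpha> \<delta> pt TYPE('b)"
  shows "(\<forall>\<beta>. 0 < \<beta> \<and> \<beta> < \<alpha> \<longrightarrow> (\<forall>t>0. \<forall>x::'a.
            (\<integral>\<^sup>+ y. ennreal (pt t x y * norm y powr \<beta>) \<partial>lborel) < \<infinity> \<and>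
            (\<integral>\<^sup>+ s. indicator {0..t} s *
                 (\<integral>\<^sup>+ y. ennreal (pt s x y * norm y powr (\<beta> - \<alpha>)) \<partial>lborel) \<partial>lborel) < \<infinity> \<and>
            enn2real (\<integral>\<^sup>+ y. ennreal (pt t x y * norm y powr \<beta>) \<partial>lborel) =
              norm x powr \<beta> + (kappa DIM('a) \<alpha> \<delta> - kappa DIM('a) \<alpha> \<beta>) *
              enn2real (\<integral>\<^sup>+ s. indicator {0..t} s *
                 (\<integral>\<^sup>+ y. ennreal (pt s x y * norm y powr (\<beta> - \<alpha>)) \<partial>lborel) \<partial>lborel)))
       \<and> (\<forall>t>0. \<forall>x::'a.
            (\<integral>\<^sup>+ y. ennreal (pt t x y * norm y powr \<delta>) \<partial>lborel) = ennreal (norm x powr \<delta>))"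
proof (intro conjI allI impI)
  fix t :: real and x :: 'a assume t: "t > 0"
  have "enn2real (\<integral>\<^sup>+ y. ennreal (pt t x y * norm y powr \<delta>) \<partial>lborel) = norm x powr \<delta>"
    using fk_kernel_moment_identity[OF assms assms(3,4) t, of x] by simp
  then show "(\<integral>\<^sup>+ y. ennreal (pt t x y * norm y powr \<delta>) \<partial>lborel) = ennreal (norm x powr \<delta>)"
    using fk_kernel_moment_finite[OF assms assms(3,4) t, of x] by (metis ennreal_enn2real infinity_ennreal_def)
qed (use fk_kernel_moment_finite[OF assms] fk_kernel_potential_finite[OF assms] fk_kernel_moment_identity[OF assms] in
    \<open>simp_all add: mult.commute[of "indicator _ _"]\<close>)

end
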